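(* Inertial continuous machines form a subalgebra $\mathsf{Mch}^{\mathrm{in}}\colon\mathcal{W}_{\widetilde{\mathrm{Int}}}\to\mathbf{Cat}$ of the algebra $\mathsf{Mch}$ of continuous machines; for any $\epsilon>0$, $\epsilon$-inertial continuous machines form a subalgebra $\mathsf{Mch}^{\epsilon\text{-}\mathrm{in}}\colon\mathcal{W}_{\widetilde{\mathrm{Int}}}\to\mathbf{Cat}$ of $\mathsf{Mch}$. Moreover, there is a colimit of algebras $$\mathsf{Mch}^{\mathrm{in}}\cong\operatorname*{colim}_{\epsilon>0}\mathsf{Mch}^{\epsilon\text{-}\mathrm{in}}$$ over the directed system of inclusions $\mathsf{Mch}^{\epsilon\text{-}\mathrm{in}}\hookrightarrow\mathsf{Mch}^{\delta\text{-}\mathrm{in}}$ for $0<\delta\le\epsilon$.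
   Context: Interval sheaves. $\mathrm{Int}$ is the category with objects $\ell\in\mathbb{R}_{\ge0}$, morphisms $\ell'\to\ell$ the symbols $\mathrm{Tr}_p$ with $p\in\mathbb{R}_{\ge0}$, $p\le\ell-\ell'$, composition $\mathrm{Tr}_p\circ\mathrm{Tr}_{p'}=\mathrm{Tr}_{p+p'}$, identities $\mathrm{Tr}_0$. For a presheaf $X$ and $x\in X(\ell)$, write $x|_{[p,p+\ell']}=X(\mathrm{Tr}_p)(x)$. A continuous interval sheaf is a presheaf $X$ on $\mathrm{Int}$ such that for all $x_1\in X(\ell_1)$, $x_2\in X(\ell_2)$ with $x_1|_{[\ell_1,\ell_1]}=x_2|_{[0,0]}$ there is a unique element of $X(\ell_1+\ell_2)$ restricting to $x_1$ on $[0,\ell_1]$ and to $x_2$ on $[\ell_1,\ell_1+\ell_2]$. $\widetilde{\mathrm{Int}}$ is the topos of such sheaves. For $\epsilon\ge0$, $(\mathsf{Ext}_\epsilon A)(\ell)=A(\ell+\epsilon)$ defines $\mathsf{Ext}_\epsilon\colon\widetilde{\mathrm{Int}}\to\widetilde{\mathrm{Int}}$, and $\lambda\colon\mathsf{Ext}_\epsilon\Rightarrow\mathrm{id}$ is left restriction $x\mapsto x|_{[0,\ell]}$. A continuous $(A,B)$-machine is a sheaf map $(p^i,p^o)\colon S\to A\times B$. A sheaf map $p\colon S\to B$ is $\epsilon$-inertial if it factors as $S\xrightarrow{\bar p}\mathsf{Ext}_\epsilon B\xrightarrow{\lambda}B$ for some sheaf map $\bar p$, and inertial if it is $\epsilon$-inertial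 for some $\epsilon>0$. A machine $(p^i,p^o)$ is inertial (resp. $\epsilon$-inertial) if $p^o$ is. Wiring diagrams, with $\mathcal{C}=\widetilde{\mathrm{Int}}$. A $\mathcal{C}$-typed finite set is a finite set $X$ with $\tau\colon X\to\mathrm{ob}\,\mathcal{C}$; typed functions preserve types; $\widehat{X}=\prod_{x\in X}\tau(x)$; a typed function $f\colon X\to X'$ induces $\widehat{f}\colon\widehat{X'}\to\widehat{X}$ by reindexing. $\mathcal{W}_{\mathcal{C}}$ is the symmetric monoidal category whose objects (boxes) are pairs $X=(X^{\mathrm{in}},X^{\mathrm{out}})$ of $\mathcal{C}$-typed finite sets and whose morphisms (wiring diagrams) $\phi\colon X\to Y$ are pairs of typed functions $\phi^{\mathrm{in}}\colon X^{\mathrm{in}}\to X^{\mathrm{out}}+Y^{\mathrm{in}}$, $\phi^{\mathrm{out}}\colon Y^{\mathrm{out}}\to X^{\mathrm{out}}$. The composite $\omega=\psi\circ\phi$ has $\omega^{\mathrm{out}}=\phi^{\mathrm{out}}\circ\psi^{\mathrm{out}}$ and $\omega^{\mathrm{in}}=(\nabla+1)\circ(1+\phi^{\mathrm{out}}+1)\circ(1+\psi^{\mathrm{in}})\circ\phi^{\mathrm{in}}$; the identity is (coproduct inclusion, identity). The tensor $\oplus$ is componentwise disjoint union with unit $0=(\emptyset,\emptyset)$. $\phi$ induces $\widehat{\phi^{\mathrm{in}}}\colon\widehat{Y^{\mathrm{in}}}\times\widehat{X^{\mathrm{out}}}\to\widehat{X^{\mathrm{in}}}$ and $\widehat{\phi^{\mathrm{out}}}\colon\widehat{X^{\mathrm{out}}}\to\widehat{Y^{\mathrm{out}}}$.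 A $\mathcal{W}_{\mathcal{C}}$-algebra is a symmetric lax monoidal functor $(\mathcal{W}_{\mathcal{C}},\oplus,0)\to(\mathbf{Cat},\times,\mathbf{1})$, in the pseudo sense (axioms up to coherent natural isomorphism); maps of algebras are monoidal (pseudo)natural transformations. The algebra $\mathsf{Mch}$ has $\mathsf{Mch}(X)=\widetilde{\mathrm{Int}}/(\widehat{X^{\mathrm{in}}}\times\widehat{X^{\mathrm{out}}})$; $\mathsf{Mch}(\phi)$ pulls a machine back along $(\widehat{\phi^{\mathrm{in}}},\pi_2)\colon\widehat{Y^{\mathrm{in}}}\times\widehat{X^{\mathrm{out}}}\to\widehat{X^{\mathrm{in}}}\times\widehat{X^{\mathrm{out}}}$ and postcomposes with $1\times\widehat{\phi^{\mathrm{out}}}$; the lax structure is cartesian product of spans. A class of machines forms a subalgebra if the corresponding full subcategories of $\mathsf{Mch}(X)$ are preserved by all $\mathsf{Mch}(\phi)$ and by the lax monoidal structure maps (including the unit). *)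

theory Defs
  imports Complex_Main "HOL-Library.FuncSet"
begin

section \<open>Categories, functors, slices\<close>

record ('o, 'm) cat =
  Obj :: "'o set"
  Arr :: "'m set"
  src :: "'m \<Rightarrow> 'o"
  trg :: "'m \<Rightarrow> 'o"
  idn :: "'o \<Rightarrow> 'm"
  cmp :: "'m \<Rightarrow> 'm \<Rightarrow> 'm" (infixr "\<cdot>\<index>" 70)

definition hom :: "('o, 'm, 'z) cat_scheme \<Rightarrow> 'o \<Rightarrow> 'o \<Rightarrow> 'm set" where
  "hom C A B = {f \<in> Arr C. src C f = A \<and> trg C f = B}"

definition isos :: "('o, 'm, 'z) cat_scheme \<Rightarrow> 'o \<Rightarrow> 'o \<Rightarrow> 'm set" where
  "isos C A B = {f \<in> hom C A B. \<exists>g \<in> hom C B A. g \<cdot>\<^bsub>C\<^esub> f = idn C A \<and> f \<cdot>\<^bsub>C\<^esub> g = idn C B}"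

locale category =
  fixes C :: "('o, 'm, 'z) cat_scheme" (structure)
  assumes src_obj: "f \<in> Arr C \<Longrightarrow> src C f \<in> Obj C"
    and trg_obj: "f \<in> Arr C \<Longrightarrow> trg C f \<in> Obj C"
    and idn_hom: "A \<in> Obj C \<Longrightarrow> idn C A \<in> hom C A A"
    and cmp_hom: "\<lbrakk>f \<in> hom C A B; g \<in> hom C B D\<rbrakk> \<Longrightarrow> g \<cdot> f \<in> hom C A D"
    and idn_left: "f \<in> hom C A B \<Longrightarrow> idn C B \<cdot> f = f"
    and idn_right: "f \<in> hom C A B \<Longrightarrow> f \<cdot> idn C A = f"
    and cmp_assoc: "\<lbrakk>f \<in> hom C A B; g \<in> hom C B D; h \<in> hom C D E\<rbrakk>
      \<Longrightarrow> (h \<cdot> g) \<cdot> f = h \<cdot> (g \<cdot> f)"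

definition is_functor ::
  "('o, 'm, 'y) cat_scheme \<Rightarrow> ('p, 'n, 'z) cat_scheme \<Rightarrow> ('o \<Rightarrow> 'p) \<Rightarrow> ('m \<Rightarrow> 'n) \<Rightarrow> bool" where
  "is_functor C D Fo Fa \<longleftrightarrow>
     (\<forall>A \<in> Obj C. Fo A \<in> Obj D \<and> Fa (idn C A) = idn D (Fo A)) \<and>
     (\<forall>A B f. f \<in> hom C A B \<longrightarrow> Fa f \<in> hom D (Fo A) (Fo B)) \<and>
     (\<forall>A B E f g. f \<in> hom C A B \<longrightarrow> g \<in> hom C B E \<longrightarrow>
        Fa (g \<cdot>\<^bsub>C\<^esub> f) = Fa g \<cdot>\<^bsub>D\<^esub> Fa f)"

definition full_subcat :: "('o, 'm) cat \<Rightarrow> ('o \<Rightarrow> bool) \<Rightarrow> ('o, 'm) cat" where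
  "full_subcat C P = C\<lparr>Obj := {A \<in> Obj C. P A},
     Arr := {f \<in> Arr C. P (src C f) \<and> P (trg C f)}\<rparr>"

text \<open>An arrow of a slice is the triple of its source, its target and the underlying arrow.\<close>

definition slice :: "('o, 'm, 'z) cat_scheme \<Rightarrow> 'o \<Rightarrow> ('m, 'm \<times> 'm \<times> 'm) cat" where
  "slice C B = \<lparr>
     Obj = {p \<in> Arr C. trg C p = B},
     Arr = {(p, q, h). p \<in> Arr C \<and> trg C p = B \<and> q \<in> Arr C \<and> trg C q = B \<and>
                       h \<in> hom C (src C p) (src C q) \<and> q \<cdot>\<^bsub>C\<^esub> h = p},
     src = (\<lambda>(p, q, h). p),
     trg = (\<lambda>(p, q, h). q),
     idn = (\<lambda>p. (p, p, idn C (src C p))),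
     cmp = (\<lambda>(q, r, k) (p, q', h). (p, r, k \<cdot>\<^bsub>C\<^esub> h))\<rparr>"


section \<open>Symmetric monoidal categories\<close>

record ('o, 'm) smcat = "('o, 'm) cat" +
  ten :: "'o \<Rightarrow> 'o \<Rightarrow> 'o" (infixr "\<boxplus>\<index>" 65)
  tenA :: "'m \<Rightarrow> 'm \<Rightarrow> 'm" (infixr "\<boxtimes>\<index>" 65)
  unit_obj :: "'o"
  assoc :: "'o \<Rightarrow> 'o \<Rightarrow> 'o \<Rightarrow> 'm"
  lunit :: "'o \<Rightarrow> 'm"
  runit :: "'o \<Rightarrow> 'm"
  braid :: "'o \<Rightarrow> 'o \<Rightarrow> 'm"

locale symmetric_monoidal = category V
  for V :: "('o, 'm) smcat" (structure) +
  assumes ten_obj: "\<lbrakk>X \<in> Obj V; Y \<in> Obj V\<rbrakk> \<Longrightarrow> X \<boxplus> Y \<in> Obj V"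
    and tenA_hom: "\<lbrakk>f \<in> hom V X Y; f' \<in> hom V X' Y'\<rbrakk> \<Longrightarrow> f \<boxtimes> f' \<in> hom V (X \<boxplus> X') (Y \<boxplus> Y')"
    and tenA_idn: "\<lbrakk>X \<in> Obj V; Y \<in> Obj V\<rbrakk> \<Longrightarrow> idn V X \<boxtimes> idn V Y = idn V (X \<boxplus> Y)"
    and tenA_cmp: "\<lbrakk>f \<in> hom V X Y; g \<in> hom V Y Z; f' \<in> hom V X' Y'; g' \<in> hom V Y' Z'\<rbrakk>
      \<Longrightarrow> (g \<cdot> f) \<boxtimes> (g' \<cdot> f') = (g \<boxtimes> g') \<cdot> (f \<boxtimes> f')"
    and unit_obj_obj: "unit_obj V \<in> Obj V"
    and assoc_iso: "\<lbrakk>X \<in> Obj V; Y \<in> Obj V; Z \<in> Obj V\<rbrakk>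
      \<Longrightarrow> assoc V X Y Z \<in> isos V ((X \<boxplus> Y) \<boxplus> Z) (X \<boxplus> (Y \<boxplus> Z))"
    and assoc_nat: "\<lbrakk>f \<in> hom V X X'; g \<in> hom V Y Y'; h \<in> hom V Z Z'\<rbrakk>
      \<Longrightarrow> assoc V X' Y' Z' \<cdot> ((f \<boxtimes> g) \<boxtimes> h) = (f \<boxtimes> (g \<boxtimes> h)) \<cdot> assoc V X Y Z"
    and lunit_iso: "X \<in> Obj V \<Longrightarrow> lunit V X \<in> isos V (unit_obj V \<boxplus> X) X"
    and lunit_nat: "f \<in> hom V X Y \<Longrightarrow> lunit V Y \<cdot> (idn V (unit_obj V) \<boxtimes> f) = f \<cdot> lunit V X"
    and runit_iso: "X \<in> Obj V \<Longrightarrow> runit V X \<in> isos V (X \<boxplus> unit_obj V) X"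
    and runit_nat: "f \<in> hom V X Y \<Longrightarrow> runit V Y \<cdot> (f \<boxtimes> idn V (unit_obj V)) = f \<cdot> runit V X"
    and braid_hom: "\<lbrakk>X \<in> Obj V; Y \<in> Obj V\<rbrakk> \<Longrightarrow> braid V X Y \<in> hom V (X \<boxplus> Y) (Y \<boxplus> X)"
    and braid_nat: "\<lbrakk>f \<in> hom V X X'; g \<in> hom V Y Y'\<rbrakk>
      \<Longrightarrow> braid V X' Y' \<cdot> (f \<boxtimes> g) = (g \<boxtimes> f) \<cdot> braid V X Y"
    and braid_sym: "\<lbrakk>X \<in> Obj V; Y \<in> Obj V\<rbrakk> \<Longrightarrow> braid V Y X \<cdot> braid V X Y = idn V (X \<boxplus> Y)"
    and pentagon: "\<lbrakk>X \<in> Obj V; Y \<in> Obj V; Z \<in> Obj V; U \<in> Obj V\<rbrakk>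
      \<Longrightarrow> (idn V X \<boxtimes> assoc V Y Z U) \<cdot> assoc V X (Y \<boxplus> Z) U \<cdot> (assoc V X Y Z \<boxtimes> idn V U)
        = assoc V X Y (Z \<boxplus> U) \<cdot> assoc V (X \<boxplus> Y) Z U"
    and triangle: "\<lbrakk>X \<in> Obj V; Y \<in> Obj V\<rbrakk>
      \<Longrightarrow> (idn V X \<boxtimes> lunit V Y) \<cdot> assoc V X (unit_obj V) Y = runit V X \<boxtimes> idn V Y"
    and hexagon: "\<lbrakk>X \<in> Obj V; Y \<in> Obj V; Z \<in> Obj V\<rbrakk>
      \<Longrightarrow> (idn V Y \<boxtimes> braid V X Z) \<cdot> assoc V Y X Z \<cdot> (braid V X Y \<boxtimes> idn V Z)
        = assoc V Y Z X \<cdot> braid V X (Y \<boxplus> Z) \<cdot> assoc V X Y Z"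


section \<open>Algebras: symmetric lax monoidal pseudofunctors to categories\<close>

text \<open>
  An algebra \<open>F\<close> over a symmetric monoidal category \<open>V\<close> consists of categories \<open>F X\<close>
  (\<open>fib\<close>), functors \<open>F \<phi>\<close> (\<open>act\<close>, \<open>actA\<close>), laxators \<open>\<mu> : F X \<times> F Y \<rightarrow> F (X \<boxplus> Y)\<close>
  (\<open>mu\<close>, \<open>muA\<close>), a unit object of \<open>F 1\<close> (\<open>eta\<close>), and the invertible cells

  \<^item> \<open>fcmp \<psi> \<phi> A : F (\<psi> \<cdot> \<phi>) A \<rightarrow> F \<psi> (F \<phi> A)\<close> and \<open>fidn X A : F (id X) A \<rightarrow> A\<close>,
  \<^item> \<open>muN \<phi> \<phi>' A A' : F (\<phi> \<boxtimes> \<phi>') (\<mu> A A') \<rightarrow> \<mu> (F \<phi> A) (F \<phi>' A')\<close>,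
  \<^item> \<open>mu_assoc A B C : F \<alpha> (\<mu> (\<mu> A B) C) \<rightarrow> \<mu> A (\<mu> B C)\<close>, \<open>mu_braid A B : F \<beta> (\<mu> A B) \<rightarrow> \<mu> B A\<close>,
  \<^item> \<open>mu_lunit A : F \<lambda> (\<mu> \<eta> A) \<rightarrow> A\<close>, \<open>mu_runit A : F \<rho> (\<mu> A \<eta>) \<rightarrow> A\<close>.

  As all cells are invertible, their direction is a convention; with this one all the pasting
  diagrams below can be written without inverses.
\<close>

record ('v, 'w, 'o, 'm) alg =
  fib :: "'v \<Rightarrow> ('o, 'm) cat"
  act :: "'w \<Rightarrow> 'o \<Rightarrow> 'o"
  actA :: "'w \<Rightarrow> 'm \<Rightarrow> 'm"
  fcmp :: "'w \<Rightarrow> 'w \<Rightarrow> 'o \<Rightarrow> 'm"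
  fidn :: "'v \<Rightarrow> 'o \<Rightarrow> 'm"
  mu :: "'v \<Rightarrow> 'v \<Rightarrow> 'o \<Rightarrow> 'o \<Rightarrow> 'o"
  muA :: "'v \<Rightarrow> 'v \<Rightarrow> 'm \<Rightarrow> 'm \<Rightarrow> 'm"
  muN :: "'w \<Rightarrow> 'w \<Rightarrow> 'o \<Rightarrow> 'o \<Rightarrow> 'm"
  eta :: "'o"
  mu_assoc :: "'v \<Rightarrow> 'v \<Rightarrow> 'v \<Rightarrow> 'o \<Rightarrow> 'o \<Rightarrow> 'o \<Rightarrow> 'm"
  mu_lunit :: "'v \<Rightarrow> 'o \<Rightarrow> 'm"
  mu_runit :: "'v \<Rightarrow> 'o \<Rightarrow> 'm"
  mu_braid :: "'v \<Rightarrow> 'v \<Rightarrow> 'o \<Rightarrow> 'o \<Rightarrow> 'm"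

text \<open>
  Pasting. A triple \<open>(\<phi>, A, f)\<close> stands for an arrow \<open>f : F \<phi> A \<rightarrow> B\<close> of \<open>F Y\<close>, where
  \<open>\<phi> : X \<rightarrow> Y\<close> and \<open>A\<close> is an object of \<open>F X\<close>. Such triples paste along composition
  (\<open>F (\<psi> \<cdot> \<phi>) A \<rightarrow> F \<psi> (F \<phi> A) \<rightarrow> F \<psi> B \<rightarrow> C\<close>) and along the tensor
  (\<open>F (\<phi> \<boxtimes> \<phi>') (\<mu> A A') \<rightarrow> \<mu> (F \<phi> A) (F \<phi>' A') \<rightarrow> \<mu> B B'\<close>).
\<close>

definition pcmp :: "('v, 'w) smcat \<Rightarrow> ('v, 'w, 'o, 'm) alg \<Rightarrow>
    'w \<times> 'o \<times> 'm \<Rightarrow> 'w \<times> 'o \<times> 'm \<Rightarrow> 'w \<times> 'o \<times> 'm" where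
  "pcmp V F = (\<lambda>(\<psi>, B, g) (\<phi>, A, f).
     let Z = fib F (trg V \<psi>) in (\<psi> \<cdot>\<^bsub>V\<^esub> \<phi>, A, g \<cdot>\<^bsub>Z\<^esub> actA F \<psi> f \<cdot>\<^bsub>Z\<^esub> fcmp F \<psi> \<phi> A))"

definition pten :: "('v, 'w) smcat \<Rightarrow> ('v, 'w, 'o, 'm) alg \<Rightarrow>
    'w \<times> 'o \<times> 'm \<Rightarrow> 'w \<times> 'o \<times> 'm \<Rightarrow> 'w \<times> 'o \<times> 'm" where
  "pten V F = (\<lambda>(\<phi>, A, f) (\<phi>', A', f').
     let Y = trg V \<phi>; Y' = trg V \<phi>'; X = src V \<phi>; X' = src V \<phi>' in
     (\<phi> \<boxtimes>\<^bsub>V\<^esub> \<phi>', mu F X X' A A',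
      muA F Y Y' f f' \<cdot>\<^bsub>fib F (Y \<boxplus>\<^bsub>V\<^esub> Y')\<^esub> muN F \<phi> \<phi>' A A'))"

locale alg_data =
  fixes V :: "('v, 'w) smcat" (structure) and F :: "('v, 'w, 'o, 'm) alg"
begin

abbreviation pc (infixr "\<odot>" 70) where "pc \<equiv> pcmp V F"
abbreviation pt (infixr "\<circledast>" 75) where "pt \<equiv> pten V F"

abbreviation "p1 \<phi> A \<equiv> (\<phi>, A, idn (fib F (trg V \<phi>)) (act F \<phi> A))"
abbreviation "pI X A \<equiv> (idn V X, A, fidn F X A)"
abbreviation "pa X Y Z A B C \<equiv>
  (assoc V X Y Z, mu F (X \<boxplus> Y) Z (mu F X Y A B) C, mu_assoc F X Y Z A B C)"
abbreviation "pl X A \<equiv> (lunit V X, mu F (unit_obj V) X (eta F) A, mu_lunit F X A)"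
abbreviation "pr X A \<equiv> (runit V X, mu F X (unit_obj V) A (eta F), mu_runit F X A)"
abbreviation "pb X Y A B \<equiv> (braid V X Y, mu F X Y A B, mu_braid F X Y A B)"

end

locale lax_algebra = symmetric_monoidal V + alg_data V F
  for V :: "('v, 'w) smcat" (structure) and F :: "('v, 'w, 'o, 'm) alg" +
  assumes fib_category: "X \<in> Obj V \<Longrightarrow> category (fib F X)"
    and act_functor: "\<phi> \<in> hom V X Y \<Longrightarrow> is_functor (fib F X) (fib F Y) (act F \<phi>) (actA F \<phi>)"
    and fcmp_iso: "\<lbrakk>\<phi> \<in> hom V X Y; \<psi> \<in> hom V Y Z; A \<in> Obj (fib F X)\<rbrakk>
      \<Longrightarrow> fcmp F \<psi> \<phi> A \<in> isos (fib F Z) (act F (\<psi> \<cdot> \<phi>) A) (act F \<psi> (act F \<phi> A))"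
    and fcmp_nat: "\<lbrakk>\<phi> \<in> hom V X Y; \<psi> \<in> hom V Y Z; a \<in> hom (fib F X) A A'\<rbrakk>
      \<Longrightarrow> fcmp F \<psi> \<phi> A' \<cdot>\<^bsub>fib F Z\<^esub> actA F (\<psi> \<cdot> \<phi>) a
        = actA F \<psi> (actA F \<phi> a) \<cdot>\<^bsub>fib F Z\<^esub> fcmp F \<psi> \<phi> A"
    and fidn_iso: "\<lbrakk>X \<in> Obj V; A \<in> Obj (fib F X)\<rbrakk>
      \<Longrightarrow> fidn F X A \<in> isos (fib F X) (act F (idn V X) A) A"
    and fidn_nat: "\<lbrakk>X \<in> Obj V; a \<in> hom (fib F X) A A'\<rbrakk>
      \<Longrightarrow> fidn F X A' \<cdot>\<^bsub>fib F X\<^esub> actA F (idn V X) a = a \<cdot>\<^bsub>fib F X\<^esub> fidn F X A"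
    and fcmp_assoc:
      "\<lbrakk>\<phi> \<in> hom V X Y; \<psi> \<in> hom V Y Z; \<chi> \<in> hom V Z U; A \<in> Obj (fib F X)\<rbrakk>
      \<Longrightarrow> actA F \<chi> (fcmp F \<psi> \<phi> A) \<cdot>\<^bsub>fib F U\<^esub> fcmp F \<chi> (\<psi> \<cdot> \<phi>) A
        = fcmp F \<chi> \<psi> (act F \<phi> A) \<cdot>\<^bsub>fib F U\<^esub> fcmp F (\<chi> \<cdot> \<psi>) \<phi> A"
    and fcmp_fidn_left: "\<lbrakk>\<phi> \<in> hom V X Y; A \<in> Obj (fib F X)\<rbrakk>
      \<Longrightarrow> fidn F Y (act F \<phi> A) \<cdot>\<^bsub>fib F Y\<^esub> fcmp F (idn V Y) \<phi> A = idn (fib F Y) (act F \<phi> A)"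
    and fcmp_fidn_right: "\<lbrakk>\<phi> \<in> hom V X Y; A \<in> Obj (fib F X)\<rbrakk>
      \<Longrightarrow> actA F \<phi> (fidn F X A) \<cdot>\<^bsub>fib F Y\<^esub> fcmp F \<phi> (idn V X) A = idn (fib F Y) (act F \<phi> A)"

    and mu_obj: "\<lbrakk>X \<in> Obj V; Y \<in> Obj V; A \<in> Obj (fib F X); B \<in> Obj (fib F Y)\<rbrakk>
      \<Longrightarrow> mu F X Y A B \<in> Obj (fib F (X \<boxplus> Y))"
    and muA_hom: "\<lbrakk>X \<in> Obj V; Y \<in> Obj V; a \<in> hom (fib F X) A A'; b \<in> hom (fib F Y) B B'\<rbrakk>
      \<Longrightarrow> muA F X Y a b \<in> hom (fib F (X \<boxplus> Y)) (mu F X Y A B) (mu F X Y A' B')"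
    and muA_idn: "\<lbrakk>X \<in> Obj V; Y \<in> Obj V; A \<in> Obj (fib F X); B \<in> Obj (fib F Y)\<rbrakk>
      \<Longrightarrow> muA F X Y (idn (fib F X) A) (idn (fib F Y) B) = idn (fib F (X \<boxplus> Y)) (mu F X Y A B)"
    and muA_cmp: "\<lbrakk>X \<in> Obj V; Y \<in> Obj V; a \<in> hom (fib F X) A A'; a' \<in> hom (fib F X) A' A'';
        b \<in> hom (fib F Y) B B'; b' \<in> hom (fib F Y) B' B''\<rbrakk>
      \<Longrightarrow> muA F X Y (a' \<cdot>\<^bsub>fib F X\<^esub> a) (b' \<cdot>\<^bsub>fib F Y\<^esub> b)
        = muA F X Y a' b' \<cdot>\<^bsub>fib F (X \<boxplus> Y)\<^esub> muA F X Y a b"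
    and muN_iso: "\<lbrakk>\<phi> \<in> hom V X Y; \<phi>' \<in> hom V X' Y'; A \<in> Obj (fib F X); A' \<in> Obj (fib F X')\<rbrakk>
      \<Longrightarrow> muN F \<phi> \<phi>' A A' \<in> isos (fib F (Y \<boxplus> Y'))
             (act F (\<phi> \<boxtimes> \<phi>') (mu F X X' A A')) (mu F Y Y' (act F \<phi> A) (act F \<phi>' A'))"
    and muN_nat: "\<lbrakk>\<phi> \<in> hom V X Y; \<phi>' \<in> hom V X' Y';
        a \<in> hom (fib F X) A B; a' \<in> hom (fib F X') A' B'\<rbrakk>
      \<Longrightarrow> muN F \<phi> \<phi>' B B' \<cdot>\<^bsub>fib F (Y \<boxplus> Y')\<^esub> actA F (\<phi> \<boxtimes> \<phi>') (muA F X X' a a')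
        = muA F Y Y' (actA F \<phi> a) (actA F \<phi>' a') \<cdot>\<^bsub>fib F (Y \<boxplus> Y')\<^esub> muN F \<phi> \<phi>' A A'"
    and muN_cmp: "\<lbrakk>\<phi> \<in> hom V X Y; \<psi> \<in> hom V Y Z; \<phi>' \<in> hom V X' Y'; \<psi>' \<in> hom V Y' Z';
        A \<in> Obj (fib F X); A' \<in> Obj (fib F X')\<rbrakk>
      \<Longrightarrow> muN F \<psi> \<psi>' (act F \<phi> A) (act F \<phi>' A') \<cdot>\<^bsub>fib F (Z \<boxplus> Z')\<^esub>
            actA F (\<psi> \<boxtimes> \<psi>') (muN F \<phi> \<phi>' A A') \<cdot>\<^bsub>fib F (Z \<boxplus> Z')\<^esub>
            fcmp F (\<psi> \<boxtimes> \<psi>') (\<phi> \<boxtimes> \<phi>') (mu F X X' A A')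
        = muA F Z Z' (fcmp F \<psi> \<phi> A) (fcmp F \<psi>' \<phi>' A') \<cdot>\<^bsub>fib F (Z \<boxplus> Z')\<^esub>
            muN F (\<psi> \<cdot> \<phi>) (\<psi>' \<cdot> \<phi>') A A'"
    and muN_idn: "\<lbrakk>X \<in> Obj V; Y \<in> Obj V; A \<in> Obj (fib F X); B \<in> Obj (fib F Y)\<rbrakk>
      \<Longrightarrow> muA F X Y (fidn F X A) (fidn F Y B) \<cdot>\<^bsub>fib F (X \<boxplus> Y)\<^esub> muN F (idn V X) (idn V Y) A B
        = fidn F (X \<boxplus> Y) (mu F X Y A B)"
    and eta_obj: "eta F \<in> Obj (fib F (unit_obj V))"

  \<comment> \<open>A modification is natural in the arrows of the fibres (\<open>_nat\<close>) and compatible with the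
      pseudonaturality cells of the laxators (\<open>_mod\<close>).\<close>
    and mu_assoc_iso: "\<lbrakk>X \<in> Obj V; Y \<in> Obj V; Z \<in> Obj V;
        A \<in> Obj (fib F X); B \<in> Obj (fib F Y); C \<in> Obj (fib F Z)\<rbrakk>
      \<Longrightarrow> mu_assoc F X Y Z A B C \<in> isos (fib F (X \<boxplus> (Y \<boxplus> Z)))
            (act F (assoc V X Y Z) (mu F (X \<boxplus> Y) Z (mu F X Y A B) C))
            (mu F X (Y \<boxplus> Z) A (mu F Y Z B C))"
    and mu_assoc_nat: "\<lbrakk>X \<in> Obj V; Y \<in> Obj V; Z \<in> Obj V;
        a \<in> hom (fib F X) A A'; b \<in> hom (fib F Y) B B'; c \<in> hom (fib F Z) C C'\<rbrakk>
      \<Longrightarrow> mu_assoc F X Y Z A' B' C' \<cdot>\<^bsub>fib F (X \<boxplus> (Y \<boxplus> Z))\<^esub>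
            actA F (assoc V X Y Z) (muA F (X \<boxplus> Y) Z (muA F X Y a b) c)
        = muA F X (Y \<boxplus> Z) a (muA F Y Z b c) \<cdot>\<^bsub>fib F (X \<boxplus> (Y \<boxplus> Z))\<^esub> mu_assoc F X Y Z A B C"
    and mu_assoc_mod: "\<lbrakk>\<phi> \<in> hom V X X'; \<psi> \<in> hom V Y Y'; \<chi> \<in> hom V Z Z';
        A \<in> Obj (fib F X); B \<in> Obj (fib F Y); C \<in> Obj (fib F Z)\<rbrakk>
      \<Longrightarrow> pa X' Y' Z' (act F \<phi> A) (act F \<psi> B) (act F \<chi> C) \<odot> ((p1 \<phi> A \<circledast> p1 \<psi> B) \<circledast> p1 \<chi> C)
        = (p1 \<phi> A \<circledast> (p1 \<psi> B \<circledast> p1 \<chi> C)) \<odot> pa X Y Z A B C"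
    and mu_lunit_iso: "\<lbrakk>X \<in> Obj V; A \<in> Obj (fib F X)\<rbrakk>
      \<Longrightarrow> mu_lunit F X A \<in> isos (fib F X) (act F (lunit V X) (mu F (unit_obj V) X (eta F) A)) A"
    and mu_lunit_nat: "\<lbrakk>X \<in> Obj V; a \<in> hom (fib F X) A A'\<rbrakk>
      \<Longrightarrow> mu_lunit F X A' \<cdot>\<^bsub>fib F X\<^esub>
            actA F (lunit V X) (muA F (unit_obj V) X (idn (fib F (unit_obj V)) (eta F)) a)
        = a \<cdot>\<^bsub>fib F X\<^esub> mu_lunit F X A"
    and mu_lunit_mod: "\<lbrakk>\<phi> \<in> hom V X X'; A \<in> Obj (fib F X)\<rbrakk>
      \<Longrightarrow> pl X' (act F \<phi> A) \<odot> (pI (unit_obj V) (eta F) \<circledast> p1 \<phi> A) = p1 \<phi> A \<odot> pl X A"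
    and mu_runit_iso: "\<lbrakk>X \<in> Obj V; A \<in> Obj (fib F X)\<rbrakk>
      \<Longrightarrow> mu_runit F X A \<in> isos (fib F X) (act F (runit V X) (mu F X (unit_obj V) A (eta F))) A"
    and mu_runit_nat: "\<lbrakk>X \<in> Obj V; a \<in> hom (fib F X) A A'\<rbrakk>
      \<Longrightarrow> mu_runit F X A' \<cdot>\<^bsub>fib F X\<^esub>
            actA F (runit V X) (muA F X (unit_obj V) a (idn (fib F (unit_obj V)) (eta F)))
        = a \<cdot>\<^bsub>fib F X\<^esub> mu_runit F X A"
    and mu_runit_mod: "\<lbrakk>\<phi> \<in> hom V X X'; A \<in> Obj (fib F X)\<rbrakk>
      \<Longrightarrow> pr X' (act F \<phi> A) \<odot> (p1 \<phi> A \<circledast> pI (unit_obj V) (eta F)) = p1 \<phi> A \<odot> pr X A"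
    and mu_braid_iso: "\<lbrakk>X \<in> Obj V; Y \<in> Obj V; A \<in> Obj (fib F X); B \<in> Obj (fib F Y)\<rbrakk>
      \<Longrightarrow> mu_braid F X Y A B \<in> isos (fib F (Y \<boxplus> X))
            (act F (braid V X Y) (mu F X Y A B)) (mu F Y X B A)"
    and mu_braid_nat: "\<lbrakk>X \<in> Obj V; Y \<in> Obj V; a \<in> hom (fib F X) A A'; b \<in> hom (fib F Y) B B'\<rbrakk>
      \<Longrightarrow> mu_braid F X Y A' B' \<cdot>\<^bsub>fib F (Y \<boxplus> X)\<^esub> actA F (braid V X Y) (muA F X Y a b)
        = muA F Y X b a \<cdot>\<^bsub>fib F (Y \<boxplus> X)\<^esub> mu_braid F X Y A B"
    and mu_braid_mod: "\<lbrakk>\<phi> \<in> hom V X X'; \<psi> \<in> hom V Y Y'; A \<in> Obj (fib F X); B \<in> Obj (fib F Y)\<rbrakk>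
      \<Longrightarrow> pb X' Y' (act F \<phi> A) (act F \<psi> B) \<odot> (p1 \<phi> A \<circledast> p1 \<psi> B)
        = (p1 \<psi> B \<circledast> p1 \<phi> A) \<odot> pb X Y A B"

    and mu_pentagon: "\<lbrakk>X \<in> Obj V; Y \<in> Obj V; Z \<in> Obj V; U \<in> Obj V;
        A \<in> Obj (fib F X); B \<in> Obj (fib F Y); C \<in> Obj (fib F Z); D \<in> Obj (fib F U)\<rbrakk>
      \<Longrightarrow> (pI X A \<circledast> pa Y Z U B C D) \<odot> pa X (Y \<boxplus> Z) U A (mu F Y Z B C) D \<odot>
            (pa X Y Z A B C \<circledast> pI U D)
        = pa X Y (Z \<boxplus> U) A B (mu F Z U C D) \<odot> pa (X \<boxplus> Y) Z U (mu F X Y A B) C D"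
    and mu_triangle: "\<lbrakk>X \<in> Obj V; Y \<in> Obj V; A \<in> Obj (fib F X); B \<in> Obj (fib F Y)\<rbrakk>
      \<Longrightarrow> (pI X A \<circledast> pl Y B) \<odot> pa X (unit_obj V) Y A (eta F) B = pr X A \<circledast> pI Y B"
    and mu_hexagon: "\<lbrakk>X \<in> Obj V; Y \<in> Obj V; Z \<in> Obj V;
        A \<in> Obj (fib F X); B \<in> Obj (fib F Y); C \<in> Obj (fib F Z)\<rbrakk>
      \<Longrightarrow> (pI Y B \<circledast> pb X Z A C) \<odot> pa Y X Z B A C \<odot> (pb X Y A B \<circledast> pI Z C)
        = pa Y Z X B C A \<odot> pb X (Y \<boxplus> Z) A (mu F Y Z B C) \<odot> pa X Y Z A B C"
    and mu_symmetry: "\<lbrakk>X \<in> Obj V; Y \<in> Obj V; A \<in> Obj (fib F X); B \<in> Obj (fib F Y)\<rbrakk>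
      \<Longrightarrow> pb Y X B A \<odot> pb X Y A B = pI (X \<boxplus> Y) (mu F X Y A B)"



section \<open>Maps of algebras, subalgebras, colimits\<close>

text \<open>
  A map of algebras \<open>\<alpha> : F \<rightarrow> G\<close> is a monoidal pseudonatural transformation: functors \<open>\<alpha> X\<close>
  (\<open>tr\<close>, \<open>trA\<close>) and invertible cells \<open>tr_act \<phi> A : G \<phi> (\<alpha> A) \<rightarrow> \<alpha> (F \<phi> A)\<close>,
  \<open>tr_mu A B : \<mu> (\<alpha> A) (\<alpha> B) \<rightarrow> \<alpha> (\<mu> A B)\<close> and \<open>tr_eta : \<eta> \<rightarrow> \<alpha> \<eta>\<close>.
\<close>

record ('v, 'w, 'o, 'p, 'm, 'n) alg_map =
  tr :: "'v \<Rightarrow> 'o \<Rightarrow> 'p"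
  trA :: "'v \<Rightarrow> 'm \<Rightarrow> 'n"
  tr_act :: "'w \<Rightarrow> 'o \<Rightarrow> 'n"
  tr_mu :: "'v \<Rightarrow> 'v \<Rightarrow> 'o \<Rightarrow> 'o \<Rightarrow> 'n"
  tr_eta :: "'n"

locale algebra_map = F: lax_algebra V F + G: lax_algebra V G
  for V :: "('v, 'w) smcat" (structure)
    and F :: "('v, 'w, 'o, 'm) alg" and G :: "('v, 'w, 'p, 'n) alg" +
  fixes T :: "('v, 'w, 'o, 'p, 'm, 'n) alg_map"
  assumes tr_functor: "X \<in> Obj V \<Longrightarrow> is_functor (fib F X) (fib G X) (tr T X) (trA T X)"
    and tr_act_iso: "\<lbrakk>\<phi> \<in> hom V X Y; A \<in> Obj (fib F X)\<rbrakk>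
      \<Longrightarrow> tr_act T \<phi> A \<in> isos (fib G Y) (act G \<phi> (tr T X A)) (tr T Y (act F \<phi> A))"
    and tr_act_nat: "\<lbrakk>\<phi> \<in> hom V X Y; a \<in> hom (fib F X) A A'\<rbrakk>
      \<Longrightarrow> tr_act T \<phi> A' \<cdot>\<^bsub>fib G Y\<^esub> actA G \<phi> (trA T X a)
        = trA T Y (actA F \<phi> a) \<cdot>\<^bsub>fib G Y\<^esub> tr_act T \<phi> A"
    and tr_act_cmp: "\<lbrakk>\<phi> \<in> hom V X Y; \<psi> \<in> hom V Y Z; A \<in> Obj (fib F X)\<rbrakk>
      \<Longrightarrow> trA T Z (fcmp F \<psi> \<phi> A) \<cdot>\<^bsub>fib G Z\<^esub> tr_act T (\<psi> \<cdot> \<phi>) A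
        = tr_act T \<psi> (act F \<phi> A) \<cdot>\<^bsub>fib G Z\<^esub> actA G \<psi> (tr_act T \<phi> A) \<cdot>\<^bsub>fib G Z\<^esub>
            fcmp G \<psi> \<phi> (tr T X A)"
    and tr_act_idn: "\<lbrakk>X \<in> Obj V; A \<in> Obj (fib F X)\<rbrakk>
      \<Longrightarrow> trA T X (fidn F X A) \<cdot>\<^bsub>fib G X\<^esub> tr_act T (idn V X) A = fidn G X (tr T X A)"
    and tr_mu_iso: "\<lbrakk>X \<in> Obj V; Y \<in> Obj V; A \<in> Obj (fib F X); B \<in> Obj (fib F Y)\<rbrakk>
      \<Longrightarrow> tr_mu T X Y A B \<in> isos (fib G (X \<boxplus> Y))
            (mu G X Y (tr T X A) (tr T Y B)) (tr T (X \<boxplus> Y) (mu F X Y A B))"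
    and tr_mu_nat: "\<lbrakk>X \<in> Obj V; Y \<in> Obj V; a \<in> hom (fib F X) A A'; b \<in> hom (fib F Y) B B'\<rbrakk>
      \<Longrightarrow> tr_mu T X Y A' B' \<cdot>\<^bsub>fib G (X \<boxplus> Y)\<^esub> muA G X Y (trA T X a) (trA T Y b)
        = trA T (X \<boxplus> Y) (muA F X Y a b) \<cdot>\<^bsub>fib G (X \<boxplus> Y)\<^esub> tr_mu T X Y A B"
    and tr_mu_mod: "\<lbrakk>\<phi> \<in> hom V X X'; \<psi> \<in> hom V Y Y'; A \<in> Obj (fib F X); B \<in> Obj (fib F Y)\<rbrakk>
      \<Longrightarrow> trA T (X' \<boxplus> Y') (muN F \<phi> \<psi> A B) \<cdot>\<^bsub>fib G (X' \<boxplus> Y')\<^esub>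
            tr_act T (\<phi> \<boxtimes> \<psi>) (mu F X Y A B) \<cdot>\<^bsub>fib G (X' \<boxplus> Y')\<^esub>
            actA G (\<phi> \<boxtimes> \<psi>) (tr_mu T X Y A B)
        = tr_mu T X' Y' (act F \<phi> A) (act F \<psi> B) \<cdot>\<^bsub>fib G (X' \<boxplus> Y')\<^esub>
            muA G X' Y' (tr_act T \<phi> A) (tr_act T \<psi> B) \<cdot>\<^bsub>fib G (X' \<boxplus> Y')\<^esub>
            muN G \<phi> \<psi> (tr T X A) (tr T Y B)"
    and tr_eta_iso: "tr_eta T \<in> isos (fib G (unit_obj V)) (eta G) (tr T (unit_obj V) (eta F))"
    and tr_mu_assoc: "\<lbrakk>X \<in> Obj V; Y \<in> Obj V; Z \<in> Obj V;
        A \<in> Obj (fib F X); B \<in> Obj (fib F Y); C \<in> Obj (fib F Z);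
        \<alpha> = assoc V X Y Z; W = fib G (X \<boxplus> (Y \<boxplus> Z))\<rbrakk>
      \<Longrightarrow> trA T (X \<boxplus> (Y \<boxplus> Z)) (mu_assoc F X Y Z A B C) \<cdot>\<^bsub>W\<^esub>
            tr_act T \<alpha> (mu F (X \<boxplus> Y) Z (mu F X Y A B) C) \<cdot>\<^bsub>W\<^esub>
            actA G \<alpha> (tr_mu T (X \<boxplus> Y) Z (mu F X Y A B) C) \<cdot>\<^bsub>W\<^esub>
            actA G \<alpha> (muA G (X \<boxplus> Y) Z (tr_mu T X Y A B) (idn (fib G Z) (tr T Z C)))
        = tr_mu T X (Y \<boxplus> Z) A (mu F Y Z B C) \<cdot>\<^bsub>W\<^esub>
            muA G X (Y \<boxplus> Z) (idn (fib G X) (tr T X A)) (tr_mu T Y Z B C) \<cdot>\<^bsub>W\<^esub>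
            mu_assoc G X Y Z (tr T X A) (tr T Y B) (tr T Z C)"
    and tr_mu_lunit: "\<lbrakk>X \<in> Obj V; A \<in> Obj (fib F X)\<rbrakk>
      \<Longrightarrow> trA T X (mu_lunit F X A) \<cdot>\<^bsub>fib G X\<^esub>
            tr_act T (lunit V X) (mu F (unit_obj V) X (eta F) A) \<cdot>\<^bsub>fib G X\<^esub>
            actA G (lunit V X) (tr_mu T (unit_obj V) X (eta F) A) \<cdot>\<^bsub>fib G X\<^esub>
            actA G (lunit V X) (muA G (unit_obj V) X (tr_eta T) (idn (fib G X) (tr T X A)))
        = mu_lunit G X (tr T X A)"
    and tr_mu_runit: "\<lbrakk>X \<in> Obj V; A \<in> Obj (fib F X)\<rbrakk>
      \<Longrightarrow> trA T X (mu_runit F X A) \<cdot>\<^bsub>fib G X\<^esub>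
            tr_act T (runit V X) (mu F X (unit_obj V) A (eta F)) \<cdot>\<^bsub>fib G X\<^esub>
            actA G (runit V X) (tr_mu T X (unit_obj V) A (eta F)) \<cdot>\<^bsub>fib G X\<^esub>
            actA G (runit V X) (muA G X (unit_obj V) (idn (fib G X) (tr T X A)) (tr_eta T))
        = mu_runit G X (tr T X A)"
    and tr_mu_braid: "\<lbrakk>X \<in> Obj V; Y \<in> Obj V; A \<in> Obj (fib F X); B \<in> Obj (fib F Y)\<rbrakk>
      \<Longrightarrow> trA T (Y \<boxplus> X) (mu_braid F X Y A B) \<cdot>\<^bsub>fib G (Y \<boxplus> X)\<^esub>
            tr_act T (braid V X Y) (mu F X Y A B) \<cdot>\<^bsub>fib G (Y \<boxplus> X)\<^esub>
            actA G (braid V X Y) (tr_mu T X Y A B)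
        = tr_mu T Y X B A \<cdot>\<^bsub>fib G (Y \<boxplus> X)\<^esub> mu_braid G X Y (tr T X A) (tr T Y B)"

text \<open>Equality of parallel maps of algebras out of \<open>F\<close> (values off the carriers are irrelevant).\<close>

definition alg_map_eq :: "('v, 'w) smcat \<Rightarrow> ('v, 'w, 'o, 'm) alg \<Rightarrow>
    ('v, 'w, 'o, 'p, 'm, 'n) alg_map \<Rightarrow> ('v, 'w, 'o, 'p, 'm, 'n) alg_map \<Rightarrow> bool" where
  "alg_map_eq V F S T \<longleftrightarrow>
     (\<forall>X \<in> Obj V. \<forall>A \<in> Obj (fib F X). tr S X A = tr T X A) \<and>
     (\<forall>X \<in> Obj V. \<forall>a \<in> Arr (fib F X). trA S X a = trA T X a) \<and>
     (\<forall>\<phi> \<in> Arr V. \<forall>A \<in> Obj (fib F (src V \<phi>)). tr_act S \<phi> A = tr_act T \<phi> A) \<and>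
     (\<forall>X \<in> Obj V. \<forall>Y \<in> Obj V. \<forall>A \<in> Obj (fib F X). \<forall>B \<in> Obj (fib F Y).
        tr_mu S X Y A B = tr_mu T X Y A B) \<and>
     tr_eta S = tr_eta T"

text \<open>The composite of \<open>S : F \<rightarrow> G\<close> and \<open>T : G \<rightarrow> H\<close>; \<open>F\<close> only serves to type the cells.\<close>

definition alg_map_comp :: "('v, 'w) smcat \<Rightarrow> ('v, 'w, 'o, 'm) alg \<Rightarrow> ('v, 'w, 'q, 'l) alg \<Rightarrow>
    ('v, 'w, 'p, 'q, 'n, 'l) alg_map \<Rightarrow> ('v, 'w, 'o, 'p, 'm, 'n) alg_map \<Rightarrow>
    ('v, 'w, 'o, 'q, 'm, 'l) alg_map" where
  "alg_map_comp V F H T S = \<lparr>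
     tr = (\<lambda>X A. tr T X (tr S X A)),
     trA = (\<lambda>X a. trA T X (trA S X a)),
     tr_act = (\<lambda>\<phi> A. trA T (trg V \<phi>) (tr_act S \<phi> A) \<cdot>\<^bsub>fib H (trg V \<phi>)\<^esub>
                       tr_act T \<phi> (tr S (src V \<phi>) A)),
     tr_mu = (\<lambda>X Y A B. trA T (X \<boxplus>\<^bsub>V\<^esub> Y) (tr_mu S X Y A B) \<cdot>\<^bsub>fib H (X \<boxplus>\<^bsub>V\<^esub> Y)\<^esub>
                          tr_mu T X Y (tr S X A) (tr S Y B)),
     tr_eta = trA T (unit_obj V) (tr_eta S) \<cdot>\<^bsub>fib H (unit_obj V)\<^esub> tr_eta T\<rparr>"

definition full_sub :: "('v, 'w, 'o, 'm) alg \<Rightarrow> ('v \<Rightarrow> 'o \<Rightarrow> bool) \<Rightarrow> ('v, 'w, 'o, 'm) alg" where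
  "full_sub F P = F\<lparr>fib := \<lambda>X. full_subcat (fib F X) (P X)\<rparr>"

definition subalgebra ::
  "('v, 'w) smcat \<Rightarrow> ('v, 'w, 'o, 'm) alg \<Rightarrow> ('v \<Rightarrow> 'o \<Rightarrow> bool) \<Rightarrow> bool" where
  "subalgebra V F P \<longleftrightarrow> lax_algebra V F \<and>
     (\<forall>\<phi> \<in> Arr V. \<forall>A \<in> Obj (fib F (src V \<phi>)). P (src V \<phi>) A \<longrightarrow> P (trg V \<phi>) (act F \<phi> A)) \<and>
     (\<forall>X \<in> Obj V. \<forall>Y \<in> Obj V. \<forall>A \<in> Obj (fib F X). \<forall>B \<in> Obj (fib F Y).
        P X A \<longrightarrow> P Y B \<longrightarrow> P (X \<boxplus>\<^bsub>V\<^esub> Y) (mu F X Y A B)) \<and>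
     P (unit_obj V) (eta F)"

text \<open>
  The inclusion between two full subalgebras of \<open>F\<close>: identity on objects and arrows, with
  identity cells.
\<close>

definition sub_incl :: "('v, 'w) smcat \<Rightarrow> ('v, 'w, 'o, 'm) alg \<Rightarrow>
    ('v, 'w, 'o, 'o, 'm, 'm) alg_map" where
  "sub_incl V F = \<lparr>
     tr = (\<lambda>X A. A),
     trA = (\<lambda>X a. a),
     tr_act = (\<lambda>\<phi> A. idn (fib F (trg V \<phi>)) (act F \<phi> A)),
     tr_mu = (\<lambda>X Y A B. idn (fib F (X \<boxplus>\<^bsub>V\<^esub> Y)) (mu F X Y A B)),
     tr_eta = idn (fib F (unit_obj V)) (eta F)\<rparr>"

text \<open>
  Colimits in the category of \<open>V\<close>-algebras and maps of algebras, for diagrams indexed by a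
  preordered set \<open>(J, \<sqsubseteq>)\<close> viewed as a category. The type argument is the pair of the types of
  objects and arrows of the categories that the test algebras \<open>G\<close> take as values.
\<close>

definition alg_diagram :: "('v, 'w) smcat \<Rightarrow> 'j set \<Rightarrow> ('j \<Rightarrow> 'j \<Rightarrow> bool) \<Rightarrow>
    ('j \<Rightarrow> ('v, 'w, 'o, 'm) alg) \<Rightarrow> ('j \<Rightarrow> 'j \<Rightarrow> ('v, 'w, 'o, 'o, 'm, 'm) alg_map) \<Rightarrow> bool" where
  "alg_diagram V J le D d \<longleftrightarrow>
     (\<forall>i \<in> J. lax_algebra V (D i)) \<and>
     (\<forall>i \<in> J. \<forall>j \<in> J. le i j \<longrightarrow> algebra_map V (D i) (D j) (d i j)) \<and>
     (\<forall>i \<in> J. alg_map_eq V (D i) (d i i) (sub_incl V (D i))) \<and>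
     (\<forall>i \<in> J. \<forall>j \<in> J. \<forall>k \<in> J. le i j \<longrightarrow> le j k \<longrightarrow>
        alg_map_eq V (D i) (alg_map_comp V (D i) (D k) (d j k) (d i j)) (d i k))"

definition alg_cocone :: "('v, 'w) smcat \<Rightarrow> 'j set \<Rightarrow> ('j \<Rightarrow> 'j \<Rightarrow> bool) \<Rightarrow>
    ('j \<Rightarrow> ('v, 'w, 'o, 'm) alg) \<Rightarrow> ('j \<Rightarrow> 'j \<Rightarrow> ('v, 'w, 'o, 'o, 'm, 'm) alg_map) \<Rightarrow>
    ('v, 'w, 'p, 'n) alg \<Rightarrow> ('j \<Rightarrow> ('v, 'w, 'o, 'p, 'm, 'n) alg_map) \<Rightarrow> bool" where
  "alg_cocone V J le D d G c \<longleftrightarrow>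
     lax_algebra V G \<and>
     (\<forall>i \<in> J. algebra_map V (D i) G (c i)) \<and>
     (\<forall>i \<in> J. \<forall>j \<in> J. le i j \<longrightarrow>
        alg_map_eq V (D i) (alg_map_comp V (D i) G (c j) (d i j)) (c i))"

definition alg_colimit :: "('p \<times> 'n) itself \<Rightarrow> ('v, 'w) smcat \<Rightarrow> 'j set \<Rightarrow> ('j \<Rightarrow> 'j \<Rightarrow> bool) \<Rightarrow>
    ('j \<Rightarrow> ('v, 'w, 'o, 'm) alg) \<Rightarrow> ('j \<Rightarrow> 'j \<Rightarrow> ('v, 'w, 'o, 'o, 'm, 'm) alg_map) \<Rightarrow>
    ('v, 'w, 'o, 'm) alg \<Rightarrow> ('j \<Rightarrow> ('v, 'w, 'o, 'o, 'm, 'm) alg_map) \<Rightarrow> bool" where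
  "alg_colimit _ V J le D d L l \<longleftrightarrow>
     alg_diagram V J le D d \<and> alg_cocone V J le D d L l \<and>
     (\<forall>(G :: ('v, 'w, 'p, 'n) alg) c. alg_cocone V J le D d G c \<longrightarrow>
        (\<exists>u. algebra_map V L G u \<and>
             (\<forall>i \<in> J. alg_map_eq V (D i) (alg_map_comp V (D i) G u (l i)) (c i)) \<and>
             (\<forall>u'. algebra_map V L G u' \<longrightarrow>
                (\<forall>i \<in> J. alg_map_eq V (D i) (alg_map_comp V (D i) G u' (l i)) (c i)) \<longrightarrow>
                alg_map_eq V L u' u)))"


section \<open>Typed finite sets and wiring diagrams\<close>

text \<open>
  Finite sets are represented by finite sets of labels; the type of labels is closed under
  coproduct injections, so that \<open>L + R = InL ` L \<union> InR ` R\<close> is a disjoint union.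
\<close>

datatype label = Name nat | InL label | InR label

definition lcase :: "(label \<Rightarrow> 'b) \<Rightarrow> (label \<Rightarrow> 'b) \<Rightarrow> label \<Rightarrow> 'b" where
  "lcase f g z = (case z of InL x \<Rightarrow> f x | InR y \<Rightarrow> g y | Name n \<Rightarrow> undefined)"

record 'c tfs =
  lab :: "label set"
  tau :: "label \<Rightarrow> 'c"

definition is_tfs :: "'c set \<Rightarrow> 'c tfs \<Rightarrow> bool" where
  "is_tfs K X \<longleftrightarrow> finite (lab X) \<and> tau X \<in> lab X \<rightarrow>\<^sub>E K"

definition tfs_sum :: "'c tfs \<Rightarrow> 'c tfs \<Rightarrow> 'c tfs" (infixr "+\<^sub>t" 65) where
  "X +\<^sub>t Y = (let S = InL ` lab X \<union> InR ` lab Y in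
     \<lparr>lab = S, tau = restrict (lcase (tau X) (tau Y)) S\<rparr>)"

definition tfs_empty :: "'c tfs" where
  "tfs_empty = \<lparr>lab = {}, tau = (\<lambda>_. undefined)\<rparr>"

definition typed_fun :: "'c tfs \<Rightarrow> 'c tfs \<Rightarrow> (label \<Rightarrow> label) set" where
  "typed_fun X Y = {f \<in> lab X \<rightarrow>\<^sub>E lab Y. \<forall>x \<in> lab X. tau Y (f x) = tau X x}"

record 'c box =
  inp :: "'c tfs"
  outp :: "'c tfs"

record 'c wd =
  wsrc :: "'c box"
  wtrg :: "'c box"
  win :: "label \<Rightarrow> label"
  wout :: "label \<Rightarrow> label"

definition is_box :: "'c set \<Rightarrow> 'c box \<Rightarrow> bool" where
  "is_box K X \<longleftrightarrow> is_tfs K (inp X) \<and> is_tfs K (outp X)"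

definition is_wd :: "'c set \<Rightarrow> 'c wd \<Rightarrow> bool" where
  "is_wd K \<phi> \<longleftrightarrow> is_box K (wsrc \<phi>) \<and> is_box K (wtrg \<phi>) \<and>
     win \<phi> \<in> typed_fun (inp (wsrc \<phi>)) (outp (wsrc \<phi>) +\<^sub>t inp (wtrg \<phi>)) \<and>
     wout \<phi> \<in> typed_fun (outp (wtrg \<phi>)) (outp (wsrc \<phi>))"

text \<open>
  For \<open>\<phi> : X \<rightarrow> Y\<close> and \<open>\<psi> : Y \<rightarrow> Z\<close>, an inner input port is fed by \<open>\<phi>\<close> from an output of \<open>X\<close>, or
  from an input of \<open>Y\<close>; the latter is fed by \<open>\<psi>\<close> from an output of \<open>Y\<close>, which \<open>\<phi>\<close> in turn
  takes from an output of \<open>X\<close>, or from an input of \<open>Z\<close>.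
\<close>

definition wd_comp :: "'c wd \<Rightarrow> 'c wd \<Rightarrow> 'c wd" where
  "wd_comp \<psi> \<phi> = \<lparr>
     wsrc = wsrc \<phi>, wtrg = wtrg \<psi>,
     win = (\<lambda>i \<in> lab (inp (wsrc \<phi>)).
              lcase InL (\<lambda>j. lcase (\<lambda>y. InL (wout \<phi> y)) InR (win \<psi> j)) (win \<phi> i)),
     wout = (\<lambda>k \<in> lab (outp (wtrg \<psi>)). wout \<phi> (wout \<psi> k))\<rparr>"

text \<open>
  The wiring diagram \<open>X \<rightarrow> Y\<close> given by typed functions \<open>g : X\<^sup>i\<^sup>n \<rightarrow> Y\<^sup>i\<^sup>n\<close> and
  \<open>h : Y\<^sup>o\<^sup>u\<^sup>t \<rightarrow> X\<^sup>o\<^sup>u\<^sup>t\<close>, without feedback.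
\<close>

definition relabel :: "'c box \<Rightarrow> 'c box \<Rightarrow> (label \<Rightarrow> label) \<Rightarrow> (label \<Rightarrow> label) \<Rightarrow> 'c wd" where
  "relabel X Y g h = \<lparr>wsrc = X, wtrg = Y,
     win = (\<lambda>i \<in> lab (inp X). InR (g i)), wout = (\<lambda>k \<in> lab (outp Y). h k)\<rparr>"

definition box_sum :: "'c box \<Rightarrow> 'c box \<Rightarrow> 'c box" where
  "box_sum X Y = \<lparr>inp = inp X +\<^sub>t inp Y, outp = outp X +\<^sub>t outp Y\<rparr>"

definition box_empty :: "'c box" where
  "box_empty = \<lparr>inp = tfs_empty, outp = tfs_empty\<rparr>"

definition wd_sum :: "'c wd \<Rightarrow> 'c wd \<Rightarrow> 'c wd" where
  "wd_sum \<phi> \<psi> = \<lparr>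
     wsrc = box_sum (wsrc \<phi>) (wsrc \<psi>), wtrg = box_sum (wtrg \<phi>) (wtrg \<psi>),
     win = restrict
       (lcase (\<lambda>i. lcase (InL \<circ> InL) (InR \<circ> InL) (win \<phi> i))
              (\<lambda>i. lcase (InL \<circ> InR) (InR \<circ> InR) (win \<psi> i)))
       (lab (inp (wsrc \<phi>) +\<^sub>t inp (wsrc \<psi>))),
     wout = restrict (lcase (InL \<circ> wout \<phi>) (InR \<circ> wout \<psi>))
       (lab (outp (wtrg \<phi>) +\<^sub>t outp (wtrg \<psi>)))\<rparr>"

definition wiring :: "'c set \<Rightarrow> ('c box, 'c wd) smcat" where
  "wiring K = \<lparr>
     Obj = {X. is_box K X}, Arr = {\<phi>. is_wd K \<phi>}, src = wsrc, trg = wtrg,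
     idn = (\<lambda>X. relabel X X id id),
     cmp = wd_comp,
     ten = box_sum, tenA = wd_sum, unit_obj = box_empty,
     assoc = (\<lambda>X Y Z. relabel (box_sum (box_sum X Y) Z) (box_sum X (box_sum Y Z))
        (lcase (lcase InL (InR \<circ> InL)) (InR \<circ> InR)) (lcase (InL \<circ> InL) (lcase (InL \<circ> InR) InR))),
     lunit = (\<lambda>X. relabel (box_sum box_empty X) X (lcase id id) InR),
     runit = (\<lambda>X. relabel (box_sum X box_empty) X (lcase id id) InL),
     braid = (\<lambda>X Y. relabel (box_sum X Y) (box_sum Y X) (lcase InR InL) (lcase InR InL))\<rparr>"


section \<open>Interval sheaves\<close>

text \<open>The arrow \<open>Tr\<^sub>p : l' \<rightarrow> l\<close> is the triple \<open>(l', p, l)\<close>.\<close>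

definition Int_cat :: "(real, real \<times> real \<times> real) cat" where
  "Int_cat = \<lparr>
     Obj = {l. 0 \<le> l},
     Arr = {(l', p, l). 0 \<le> l' \<and> 0 \<le> l \<and> 0 \<le> p \<and> p \<le> l - l'},
     src = (\<lambda>(l', p, l). l'),
     trg = (\<lambda>(l', p, l). l),
     idn = (\<lambda>l. (l, 0, l)),
     cmp = (\<lambda>(l', p, l) (l'', p', m). (l'', p + p', l))\<rparr>"

text \<open>
  A universe of sections. It is closed under pairing and label-indexed families, so the sheaves
  with sections in \<open>'a univ\<close> have all finite limits. As \<open>'a\<close> is arbitrary, every sheaf of sets is
  isomorphic to such a sheaf for a suitable \<open>'a\<close>.
\<close>

datatype 'a univ = Atom 'a | Tup (tfst: "'a univ") (tsnd: "'a univ") | Fam (fam: "label \<Rightarrow> 'a univ")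

record 'a psh =
  sec :: "real \<Rightarrow> 'a univ set"
  res :: "real \<times> real \<times> real \<Rightarrow> 'a univ \<Rightarrow> 'a univ"

definition presheaf :: "'a psh \<Rightarrow> bool" where
  "presheaf X \<longleftrightarrow>
     (\<forall>l. l \<notin> Obj Int_cat \<longrightarrow> sec X l = {}) \<and>
     (\<forall>f. f \<notin> Arr Int_cat \<longrightarrow> res X f = (\<lambda>_. undefined)) \<and>
     (\<forall>f \<in> Arr Int_cat. res X f \<in> sec X (trg Int_cat f) \<rightarrow>\<^sub>E sec X (src Int_cat f)) \<and>
     (\<forall>l \<in> Obj Int_cat. \<forall>x \<in> sec X l. res X (idn Int_cat l) x = x) \<and>
     (\<forall>l l' l''. \<forall>f \<in> hom Int_cat l'' l'. \<forall>g \<in> hom Int_cat l' l. \<forall>x \<in> sec X l.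
        res X (g \<cdot>\<^bsub>Int_cat\<^esub> f) x = res X f (res X g x))"

text \<open>\<open>restr X l p l' x\<close> is the restriction of \<open>x \<in> X(l)\<close> to the interval \<open>[p, p + l']\<close>.\<close>

definition restr :: "'a psh \<Rightarrow> real \<Rightarrow> real \<Rightarrow> real \<Rightarrow> 'a univ \<Rightarrow> 'a univ" where
  "restr X l p l' = res X (l', p, l)"

definition sheaf :: "'a psh \<Rightarrow> bool" where
  "sheaf X \<longleftrightarrow> presheaf X \<and>
     (\<forall>l1 \<ge> 0. \<forall>l2 \<ge> 0. \<forall>x1 \<in> sec X l1. \<forall>x2 \<in> sec X l2.
        restr X l1 l1 0 x1 = restr X l2 0 0 x2 \<longrightarrow>
        (\<exists>!x. x \<in> sec X (l1 + l2) \<and>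
              restr X (l1 + l2) 0 l1 x = x1 \<and> restr X (l1 + l2) l1 l2 x = x2))"

record 'a pmap =
  pdom :: "'a psh"
  pcod :: "'a psh"
  app :: "real \<Rightarrow> 'a univ \<Rightarrow> 'a univ"

definition sheaf_map :: "'a pmap \<Rightarrow> bool" where
  "sheaf_map f \<longleftrightarrow> sheaf (pdom f) \<and> sheaf (pcod f) \<and>
     (\<forall>l. app f l \<in> sec (pdom f) l \<rightarrow>\<^sub>E sec (pcod f) l) \<and>
     (\<forall>t \<in> Arr Int_cat. \<forall>x \<in> sec (pdom f) (trg Int_cat t).
        app f (src Int_cat t) (res (pdom f) t x) = res (pcod f) t (app f (trg Int_cat t) x))"

text \<open>
  These constructors normalise the values off the carriers, so that equality of presheaves and
  of maps is extensional.
\<close>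

definition mk_psh :: "(real \<Rightarrow> 'a univ set) \<Rightarrow> (real \<times> real \<times> real \<Rightarrow> 'a univ \<Rightarrow> 'a univ) \<Rightarrow> 'a psh"
  where
  "mk_psh s r = \<lparr>
     sec = (\<lambda>l. if l \<in> Obj Int_cat then s l else {}),
     res = (\<lambda>f. if f \<in> Arr Int_cat then restrict (r f) (s (trg Int_cat f)) else (\<lambda>_. undefined))\<rparr>"

definition mk_map :: "'a psh \<Rightarrow> 'a psh \<Rightarrow> (real \<Rightarrow> 'a univ \<Rightarrow> 'a univ) \<Rightarrow> 'a pmap" where
  "mk_map A B f = \<lparr>pdom = A, pcod = B, app = (\<lambda>l. restrict (f l) (sec A l))\<rparr>"

definition IntSh :: "('a psh, 'a pmap) cat" where
  "IntSh = \<lparr>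
     Obj = {X. sheaf X}, Arr = {f. sheaf_map f}, src = pdom, trg = pcod,
     idn = (\<lambda>A. mk_map A A (\<lambda>l x. x)),
     cmp = (\<lambda>g f. mk_map (pdom f) (pcod g) (\<lambda>l x. app g l (app f l x)))\<rparr>"

definition psh_prod :: "'a psh \<Rightarrow> 'a psh \<Rightarrow> 'a psh" (infixr "\<times>\<^sub>s" 80) where
  "A \<times>\<^sub>s B = mk_psh (\<lambda>l. {Tup a b | a b. a \<in> sec A l \<and> b \<in> sec B l})
     (\<lambda>t u. Tup (res A t (tfst u)) (res B t (tsnd u)))"

definition proj2 :: "'a psh \<Rightarrow> 'a psh \<Rightarrow> 'a pmap" where
  "proj2 A B = mk_map (A \<times>\<^sub>s B) B (\<lambda>l. tsnd)"

definition map_pair :: "'a pmap \<Rightarrow> 'a pmap \<Rightarrow> 'a pmap" where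
  "map_pair f g = mk_map (pdom f) (pcod f \<times>\<^sub>s pcod g) (\<lambda>l x. Tup (app f l x) (app g l x))"

definition map_prod_s :: "'a pmap \<Rightarrow> 'a pmap \<Rightarrow> 'a pmap" where
  "map_prod_s f g = mk_map (pdom f \<times>\<^sub>s pdom g) (pcod f \<times>\<^sub>s pcod g)
     (\<lambda>l u. Tup (app f l (tfst u)) (app g l (tsnd u)))"

definition hat :: "'a psh tfs \<Rightarrow> 'a psh" where
  "hat X = mk_psh (\<lambda>l. Fam ` (\<Pi>\<^sub>E x \<in> lab X. sec (tau X x) l))
     (\<lambda>t u. Fam (\<lambda>x \<in> lab X. res (tau X x) t (fam u x)))"

definition pullback :: "'a pmap \<Rightarrow> 'a pmap \<Rightarrow> 'a psh" where
  "pullback k p = mk_psh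
     (\<lambda>l. {Tup d s | d s. d \<in> sec (pdom k) l \<and> s \<in> sec (pdom p) l \<and> app k l d = app p l s})
     (\<lambda>t u. Tup (res (pdom k) t (tfst u)) (res (pdom p) t (tsnd u)))"

definition pullback_map :: "'a pmap \<Rightarrow> 'a pmap \<Rightarrow> 'a pmap" where
  "pullback_map k p = mk_map (pullback k p) (pdom k) (\<lambda>l. tfst)"

definition Ext :: "real \<Rightarrow> 'a psh \<Rightarrow> 'a psh" where
  "Ext e A = mk_psh (\<lambda>l. sec A (l + e)) (\<lambda>(l', p, l). res A (l' + e, p, l + e))"

definition left_restr :: "real \<Rightarrow> 'a psh \<Rightarrow> 'a pmap" where
  "left_restr e A = mk_map (Ext e A) A (\<lambda>l. restr A (l + e) 0 l)"


section \<open>Continuous machines and inertiality\<close>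

definition machine :: "'a psh \<Rightarrow> 'a psh \<Rightarrow> 'a pmap \<Rightarrow> bool" where
  "machine A B m \<longleftrightarrow> sheaf A \<and> sheaf B \<and> sheaf_map m \<and> pcod m = A \<times>\<^sub>s B"

definition eps_inertial_map :: "real \<Rightarrow> 'a pmap \<Rightarrow> bool" where
  "eps_inertial_map e p \<longleftrightarrow>
     (\<exists>q \<in> hom IntSh (pdom p) (Ext e (pcod p)). left_restr e (pcod p) \<cdot>\<^bsub>IntSh\<^esub> q = p)"

definition inertial_map :: "'a pmap \<Rightarrow> bool" where
  "inertial_map p \<longleftrightarrow> (\<exists>e > 0. eps_inertial_map e p)"

definition out_map :: "'a psh \<Rightarrow> 'a psh \<Rightarrow> 'a pmap \<Rightarrow> 'a pmap" where
  "out_map A B m = proj2 A B \<cdot>\<^bsub>IntSh\<^esub> m"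

definition eps_inertial_machine :: "real \<Rightarrow> 'a psh box \<Rightarrow> 'a pmap \<Rightarrow> bool" where
  "eps_inertial_machine e X m \<longleftrightarrow>
     machine (hat (inp X)) (hat (outp X)) m \<and>
     eps_inertial_map e (out_map (hat (inp X)) (hat (outp X)) m)"

definition inertial_machine :: "'a psh box \<Rightarrow> 'a pmap \<Rightarrow> bool" where
  "inertial_machine X m \<longleftrightarrow>
     machine (hat (inp X)) (hat (outp X)) m \<and>
     inertial_map (out_map (hat (inp X)) (hat (outp X)) m)"


section \<open>The algebra of continuous machines\<close>

abbreviation IntW :: "('a psh box, 'a psh wd) smcat" where
  "IntW \<equiv> wiring (Obj IntSh)"

text \<open>\<open>wd_in \<phi>\<close> and \<open>wd_out \<phi>\<close> are the maps induced by \<open>\<phi>\<^sup>i\<^sup>n\<close> and \<open>\<phi>\<^sup>o\<^sup>u\<^sup>t\<close>.\<close>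

definition iface :: "'a psh box \<Rightarrow> 'a psh" where
  "iface X = hat (inp X) \<times>\<^sub>s hat (outp X)"

definition wd_in :: "'a psh wd \<Rightarrow> 'a pmap" where
  "wd_in \<phi> = mk_map (hat (inp (wtrg \<phi>)) \<times>\<^sub>s hat (outp (wsrc \<phi>))) (hat (inp (wsrc \<phi>)))
     (\<lambda>l u. Fam (\<lambda>i \<in> lab (inp (wsrc \<phi>)). lcase (fam (tsnd u)) (fam (tfst u)) (win \<phi> i)))"

definition wd_out :: "'a psh wd \<Rightarrow> 'a pmap" where
  "wd_out \<phi> = mk_map (hat (outp (wsrc \<phi>))) (hat (outp (wtrg \<phi>)))
     (\<lambda>l u. Fam (\<lambda>k \<in> lab (outp (wtrg \<phi>)). fam u (wout \<phi> k)))"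

definition mch_act :: "'a psh wd \<Rightarrow> 'a pmap \<Rightarrow> 'a pmap" where
  "mch_act \<phi> m =
     map_prod_s (idn IntSh (hat (inp (wtrg \<phi>)))) (wd_out \<phi>) \<cdot>\<^bsub>IntSh\<^esub>
     pullback_map
       (map_pair (wd_in \<phi>) (proj2 (hat (inp (wtrg \<phi>))) (hat (outp (wsrc \<phi>))))) m"

text \<open>
  The isomorphism \<open>(X\<^sup>i\<^sup>n \<times> X\<^sup>o\<^sup>u\<^sup>t) \<times> (Y\<^sup>i\<^sup>n \<times> Y\<^sup>o\<^sup>u\<^sup>t) \<rightarrow> (X + Y)\<^sup>i\<^sup>n \<times> (X + Y)\<^sup>o\<^sup>u\<^sup>t\<close> on products of types,
  and the laxator: the product of machines, postcomposed with it.
\<close>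

definition fam_join :: "'c tfs \<Rightarrow> 'c tfs \<Rightarrow> 'a univ \<Rightarrow> 'a univ \<Rightarrow> 'a univ" where
  "fam_join A B a b = Fam (restrict (lcase (fam a) (fam b)) (lab (A +\<^sub>t B)))"

definition iface_join :: "'a psh box \<Rightarrow> 'a psh box \<Rightarrow> 'a pmap" where
  "iface_join X Y = mk_map (iface X \<times>\<^sub>s iface Y) (iface (box_sum X Y))
     (\<lambda>l u. Tup (fam_join (inp X) (inp Y) (tfst (tfst u)) (tfst (tsnd u)))
                (fam_join (outp X) (outp Y) (tsnd (tfst u)) (tsnd (tsnd u))))"

definition mch_mu :: "'a psh box \<Rightarrow> 'a psh box \<Rightarrow> 'a pmap \<Rightarrow> 'a pmap \<Rightarrow> 'a pmap" where
  "mch_mu X Y m n = iface_join X Y \<cdot>\<^bsub>IntSh\<^esub> map_prod_s m n"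

text \<open>The unit is the nullary product of spans, carried by the terminal sheaf \<open>hat tfs_empty\<close>.\<close>

definition mch_eta :: "'a pmap" where
  "mch_eta = mk_map (hat tfs_empty) (iface box_empty) (\<lambda>l u. Tup u u)"

definition mk_arr :: "'a pmap \<Rightarrow> 'a pmap \<Rightarrow> (real \<Rightarrow> 'a univ \<Rightarrow> 'a univ) \<Rightarrow> 'a pmap \<times> 'a pmap \<times> 'a pmap"
  where "mk_arr m n f = (m, n, mk_map (pdom m) (pdom n) f)"

definition left_part :: "'c tfs \<Rightarrow> 'a univ \<Rightarrow> 'a univ" where
  "left_part A u = Fam (\<lambda>x \<in> lab A. fam u (InL x))"

definition right_part :: "'c tfs \<Rightarrow> 'a univ \<Rightarrow> 'a univ" where
  "right_part B u = Fam (\<lambda>x \<in> lab B. fam u (InR x))"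

text \<open>
  The structure cells are the canonical ones between iterated pullbacks and products. States of
  \<open>mch_act \<phi> m\<close> are \<open>Tup (Tup y x) s\<close> with \<open>y\<close> an input of the outer box, \<open>x\<close> an output of the
  inner box and \<open>s\<close> a state of \<open>m\<close>; states of \<open>mch_mu X Y m n\<close> are pairs of states.
\<close>

definition Mch :: "('a psh box, 'a psh wd, 'a pmap, 'a pmap \<times> 'a pmap \<times> 'a pmap) alg" where
  "Mch = \<lparr>
     fib = (\<lambda>X. slice IntSh (iface X)),
     act = mch_act,
     actA = (\<lambda>\<phi> (m, n, h). mk_arr (mch_act \<phi> m) (mch_act \<phi> n)
        (\<lambda>l u. Tup (tfst u) (app h l (tsnd u)))),
     fcmp = (\<lambda>\<psi> \<phi> m. mk_arr (mch_act (wd_comp \<psi> \<phi>) m) (mch_act \<psi> (mch_act \<phi> m))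
        (\<lambda>l u. let z = tfst (tfst u); x = tsnd (tfst u); s = tsnd u; y = app (wd_out \<phi>) l x in
           Tup (Tup z y) (Tup (Tup (app (wd_in \<psi>) l (Tup z y)) x) s))),
     fidn = (\<lambda>X m. mk_arr (mch_act (idn IntW X) m) m (\<lambda>l. tsnd)),
     mu = mch_mu,
     muA = (\<lambda>X Y (m, m', h) (n, n', k). mk_arr (mch_mu X Y m n) (mch_mu X Y m' n')
        (\<lambda>l u. Tup (app h l (tfst u)) (app k l (tsnd u)))),
     muN = (\<lambda>\<phi> \<psi> m n. mk_arr (mch_act (wd_sum \<phi> \<psi>) (mch_mu (wsrc \<phi>) (wsrc \<psi>) m n))
        (mch_mu (wtrg \<phi>) (wtrg \<psi>) (mch_act \<phi> m) (mch_act \<psi> n))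
        (\<lambda>l u. let y = tfst (tfst u); x = tsnd (tfst u); s = tfst (tsnd u); t = tsnd (tsnd u) in
           Tup (Tup (Tup (left_part (inp (wtrg \<phi>)) y) (left_part (outp (wsrc \<phi>)) x)) s)
               (Tup (Tup (right_part (inp (wtrg \<psi>)) y) (right_part (outp (wsrc \<psi>)) x)) t))),
     eta = mch_eta,
     mu_assoc = (\<lambda>X Y Z m n k. mk_arr
        (mch_act (assoc IntW X Y Z) (mch_mu (box_sum X Y) Z (mch_mu X Y m n) k))
        (mch_mu X (box_sum Y Z) m (mch_mu Y Z n k))
        (\<lambda>l u. let w = tsnd u in Tup (tfst (tfst w)) (Tup (tsnd (tfst w)) (tsnd w)))),
     mu_lunit = (\<lambda>X m. mk_arr (mch_act (lunit IntW X) (mch_mu box_empty X mch_eta m)) m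
        (\<lambda>l u. tsnd (tsnd u))),
     mu_runit = (\<lambda>X m. mk_arr (mch_act (runit IntW X) (mch_mu X box_empty m mch_eta)) m
        (\<lambda>l u. tfst (tsnd u))),
     mu_braid = (\<lambda>X Y m n. mk_arr (mch_act (braid IntW X Y) (mch_mu X Y m n)) (mch_mu Y X n m)
        (\<lambda>l u. Tup (tsnd (tsnd u)) (tfst (tsnd u))))\<rparr>"

definition Mch_eps :: "real \<Rightarrow>
    ('a psh box, 'a psh wd, 'a pmap, 'a pmap \<times> 'a pmap \<times> 'a pmap) alg" where
  "Mch_eps e = full_sub Mch (eps_inertial_machine e)"

definition Mch_in :: "('a psh box, 'a psh wd, 'a pmap, 'a pmap \<times> 'a pmap \<times> 'a pmap) alg" where
  "Mch_in = full_sub Mch inertial_machine"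

end

theory Submission
  imports Defs
begin

text \<open>
  Inertiality. An \<open>\<epsilon>\<close>-inertial structure on a machine is a natural family \<open>q\<close> of extensions by
  \<open>\<epsilon>\<close> of its outputs. Since \<open>Ext\<^sub>\<epsilon>\<close> is computed sectionwise and wiring acts on outputs by the
  sheaf map \<open>\<phi>\<^sup>o\<^sup>u\<^sup>t\<close>, applying that map at length \<open>l + \<epsilon>\<close> to \<open>q\<close> of the inner state extends the
  outer outputs; pairs of extensions extend the outputs of a product, and truncating an extension
  shows that \<open>\<epsilon>\<close>-inertial machines are \<open>\<delta>\<close>-inertial for \<open>\<delta> \<le> \<epsilon>\<close>.

  Colimit. Every axiom of a map of algebras involves finitely many objects, so maps out of a
  directed union of full subalgebras are glued from maps out of its members.

  Coherence of \<open>Mch\<close>. A state of \<open>mch_act \<phi> m\<close> is determined by its image in the interface and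
  the underlying state of \<open>m\<close>. All structure cells respect interfaces and act on underlying states
  by reassociating tuples, so each coherence equation reduces to a trivial one about tuples.
\<close>

section \<open>Full subalgebras\<close>

text \<open>The colimit is strict: a mediating map has to commute with the legs up to equality of
  all data, cells included. This is attainable because inclusions have identity cells, so that the
  legs of a cocone literally restrict to one another. The index order reverses that of the reals,
  since a smaller epsilon gives a larger class of machines; upper bounds are minima. The main
  obstacle is coherence of \<open>Mch\<close>. Both sides of an axiom are arrows between iterated
  pullbacks and products, whose states record interface values at each stage. Arrows of a slice
  preserve the interface, so it is enough to compare what is left of a target state once all records
  are dropped, provided that this and the interface value determine the state. A second obstacle is
  that \<open>Ext\<close> of a sheaf is again a sheaf. Its sections over adjacent intervals overlap,
  as sections of the given sheaf, on a whole interval, whereas the sheaf condition glues along a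
  point.\<close>

lemma full_subcat_simps [simp]:
  "Obj (full_subcat C P) = {A \<in> Obj C. P A}"
  "Arr (full_subcat C P) = {f \<in> Arr C. P (src C f) \<and> P (trg C f)}"
  "src (full_subcat C P) = src C" "trg (full_subcat C P) = trg C"
  "idn (full_subcat C P) = idn C" "cmp (full_subcat C P) = cmp C"
  by (simp_all add: full_subcat_def)

lemma hom_full_subcat [simp]: "hom (full_subcat C P) A B = {f \<in> hom C A B. P A \<and> P B}"
  by (auto simp: hom_def)

text \<open>Fullness puts the inverse into the subcategory as soon as both ends are objects of
  it.\<close>

lemma isos_full_subcat [simp]: "isos (full_subcat C P) A B = {f \<in> isos C A B. P A \<and> P B}"
  by (auto simp: isos_def)

lemma isos_hom: "f \<in> isos C A B \<Longrightarrow> f \<in> hom C A B"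
  by (simp add: isos_def)

lemma homD: "f \<in> hom C A B \<Longrightarrow> f \<in> Arr C \<and> src C f = A \<and> trg C f = B"
  by (simp add: hom_def)

lemma (in category) hom_obj: "f \<in> hom C A B \<Longrightarrow> A \<in> Obj C" "f \<in> hom C A B \<Longrightarrow> B \<in> Obj C"
  using src_obj trg_obj by (auto simp: hom_def)

lemma (in category) idn_iso: "A \<in> Obj C \<Longrightarrow> idn C A \<in> isos C A A"
  using idn_hom[of A] idn_left[of "idn C A" A A] by (auto simp: isos_def)

lemma full_subcat_category:
  assumes "category (C :: ('o, 'm) cat)"
  shows "category (full_subcat C P)"
proof -
  interpret category C by fact
  show ?thesis
    by unfold_locales
     (auto intro: src_obj trg_obj idn_hom cmp_hom idn_left idn_right cmp_assoc)
qed

lemma full_sub_simps [simp]: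
  "fib (full_sub F P) X = full_subcat (fib F X) (P X)"
  "act (full_sub F P) = act F" "actA (full_sub F P) = actA F"
  "fcmp (full_sub F P) = fcmp F" "fidn (full_sub F P) = fidn F"
  "mu (full_sub F P) = mu F" "muA (full_sub F P) = muA F" "muN (full_sub F P) = muN F"
  "eta (full_sub F P) = eta F" "mu_assoc (full_sub F P) = mu_assoc F"
  "mu_lunit (full_sub F P) = mu_lunit F" "mu_runit (full_sub F P) = mu_runit F"
  "mu_braid (full_sub F P) = mu_braid F"
  by (simp_all add: full_sub_def)

lemma pcmp_full_sub [simp]: "pcmp V (full_sub F P) = pcmp V F"
  by (simp add: pcmp_def Let_def)

lemma pten_full_sub [simp]: "pten V (full_sub F P) = pten V F"
  by (simp add: pten_def Let_def)

lemma subalgebraD: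
  assumes "subalgebra V F P"
  shows "\<phi> \<in> hom V X Y \<Longrightarrow> A \<in> Obj (fib F X) \<Longrightarrow> P X A \<Longrightarrow> P Y (act F \<phi> A)"
    and "X \<in> Obj V \<Longrightarrow> Y \<in> Obj V \<Longrightarrow> A \<in> Obj (fib F X) \<Longrightarrow> B \<in> Obj (fib F Y) \<Longrightarrow> P X A \<Longrightarrow> P Y B \<Longrightarrow>
      P (X \<boxplus>\<^bsub>V\<^esub> Y) (mu F X Y A B)"
    and "P (unit_obj V) (eta F)"
  using assms by (auto simp: subalgebra_def hom_def)

text \<open>No operation changes, so every equation is inherited. Closure under the operations
  enters only where an axiom places an object, an arrow or an invertible cell in a fibre.\<close>

lemma full_sub_algebra:
  assumes "subalgebra V F P"
  shows "lax_algebra V (full_sub F P)"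
proof -
  interpret F: lax_algebra V F using assms by (simp add: subalgebra_def)
  note act = subalgebraD(1)[OF assms] and mu = subalgebraD(2)[OF assms] and eta = subalgebraD(3)[OF assms]
  have V: "\<phi> \<in> hom V X Y \<Longrightarrow> X \<in> Obj V" "\<phi> \<in> hom V X Y \<Longrightarrow> Y \<in> Obj V" for \<phi> X Y
    by (blast dest: F.hom_obj)+
  have act_obj: "act F \<phi> A \<in> Obj (fib F Y)" if "\<phi> \<in> hom V X Y" "A \<in> Obj (fib F X)" for \<phi> X Y A
    using F.act_functor[OF that(1)] that(2) by (auto simp: is_functor_def)
  have act_fun: "is_functor (full_subcat (fib F X) (P X)) (full_subcat (fib F Y) (P Y)) (act F \<phi>) (actA F \<phi>)"
    if \<phi>: "\<phi> \<in> hom V X Y" for \<phi> X Y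
  proof -
    have cX: "category (fib F X)" using F.fib_category V \<phi> by blast
    have cY: "category (fib F Y)" using F.fib_category V \<phi> by blast
    show ?thesis
      using F.act_functor[OF \<phi>] act[OF \<phi>] category.hom_obj[OF cX] unfolding is_functor_def
      by (simp add: Ball_def) metis
  qed
  have fib_obj: "A \<in> Obj (fib F X)" "B \<in> Obj (fib F X)" if "a \<in> hom (fib F X) A B" "X \<in> Obj V" for a A B X
    using category.hom_obj[OF F.fib_category] that by blast+
  note closed = act mu eta V act_obj fib_obj F.ten_obj F.mu_obj F.tenA_hom F.cmp_hom F.idn_hom F.unit_obj_obj
    F.eta_obj
    F.assoc_iso[THEN isos_hom] F.lunit_iso[THEN isos_hom] F.runit_iso[THEN isos_hom] F.braid_hom
  show ?thesis
    apply (intro_locales)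
    apply (unfold lax_algebra_axioms_def)
    apply (intro conjI allI impI; simp only: full_sub_simps pcmp_full_sub pten_full_sub full_subcat_simps hom_full_subcat isos_full_subcat mem_Collect_eq)
    subgoal by (rule full_subcat_category[OF F.fib_category])
    subgoal by (rule act_fun)
    subgoal by (blast intro: F.fcmp_iso closed)
    subgoal by (blast intro: F.fcmp_nat)
    subgoal by (blast intro: F.fidn_iso closed)
    subgoal by (blast intro: F.fidn_nat)
    subgoal by (blast intro: F.fcmp_assoc)
    subgoal by (blast intro: F.fcmp_fidn_left)
    subgoal by (blast intro: F.fcmp_fidn_right)
    subgoal by (blast intro: closed)
    subgoal by (blast intro: F.muA_hom closed)
    subgoal by (blast intro: F.muA_idn)
    subgoal by (blast intro: F.muA_cmp)
    subgoal by (blast intro: F.muN_iso closed)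
    subgoal by (blast intro: F.muN_nat)
    subgoal by (blast intro: F.muN_cmp)
    subgoal by (blast intro: F.muN_idn)
    subgoal by (blast intro: closed)
    subgoal by (blast intro: F.mu_assoc_iso closed)
    subgoal by (blast intro: F.mu_assoc_nat)
    subgoal by (blast intro: F.mu_assoc_mod)
    subgoal by (blast intro: F.mu_lunit_iso closed)
    subgoal by (blast intro: F.mu_lunit_nat)
    subgoal by (blast intro: F.mu_lunit_mod)
    subgoal by (blast intro: F.mu_runit_iso closed)
    subgoal by (blast intro: F.mu_runit_nat)
    subgoal by (blast intro: F.mu_runit_mod)
    subgoal by (blast intro: F.mu_braid_iso closed)
    subgoal by (blast intro: F.mu_braid_nat)
    subgoal by (blast intro: F.mu_braid_mod)
    subgoal by (blast intro: F.mu_pentagon)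
    subgoal by (blast intro: F.mu_triangle)
    subgoal by (blast intro: F.mu_hexagon)
    subgoal by (blast intro: F.mu_symmetry)
    done
qed

lemma is_functorD:
  assumes "is_functor C D Fo Fa"
  shows "A \<in> Obj C \<Longrightarrow> Fo A \<in> Obj D"
    and "A \<in> Obj C \<Longrightarrow> Fa (idn C A) = idn D (Fo A)"
    and "f \<in> hom C A B \<Longrightarrow> Fa f \<in> hom D (Fo A) (Fo B)"
    and "f \<in> hom C A B \<Longrightarrow> g \<in> hom C B E \<Longrightarrow> Fa (g \<cdot>\<^bsub>C\<^esub> f) = Fa g \<cdot>\<^bsub>D\<^esub> Fa f"
  using assms unfolding is_functor_def by blast+

context lax_algebra
begin

lemma act_obj: "\<phi> \<in> hom V X Y \<Longrightarrow> A \<in> Obj (fib F X) \<Longrightarrow> act F \<phi> A \<in> Obj (fib F Y)"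
  by (rule is_functorD(1)[OF act_functor])

lemma actA_hom: "\<phi> \<in> hom V X Y \<Longrightarrow> a \<in> hom (fib F X) A A' \<Longrightarrow> actA F \<phi> a \<in> hom (fib F Y) (act F \<phi> A) (act F \<phi> A')"
  by (rule is_functorD(3)[OF act_functor])

lemma actA_idn: "\<phi> \<in> hom V X Y \<Longrightarrow> A \<in> Obj (fib F X) \<Longrightarrow> actA F \<phi> (idn (fib F X) A) = idn (fib F Y) (act F \<phi> A)"
  by (rule is_functorD(2)[OF act_functor])

lemma fib_idl: "X \<in> Obj V \<Longrightarrow> f \<in> hom (fib F X) A B \<Longrightarrow> idn (fib F X) B \<cdot>\<^bsub>fib F X\<^esub> f = f"
  by (rule category.idn_left[OF fib_category])

lemma fib_idr: "X \<in> Obj V \<Longrightarrow> f \<in> hom (fib F X) A B \<Longrightarrow> f \<cdot>\<^bsub>fib F X\<^esub> idn (fib F X) A = f"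
  by (rule category.idn_right[OF fib_category])

lemma fib_idn_hom: "X \<in> Obj V \<Longrightarrow> A \<in> Obj (fib F X) \<Longrightarrow> idn (fib F X) A \<in> hom (fib F X) A A"
  by (rule category.idn_hom[OF fib_category])

lemma fib_idn_iso: "X \<in> Obj V \<Longrightarrow> A \<in> Obj (fib F X) \<Longrightarrow> idn (fib F X) A \<in> isos (fib F X) A A"
  by (rule category.idn_iso[OF fib_category])

lemma fib_hom_obj: "X \<in> Obj V \<Longrightarrow> f \<in> hom (fib F X) A B \<Longrightarrow> A \<in> Obj (fib F X)"
    "X \<in> Obj V \<Longrightarrow> f \<in> hom (fib F X) A B \<Longrightarrow> B \<in> Obj (fib F X)"
  by (fact category.hom_obj[OF fib_category])+

end

section \<open>Inclusions, and restriction of maps to full subalgebras\<close>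

lemma sub_incl_simps [simp]:
  "tr (sub_incl V F) X A = A" "trA (sub_incl V F) X a = a"
  "tr_act (sub_incl V F) \<phi> A = idn (fib F (trg V \<phi>)) (act F \<phi> A)"
  "tr_mu (sub_incl V F) X Y A B = idn (fib F (X \<boxplus>\<^bsub>V\<^esub> Y)) (mu F X Y A B)"
  "tr_eta (sub_incl V F) = idn (fib F (unit_obj V)) (eta F)"
  by (simp_all add: sub_incl_def)

lemma sub_incl_full_sub [simp]: "sub_incl V (full_sub F P) = sub_incl V F"
  by (simp add: sub_incl_def)

text \<open>Proved for the ambient algebra alone, where the axioms reduce to identity laws; the
  inclusions between subalgebras arise from it by restricting both ends.\<close>

lemma sub_incl_map:
  fixes V :: "('v, 'w) smcat" (structure)
  assumes F: "lax_algebra V F"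
  shows "algebra_map V F F (sub_incl V F)"
proof -
  interpret lax_algebra V F by fact
  show ?thesis
    apply (intro_locales)
    apply (unfold algebra_map_axioms_def sub_incl_simps)
    apply (intro conjI allI impI)
    subgoal by (simp add: is_functor_def)
    subgoal for \<phi> X Y A using homD[of \<phi> V X Y] hom_obj[of \<phi> X Y] by (simp add: fib_idn_iso act_obj)
    subgoal for \<phi> X Y a A A'
      using homD[of \<phi> V X Y] hom_obj[of \<phi> X Y] actA_hom[of \<phi> X Y a A A'] by (simp add: fib_idl fib_idr)
    subgoal premises p for \<phi> X Y \<psi> Z A
    proof -
      have *: "fcmp F \<psi> \<phi> A \<in> hom (fib F Z) (act F (\<psi> \<cdot> \<phi>) A) (act F \<psi> (act F \<phi> A))"
        using p by (blast intro: fcmp_iso isos_hom)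
      have "trg V (\<psi> \<cdot> \<phi>) = Z" using cmp_hom[OF p(1,2)] homD by fast
      then show ?thesis
        using p homD[OF p(1)] homD[OF p(2)] hom_obj[OF p(2)] *
        by (simp add: actA_idn[OF p(2)] act_obj[OF p(1)] fib_idl[OF _ *] fib_idr[OF _ *])
    qed
    subgoal premises p for X A
      using p fidn_iso[OF p, THEN isos_hom] idn_hom[OF p(1), THEN homD] by (simp add: fib_idr)
    subgoal by (simp add: fib_idn_iso ten_obj mu_obj)
    subgoal premises p for X Y a A A' b B B'
      using muA_hom[OF p] ten_obj[OF p(1,2)] by (simp add: fib_idl fib_idr)
    subgoal premises p for \<phi> X X' \<psi> Y Y' A B
    proof -
      note [simp] = p tenA_hom[OF p(1,2), THEN homD] p(1)[THEN homD] p(2)[THEN homD]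
        hom_obj[OF p(1)] hom_obj[OF p(2)] ten_obj mu_obj act_obj[OF p(1)] act_obj[OF p(2)]
      note h = muN_iso[OF p, THEN isos_hom]
      have "act F (\<phi> \<boxtimes> \<psi>) (mu F X Y A B) \<in> Obj (fib F (X' \<boxplus> Y'))"
        by (rule act_obj[OF tenA_hom[OF p(1,2)]]) simp
      then show ?thesis
        using h by (simp add: actA_idn[OF tenA_hom[OF p(1,2)]] muA_idn fib_idl[OF _ h] fib_idr[OF _ h] fib_idl[OF _ fib_idn_hom])
    qed
    subgoal by (simp add: fib_idn_iso unit_obj_obj eta_obj)
    subgoal premises p for X Y Z A B C \<alpha> W
    proof -
      note a = assoc_iso[OF p(1-3), THEN isos_hom]
      note [simp] = p a[THEN homD] ten_obj mu_obj 
      note h = mu_assoc_iso[OF p(1-6), THEN isos_hom]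
      have *: "act F (assoc V X Y Z) (mu F (X \<boxplus> Y) Z (mu F X Y A B) C) \<in> Obj (fib F (X \<boxplus> (Y \<boxplus> Z)))"
        by (rule act_obj[OF a]) simp
      show ?thesis
        using * h by (simp add: actA_idn[OF a] muA_idn fib_idl[OF _ h] fib_idr[OF _ h] fib_idl[OF _ fib_idn_hom])
    qed
    subgoal premises p for X A
    proof -
      note a = lunit_iso[OF p(1), THEN isos_hom]
      note [simp] = p a[THEN homD] ten_obj mu_obj unit_obj_obj eta_obj
      note h = mu_lunit_iso[OF p, THEN isos_hom]
      have *: "act F (lunit V X) (mu F (unit_obj V) X (eta F) A) \<in> Obj (fib F X)"
        by (rule act_obj[OF a]) simp
      show ?thesis
        using * h by (simp add: actA_idn[OF a] muA_idn fib_idl[OF _ h] fib_idr[OF _ h] fib_idl[OF _ fib_idn_hom])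
    qed
    subgoal premises p for X A
    proof -
      note a = runit_iso[OF p(1), THEN isos_hom]
      note [simp] = p a[THEN homD] ten_obj mu_obj unit_obj_obj eta_obj
      note h = mu_runit_iso[OF p, THEN isos_hom]
      have *: "act F (runit V X) (mu F X (unit_obj V) A (eta F)) \<in> Obj (fib F X)"
        by (rule act_obj[OF a]) simp
      show ?thesis
        using * h by (simp add: actA_idn[OF a] muA_idn fib_idl[OF _ h] fib_idr[OF _ h] fib_idl[OF _ fib_idn_hom])
    qed
    subgoal premises p for X Y A B
    proof -
      note a = braid_hom[OF p(1,2)]
      note [simp] = p a[THEN homD] ten_obj mu_obj
      note h = mu_braid_iso[OF p(1-4), THEN isos_hom]
      have *: "act F (braid V X Y) (mu F X Y A B) \<in> Obj (fib F (Y \<boxplus> X))"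
        by (rule act_obj[OF a]) simp
      show ?thesis
        using * h by (simp add: actA_idn[OF a] muA_idn fib_idl[OF _ h] fib_idr[OF _ h] fib_idl[OF _ fib_idn_hom])
    qed
    done
qed

text \<open>A full subalgebra shares all operations with the ambient algebra, so the same record
  \<open>T\<close> serves. Landing in \<open>Q\<close> makes its cells arrows of the smaller
  fibres.\<close>

lemma algebra_map_full_sub:
  fixes V :: "('v, 'w) smcat" (structure)
  assumes T: "algebra_map V F G T" and P: "subalgebra V F P" and Q: "subalgebra V G Q"
    and PQ: "\<And>X A. X \<in> Obj V \<Longrightarrow> A \<in> Obj (fib F X) \<Longrightarrow> P X A \<Longrightarrow> Q X (tr T X A)"
  shows "algebra_map V (full_sub F P) (full_sub G Q) T"
proof -
  interpret T: algebra_map V F G T by fact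
  interpret F': lax_algebra V "full_sub F P" by (rule full_sub_algebra) fact
  interpret G': lax_algebra V "full_sub G Q" by (rule full_sub_algebra) fact
  note actP = subalgebraD(1)[OF P] and muP = subalgebraD(2)[OF P] and etaP = subalgebraD(3)[OF P]
  note actQ = subalgebraD(1)[OF Q] and muQ = subalgebraD(2)[OF Q] and etaQ = subalgebraD(3)[OF Q]
  have trQ: "Q X (tr T X A)" if "X \<in> Obj V" "A \<in> Obj (fib F X)" "P X A" for X A
    using PQ that by blast
  have V: "\<phi> \<in> hom V X Y \<Longrightarrow> X \<in> Obj V" "\<phi> \<in> hom V X Y \<Longrightarrow> Y \<in> Obj V" for \<phi> X Y
    by (blast dest: T.F.hom_obj)+
  have tr_obj: "tr T X A \<in> Obj (fib G X)" if "X \<in> Obj V" "A \<in> Obj (fib F X)" for X A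
    using is_functorD(1)[OF T.tr_functor] that by blast
  have fib_obj: "A \<in> Obj (fib F X)" "B \<in> Obj (fib F X)" if "a \<in> hom (fib F X) A B" "X \<in> Obj V" for a A B X
    using T.F.fib_hom_obj that by blast+
  note closed = actP muP etaP actQ muQ etaQ trQ V T.F.act_obj T.G.act_obj tr_obj fib_obj T.F.ten_obj
     T.F.mu_obj T.G.mu_obj T.F.unit_obj_obj T.F.eta_obj T.G.eta_obj
  show ?thesis
    apply (intro_locales)
    apply (unfold algebra_map_axioms_def)
    apply (intro conjI allI impI; simp only: full_sub_simps full_subcat_simps hom_full_subcat isos_full_subcat mem_Collect_eq)
    subgoal premises p for X 
      using T.tr_functor[OF p] trQ[OF p] fib_obj[OF _ p] unfolding is_functor_def
      by (simp add: Ball_def) metis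
    subgoal by (blast intro: T.tr_act_iso closed)
    subgoal by (blast intro: T.tr_act_nat)
    subgoal by (blast intro: T.tr_act_cmp)
    subgoal by (blast intro: T.tr_act_idn)
    subgoal by (blast intro: T.tr_mu_iso closed)
    subgoal by (blast intro: T.tr_mu_nat)
    subgoal by (blast intro: T.tr_mu_mod)
    subgoal by (blast intro: T.tr_eta_iso closed)
    subgoal by (blast intro: T.tr_mu_assoc[OF _ _ _ _ _ _ refl refl])
    subgoal by (blast intro: T.tr_mu_lunit)
    subgoal by (blast intro: T.tr_mu_runit)
    subgoal by (blast intro: T.tr_mu_braid)
    done
qed

lemma alg_map_eqD:
  assumes "alg_map_eq V F S T"
  shows "X \<in> Obj V \<Longrightarrow> A \<in> Obj (fib F X) \<Longrightarrow> tr S X A = tr T X A"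
    and "X \<in> Obj V \<Longrightarrow> a \<in> Arr (fib F X) \<Longrightarrow> trA S X a = trA T X a"
    and "X \<in> Obj V \<Longrightarrow> a \<in> hom (fib F X) A B \<Longrightarrow> trA S X a = trA T X a"
    and "\<phi> \<in> hom V X Y \<Longrightarrow> A \<in> Obj (fib F X) \<Longrightarrow> tr_act S \<phi> A = tr_act T \<phi> A"
    and "X \<in> Obj V \<Longrightarrow> Y \<in> Obj V \<Longrightarrow> A \<in> Obj (fib F X) \<Longrightarrow> B \<in> Obj (fib F Y) \<Longrightarrow>
        tr_mu S X Y A B = tr_mu T X Y A B"
    and "tr_eta S = tr_eta T"
  using assms unfolding alg_map_eq_def hom_def by auto

text \<open>The axioms evaluate a map on the carriers only. This transports them from a leg of a
  cocone to a glued map, which agrees with that leg just on the subalgebra of the leg.\<close>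

lemma algebra_map_cong:
  fixes V :: "('v, 'w) smcat" (structure)
  assumes T: "algebra_map V F G T" and eq: "alg_map_eq V F S T"
  shows "algebra_map V F G S"
proof -
  interpret T: algebra_map V F G T by fact
  note eqD = alg_map_eqD[OF eq]
  note V = T.F.hom_obj
  show ?thesis
    apply (intro_locales)
    apply (unfold algebra_map_axioms_def)
    apply (intro conjI allI impI)
    subgoal premises p for X 
    proof -
      interpret category "fib F X" by (rule T.F.fib_category) fact
      show ?thesis
        unfolding is_functor_def
      proof (intro conjI ballI allI impI)
        fix A assume A: "A \<in> Obj (fib F X)"
        show "tr S X A \<in> Obj (fib G X)" "trA S X (idn (fib F X) A) = idn (fib G X) (tr S X A)"
          using eqD(1)[OF p A] eqD(3)[OF p idn_hom[OF A]] is_functorD(1,2)[OF T.tr_functor[OF p] A] by simp_all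
      next
        fix A B a assume a: "a \<in> hom (fib F X) A B"
        show "trA S X a \<in> hom (fib G X) (tr S X A) (tr S X B)"
          using is_functorD(3)[OF T.tr_functor[OF p] a] eqD(3)[OF p a] eqD(1)[OF p] hom_obj[OF a] by simp
      next
        fix A B E a b assume a: "a \<in> hom (fib F X) A B" and b: "b \<in> hom (fib F X) B E"
        show "trA S X (b \<cdot>\<^bsub>fib F X\<^esub> a) = trA S X b \<cdot>\<^bsub>fib G X\<^esub> trA S X a"
          using is_functorD(4)[OF T.tr_functor[OF p] a b] eqD(3)[OF p a] eqD(3)[OF p b]
            eqD(3)[OF p cmp_hom[OF a b]] by simp
      qed
    qed
    subgoal premises p for \<phi> X Y A
      using T.tr_act_iso[OF p] eqD(1) eqD(4)[OF p] V(1,2)[OF p(1)] T.F.act_obj[OF p] p by simp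
    subgoal premises p for \<phi> X Y a A A'
      using T.tr_act_nat[OF p] eqD(3)[OF _ p(2)] eqD(4)[OF p(1)]  eqD(3)[OF _ T.F.actA_hom[OF p]] V(1,2)[OF p(1)] 
        T.F.fib_hom_obj[OF _ p(2)] by simp
    subgoal premises p for \<phi> X Y \<psi> Z A
      using T.tr_act_cmp[OF p] V(1,2)[OF p(1)] V(1,2)[OF p(2)] p eqD(4)[OF p(1,3)] eqD(4)[OF p(2)]
        eqD(4)[OF T.F.cmp_hom[OF p(1,2)] p(3)] T.F.act_obj[OF p(1,3)] eqD(1)
        eqD(3)[OF _ T.F.fcmp_iso[OF p, THEN isos_hom]] by simp
    subgoal premises p for X A
      using T.tr_act_idn[OF p] p eqD(1)[OF p] eqD(4)[OF T.F.idn_hom[OF p(1)] p(2)]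
        eqD(3)[OF _ T.F.fidn_iso[OF p, THEN isos_hom]] by simp
    subgoal premises p for X Y A B
      using T.tr_mu_iso[OF p] p eqD(5)[OF p] eqD(1) T.F.ten_obj T.F.mu_obj[OF p] by simp
    subgoal premises p for X Y a A A' b B B'
      using T.tr_mu_nat[OF p] p(1,2) eqD(3)[OF _ p(3)] eqD(3)[OF _ p(4)] eqD(3)[OF _ T.F.muA_hom[OF p]]
        T.F.fib_hom_obj[OF _ p(3)] T.F.fib_hom_obj[OF _ p(4)] T.F.ten_obj[OF p(1,2)] eqD(5)[OF p(1,2)] by simp
    subgoal premises p for \<phi> X X' \<psi> Y Y' A B
      using T.tr_mu_mod[OF p] p V(1,2)[OF p(1)] V(1,2)[OF p(2)] eqD(4)[OF p(1,3)] eqD(4)[OF p(2,4)] 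
        eqD(3)[OF _ T.F.muN_iso[OF p, THEN isos_hom]] T.F.ten_obj eqD(4)[OF T.F.tenA_hom[OF p(1,2)]]
        T.F.mu_obj eqD(5) T.F.act_obj[OF p(1,3)] T.F.act_obj[OF p(2,4)] eqD(1) by simp
    subgoal using T.tr_eta_iso eqD(6) eqD(1) T.F.unit_obj_obj T.F.eta_obj by simp
    subgoal premises p for X Y Z A B C \<alpha> W
      using T.tr_mu_assoc[OF p] p eqD(1,5) T.F.mu_obj T.F.ten_obj
        eqD(3)[OF _ T.F.mu_assoc_iso[OF p(1-6), THEN isos_hom]]
        eqD(4)[OF T.F.assoc_iso[OF p(1-3), THEN isos_hom]] by simp
    subgoal premises p for X A
      using T.tr_mu_lunit[OF p] p eqD(1,5,6) T.F.mu_obj T.F.ten_obj T.F.unit_obj_obj T.F.eta_obj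
        eqD(3)[OF _ T.F.mu_lunit_iso[OF p, THEN isos_hom]]
        eqD(4)[OF T.F.lunit_iso[OF p(1), THEN isos_hom]] by simp
    subgoal premises p for X A
      using T.tr_mu_runit[OF p] p eqD(1,5,6) T.F.mu_obj T.F.ten_obj T.F.unit_obj_obj T.F.eta_obj
        eqD(3)[OF _ T.F.mu_runit_iso[OF p, THEN isos_hom]]
        eqD(4)[OF T.F.runit_iso[OF p(1), THEN isos_hom]] by simp
    subgoal premises p for X Y A B
      using T.tr_mu_braid[OF p] p eqD(1,5) T.F.mu_obj T.F.ten_obj
        eqD(3)[OF _ T.F.mu_braid_iso[OF p, THEN isos_hom]]
        eqD(4)[OF T.F.braid_hom[OF p(1,2)]] by simp
    done
qed

section \<open>Directed unions of full subalgebras\<close>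

lemma alg_map_comp_simps [simp]:
  "tr (alg_map_comp V F H T S) X A = tr T X (tr S X A)"
  "trA (alg_map_comp V F H T S) X a = trA T X (trA S X a)"
  "tr_act (alg_map_comp V F H T S) \<phi> A = trA T (trg V \<phi>) (tr_act S \<phi> A) \<cdot>\<^bsub>fib H (trg V \<phi>)\<^esub>
     tr_act T \<phi> (tr S (src V \<phi>) A)"
  "tr_mu (alg_map_comp V F H T S) X Y A B = trA T (X \<boxplus>\<^bsub>V\<^esub> Y) (tr_mu S X Y A B)
     \<cdot>\<^bsub>fib H (X \<boxplus>\<^bsub>V\<^esub> Y)\<^esub> tr_mu T X Y (tr S X A) (tr S Y B)"
  "tr_eta (alg_map_comp V F H T S) = trA T (unit_obj V) (tr_eta S) \<cdot>\<^bsub>fib H (unit_obj V)\<^esub> tr_eta T"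
  by (simp_all add: alg_map_comp_def)

text \<open>Each cell of the composite carries an extra factor, the image under \<open>T\<close> of
  an identity cell. Functoriality of \<open>T\<close> turns it into an identity, so precomposing
  with an inclusion is plain restriction.\<close>

lemma sub_incl_comp:
  assumes T: "algebra_map V (full_sub F P) G T"
    and le: "\<And>X A. X \<in> Obj V \<Longrightarrow> A \<in> Obj (fib F X) \<Longrightarrow> P' X A \<Longrightarrow> P X A"
  shows "alg_map_eq V (full_sub F P') (alg_map_comp V H G T (sub_incl V F)) T"
proof -
  interpret T: algebra_map V "full_sub F P" G T by fact
  have idn: "trA T X (idn (fib F X) A) = idn (fib G X) (tr T X A)"
    if "X \<in> Obj V" "A \<in> Obj (fib F X)" "P X A" for X A
    using is_functorD(2)[OF T.tr_functor[OF that(1)], of A] that by simp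
  show ?thesis
    unfolding alg_map_eq_def
  proof (intro conjI ballI)
    fix \<phi> A assume \<phi>: "\<phi> \<in> Arr V" and A: "A \<in> Obj (fib (full_sub F P') (src V \<phi>))"
    have h: "\<phi> \<in> hom V (src V \<phi>) (trg V \<phi>)" using \<phi> by (simp add: hom_def)
    have A': "A \<in> Obj (fib (full_sub F P) (src V \<phi>))" using A le T.F.src_obj[OF \<phi>] by simp
    have "tr_act T \<phi> A \<in> hom (fib G (trg V \<phi>)) (act G \<phi> (tr T (src V \<phi>) A)) (tr T (trg V \<phi>) (act F \<phi> A))"
      using T.tr_act_iso[OF h A', THEN isos_hom] by simp
    then show "tr_act (alg_map_comp V H G T (sub_incl V F)) \<phi> A = tr_act T \<phi> A"
      using T.F.act_obj[OF h A'] T.F.trg_obj[OF \<phi>] by (simp add: idn T.G.fib_idl)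
  next
    fix X Y A B assume X: "X \<in> Obj V" and Y: "Y \<in> Obj V"
      and "A \<in> Obj (fib (full_sub F P') X)" "B \<in> Obj (fib (full_sub F P') Y)"
    then have A: "A \<in> Obj (fib (full_sub F P) X)" and B: "B \<in> Obj (fib (full_sub F P) Y)"
      using le by simp_all
    show "tr_mu (alg_map_comp V H G T (sub_incl V F)) X Y A B = tr_mu T X Y A B"
      using T.tr_mu_iso[OF X Y A B, THEN isos_hom] T.F.mu_obj[OF X Y A B] T.F.ten_obj[OF X Y]
      by (simp add: idn T.G.fib_idl)
  next
    show "tr_eta (alg_map_comp V H G T (sub_incl V F)) = tr_eta T"
      using T.tr_eta_iso[THEN isos_hom] T.F.eta_obj T.F.unit_obj_obj by (simp add: idn T.G.fib_idl)
  qed simp_all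
qed

section \<open>Gluing maps of algebras along a directed union\<close>

lemma alg_map_eq_sym: "alg_map_eq V F S T \<Longrightarrow> alg_map_eq V F T S"
  by (simp add: alg_map_eq_def)

lemma alg_map_eq_trans: "alg_map_eq V F R S \<Longrightarrow> alg_map_eq V F S T \<Longrightarrow> alg_map_eq V F R T"
  by (simp add: alg_map_eq_def)

text \<open>The union is required of objects only. Arrows of the union are covered as well: by
  directedness both ends lie in one member, and members are full.\<close>

locale directed_union =
  fixes V :: "('v, 'w) smcat" (structure) and F :: "('v, 'w, 'o, 'm) alg"
    and J :: "'j set" and le :: "'j \<Rightarrow> 'j \<Rightarrow> bool" and P :: "'j \<Rightarrow> 'v \<Rightarrow> 'o \<Rightarrow> bool"
    and Q :: "'v \<Rightarrow> 'o \<Rightarrow> bool"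
  assumes P_sub: "i \<in> J \<Longrightarrow> subalgebra V F (P i)"
    and Q_sub: "subalgebra V F Q"
    and P_mono: "\<lbrakk>i \<in> J; j \<in> J; le i j; X \<in> Obj V; A \<in> Obj (fib F X); P i X A\<rbrakk> \<Longrightarrow> P j X A"
    and directed: "\<lbrakk>i \<in> J; j \<in> J\<rbrakk> \<Longrightarrow> \<exists>k \<in> J. le i k \<and> le j k"
    and nonempty: "J \<noteq> {}"
    and Q_union: "\<lbrakk>X \<in> Obj V; A \<in> Obj (fib F X)\<rbrakk> \<Longrightarrow> Q X A \<longleftrightarrow> (\<exists>i \<in> J. P i X A)"
begin

sublocale F: lax_algebra V F using Q_sub by (simp add: subalgebra_def)

text \<open>By induction on the set, passing to a common bound with each new pair; a nonempty index
  set provides the start.\<close>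

lemma common_index:
  assumes "finite K" "\<And>X A. (X, A) \<in> K \<Longrightarrow> X \<in> Obj V \<and> A \<in> Obj (fib F X) \<and> Q X A"
  shows "\<exists>i \<in> J. \<forall>(X, A) \<in> K. P i X A"
  using assms
proof (induction K)
  case empty
  then show ?case using nonempty by blast
next
  case (insert p K)
  obtain X A where p: "p = (X, A)" by fastforce
  have XA: "X \<in> Obj V" "A \<in> Obj (fib F X)" "Q X A" using insert.prems p by blast+
  obtain i where i: "i \<in> J" "\<forall>(X, A) \<in> K. P i X A" using insert by blast
  obtain j where j: "j \<in> J" "P j X A" using Q_union XA by blast
  obtain k where k: "k \<in> J" "le i k" "le j k" using directed i(1) j(1) by blast
  have "P k X A" using P_mono[OF j(1) k(1,3) XA(1,2) j(2)] .
  moreover have "P k X' A'" if "(X', A') \<in> K" for X' A'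
    using P_mono[OF i(1) k(1,2)] insert.prems that i(2) by blast
  ultimately show ?case using k(1) p by blast
qed

lemma common1:
  assumes "X \<in> Obj V" "A \<in> Obj (fib F X)" "Q X A"
  obtains i where "i \<in> J" "P i X A"
  using assms Q_union by blast

lemma common2:
  assumes "X \<in> Obj V" "A \<in> Obj (fib F X)" "Q X A" "Y \<in> Obj V" "B \<in> Obj (fib F Y)" "Q Y B"
  obtains i where "i \<in> J" "P i X A" "P i Y B"
  using assms common_index[of "{(X, A), (Y, B)}"] by auto

lemma common3:
  assumes "X \<in> Obj V" "A \<in> Obj (fib F X)" "Q X A" "Y \<in> Obj V" "B \<in> Obj (fib F Y)" "Q Y B"
    "Z \<in> Obj V" "C \<in> Obj (fib F Z)" "Q Z C"
  obtains i where "i \<in> J" "P i X A" "P i Y B" "P i Z C"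
  using assms common_index[of "{(X, A), (Y, B), (Z, C)}"] by auto

text \<open>Four is the largest number of objects in any axiom of a map: naturality of
  \<open>tr_mu\<close> involves two arrows and hence four ends.\<close>

lemma common4:
  assumes "X \<in> Obj V" "A \<in> Obj (fib F X)" "Q X A" "Y \<in> Obj V" "B \<in> Obj (fib F Y)" "Q Y B"
    "Z \<in> Obj V" "C \<in> Obj (fib F Z)" "Q Z C" "U \<in> Obj V" "D \<in> Obj (fib F U)" "Q U D"
  obtains i where "i \<in> J" "P i X A" "P i Y B" "P i Z C" "P i U D"
  using assms common_index[of "{(X, A), (Y, B), (Z, C), (U, D)}"] by auto

lemma algebra_map_glue:
  assumes T: "\<And>i. i \<in> J \<Longrightarrow> algebra_map V (full_sub F (P i)) G T"
  shows "algebra_map V (full_sub F Q) G T"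
proof -
  interpret F': lax_algebra V "full_sub F Q" by (rule full_sub_algebra[OF Q_sub])
  \<comment> \<open>Any one member shows that \<open>G\<close> is an algebra, and it settles the
    axiom on \<open>tr_eta\<close>, which quantifies over no object.\<close>
  obtain i\<^sub>0 where i\<^sub>0: "i\<^sub>0 \<in> J" using nonempty by blast
  interpret T0: algebra_map V "full_sub F (P i\<^sub>0)" G T by (rule T[OF i\<^sub>0])
  note V = F.hom_obj
  show ?thesis
    apply (intro_locales)
    apply (unfold algebra_map_axioms_def)
    apply (intro conjI allI impI)
    subgoal premises p for X
      unfolding is_functor_def
    proof (intro conjI ballI allI impI)
      fix A assume A: "A \<in> Obj (fib (full_sub F Q) X)"
      then obtain i where i: "i \<in> J" "P i X A" using common1[of X A] p by auto
      show "tr T X A \<in> Obj (fib G X)" "trA T X (idn (fib (full_sub F Q) X) A) = idn (fib G X) (tr T X A)"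
        using is_functorD(1,2)[OF algebra_map.tr_functor[OF T[OF i(1)] p], of A] A i by simp_all
    next
      fix A B a assume a: "a \<in> hom (fib (full_sub F Q) X) A B"
      then obtain i where i: "i \<in> J" "P i X A" "P i X B"
        using common2[of X A X B] F.fib_hom_obj[of X a A B] p by auto
      show "trA T X a \<in> hom (fib G X) (tr T X A) (tr T X B)"
        using is_functorD(3)[OF algebra_map.tr_functor[OF T[OF i(1)] p], of a A B] a i by simp
    next
      fix A B E a b assume a: "a \<in> hom (fib (full_sub F Q) X) A B" and b: "b \<in> hom (fib (full_sub F Q) X) B E"
      obtain i where i: "i \<in> J" "P i X A" "P i X B" "P i X E"
        using common3[of X A X B X E] F.fib_hom_obj[of X a A B] F.fib_hom_obj[of X b B E] p a b by auto
      show "trA T X (b \<cdot>\<^bsub>fib (full_sub F Q) X\<^esub> a) = trA T X b \<cdot>\<^bsub>fib G X\<^esub> trA T X a"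
        using is_functorD(4)[OF algebra_map.tr_functor[OF T[OF i(1)] p], of a A B b E] a b i by simp
    qed
    subgoal premises p for \<phi> X Y A
      using p(2) common1[of X A] V(1)[OF p(1)] algebra_map.tr_act_iso[OF T p(1), of _ A] by auto
    subgoal premises p for \<phi> X Y a A A'
      using p(2) common2[of X A X A'] V(1)[OF p(1)] F.fib_hom_obj[of X a A A']
        algebra_map.tr_act_nat[OF T p(1), of _ a A A'] by auto
    subgoal premises p for \<phi> X Y \<psi> Z A
      using p(3) common1[of X A] V(1)[OF p(1)] algebra_map.tr_act_cmp[OF T p(1,2), of _ A] by auto
    subgoal premises p for X A
      using p(2) common1[of X A] p(1) algebra_map.tr_act_idn[OF T p(1), of _ A] by auto
    subgoal premises p for X Y A B
      using p common2[of X A Y B] algebra_map.tr_mu_iso[OF T p(1,2), of _ A B] by auto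
    subgoal premises p for X Y a A A' b B B'
      using p common4[of X A X A' Y B Y B'] F.fib_hom_obj[of X a A A'] F.fib_hom_obj[of Y b B B']
        algebra_map.tr_mu_nat[OF T p(1,2), of _ a A A' b B B'] by auto
    subgoal premises p for \<phi> X X' \<psi> Y Y' A B
      using p(3,4) common2[of X A Y B] V(1)[OF p(1)] V(1)[OF p(2)] algebra_map.tr_mu_mod[OF T p(1,2), of _ A B] by auto
    subgoal using T0.tr_eta_iso by simp
    subgoal premises p for X Y Z A B C \<alpha> W
      using p(4-6) common3[of X A Y B Z C] p(1-3)
        algebra_map.tr_mu_assoc[OF T p(1-3) _ _ _ p(7,8), of _ A B C] by auto
    subgoal premises p for X A
      using p common1[of X A] algebra_map.tr_mu_lunit[OF T p(1), of _ A] by auto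
    subgoal premises p for X A
      using p common1[of X A] algebra_map.tr_mu_runit[OF T p(1), of _ A] by auto
    subgoal premises p for X Y A B
      using p common2[of X A Y B] algebra_map.tr_mu_braid[OF T p(1,2), of _ A B] by auto
    done
qed

lemma incl_map:
  assumes "subalgebra V F R" "subalgebra V F S"
    and "\<And>X A. X \<in> Obj V \<Longrightarrow> A \<in> Obj (fib F X) \<Longrightarrow> R X A \<Longrightarrow> S X A"
  shows "algebra_map V (full_sub F R) (full_sub F S) (sub_incl V F)"
  by (rule algebra_map_full_sub[OF sub_incl_map assms(1,2)]) (use assms F.lax_algebra_axioms in auto)

lemma incl_map_Q: "i \<in> J \<Longrightarrow> algebra_map V (full_sub F (P i)) (full_sub F Q) (sub_incl V F)"
  by (rule incl_map[OF P_sub Q_sub]) (auto simp: Q_union)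

lemma incl_map_P: "i \<in> J \<Longrightarrow> j \<in> J \<Longrightarrow> le i j \<Longrightarrow>
    algebra_map V (full_sub F (P i)) (full_sub F (P j)) (sub_incl V F)"
  by (rule incl_map[OF P_sub P_sub]) (auto intro: P_mono)

lemma cocone_glue:
  assumes c: "alg_cocone V J le (\<lambda>i. full_sub F (P i)) (\<lambda>i j. sub_incl V F) G c"
  obtains u where "\<And>i. i \<in> J \<Longrightarrow> alg_map_eq V (full_sub F (P i)) u (c i)"
proof -
  have c_map: "algebra_map V (full_sub F (P i)) G (c i)" if "i \<in> J" for i
    using c that by (simp add: alg_cocone_def)
  \<comment> \<open>The cocone equations speak of composites with inclusions. With these removed,
    the leg at the later index restricts to the leg at the earlier one.\<close>
  have c_le: "alg_map_eq V (full_sub F (P i)) (c j) (c i)" if "i \<in> J" "j \<in> J" "le i j" for i j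
  proof -
    have "alg_map_eq V (full_sub F (P i))
        (alg_map_comp V (full_sub F (P i)) G (c j) (sub_incl V F)) (c i)"
      using c that by (simp add: alg_cocone_def)
    moreover have "alg_map_eq V (full_sub F (P i))
        (alg_map_comp V (full_sub F (P i)) G (c j) (sub_incl V F)) (c j)"
      by (rule sub_incl_comp[OF c_map]) (use that P_mono in auto)
    ultimately show ?thesis using alg_map_eq_sym alg_map_eq_trans by blast
  qed
  define a\<^sub>o where "a\<^sub>o X A = (SOME i. i \<in> J \<and> P i X A)" for X A
  \<comment> \<open>Serves both for the two ends of an arrow, which by fullness is then an arrow of
    the chosen member, and for the two arguments of \<open>tr_mu\<close>.\<close>
  define a\<^sub>p where "a\<^sub>p X A Y B = (SOME i. i \<in> J \<and> P i X A \<and> P i Y B)" for X A Y B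
  define a\<^sub>e where "a\<^sub>e = (SOME i. i \<in> J)"
  define u where "u = \<lparr>
    tr = (\<lambda>X A. tr (c (a\<^sub>o X A)) X A),
    trA = (\<lambda>X a. trA (c (a\<^sub>p X (src (fib F X) a) X (trg (fib F X) a))) X a),
    tr_act = (\<lambda>\<phi> A. tr_act (c (a\<^sub>o (src V \<phi>) A)) \<phi> A),
    tr_mu = (\<lambda>X Y A B. tr_mu (c (a\<^sub>p X A Y B)) X Y A B),
    tr_eta = tr_eta (c a\<^sub>e)\<rparr>"
  have a\<^sub>o: "a\<^sub>o X A \<in> J \<and> P (a\<^sub>o X A) X A" if "i \<in> J" "P i X A" for i X A
    unfolding a\<^sub>o_def by (rule someI[where x = i]) (use that in simp)
  have a\<^sub>p: "a\<^sub>p X A Y B \<in> J \<and> P (a\<^sub>p X A Y B) X A \<and> P (a\<^sub>p X A Y B) Y B"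
    if "i \<in> J" "P i X A" "P i Y B" for i X A Y B
    unfolding a\<^sub>p_def by (rule someI[where x = i]) (use that in simp)
  have a\<^sub>e: "a\<^sub>e \<in> J" unfolding a\<^sub>e_def using nonempty by (simp add: some_in_eq)
  have "alg_map_eq V (full_sub F (P i)) u (c i)" if i: "i \<in> J" for i
    unfolding alg_map_eq_def
  proof (intro conjI ballI)
    fix X A assume X: "X \<in> Obj V" and A: "A \<in> Obj (fib (full_sub F (P i)) X)"
    have j: "a\<^sub>o X A \<in> J" "P (a\<^sub>o X A) X A" using a\<^sub>o[OF i, of X A] A by simp_all
    \<comment> \<open>The chosen index need not be comparable with \<open>i\<close>, so both legs
      are compared with the leg at a common bound \<open>k\<close>. The other components follow the
      same pattern.\<close>
    obtain k where k: "k \<in> J" "le i k" "le (a\<^sub>o X A) k" using directed i j by blast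
    show "tr u X A = tr (c i) X A"
      using alg_map_eqD(1)[OF c_le[OF i k(1,2)] X A] alg_map_eqD(1)[OF c_le[OF j(1) k(1,3)] X, of A] A j
      by (simp add: u_def)
  next
    fix X f assume X: "X \<in> Obj V" and f: "f \<in> Arr (fib (full_sub F (P i)) X)"
    let ?j = "a\<^sub>p X (src (fib F X) f) X (trg (fib F X) f)"
    have j: "?j \<in> J" "f \<in> Arr (fib (full_sub F (P ?j)) X)"
      using a\<^sub>p[OF i, of X "src (fib F X) f" X "trg (fib F X) f"] f by simp_all
    obtain k where k: "k \<in> J" "le i k" "le ?j k" using directed i j by blast
    show "trA u X f = trA (c i) X f"
      using alg_map_eqD(2)[OF c_le[OF i k(1,2)] X f] alg_map_eqD(2)[OF c_le[OF j(1) k(1,3)] X j(2)]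
      by (simp add: u_def)
  next
    fix \<phi> A assume \<phi>: "\<phi> \<in> Arr V" and A: "A \<in> Obj (fib (full_sub F (P i)) (src V \<phi>))"
    let ?j = "a\<^sub>o (src V \<phi>) A"
    have h: "\<phi> \<in> hom V (src V \<phi>) (trg V \<phi>)" using \<phi> by (simp add: hom_def)
    have j: "?j \<in> J" "A \<in> Obj (fib (full_sub F (P ?j)) (src V \<phi>))" 
      using a\<^sub>o[OF i, of "src V \<phi>" A] A by simp_all
    obtain k where k: "k \<in> J" "le i k" "le ?j k" using directed i j by blast
    show "tr_act u \<phi> A = tr_act (c i) \<phi> A"
      using alg_map_eqD(4)[OF c_le[OF i k(1,2)] h A] alg_map_eqD(4)[OF c_le[OF j(1) k(1,3)] h j(2)]
      by (simp add: u_def)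
  next
    fix X Y A B assume X: "X \<in> Obj V" and Y: "Y \<in> Obj V" and A: "A \<in> Obj (fib (full_sub F (P i)) X)"
      and B: "B \<in> Obj (fib (full_sub F (P i)) Y)"
    let ?j = "a\<^sub>p X A Y B"
    have j: "?j \<in> J" "A \<in> Obj (fib (full_sub F (P ?j)) X)" "B \<in> Obj (fib (full_sub F (P ?j)) Y)"
      using a\<^sub>p[OF i, of X A Y B] A B by simp_all
    obtain k where k: "k \<in> J" "le i k" "le ?j k" using directed i j by blast
    show "tr_mu u X Y A B = tr_mu (c i) X Y A B"
      using alg_map_eqD(5)[OF c_le[OF i k(1,2)] X Y A B] alg_map_eqD(5)[OF c_le[OF j(1) k(1,3)] X Y j(2,3)]
      by (simp add: u_def)
  next
    obtain k where k: "k \<in> J" "le i k" "le a\<^sub>e k" using directed i a\<^sub>e by blast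
    show "tr_eta u = tr_eta (c i)"
      using alg_map_eqD(6)[OF c_le[OF i k(1,2)]] alg_map_eqD(6)[OF c_le[OF a\<^sub>e k(1,3)]]
      by (simp add: u_def)
  qed
  then show ?thesis using that by blast
qed

text \<open>Responsible for uniqueness of the mediating map.\<close>

lemma alg_map_eq_glue:
  assumes "\<And>i. i \<in> J \<Longrightarrow> alg_map_eq V (full_sub F (P i)) S T"
  shows "alg_map_eq V (full_sub F Q) S T"
  unfolding alg_map_eq_def
proof (intro conjI ballI)
  fix X A assume X: "X \<in> Obj V" and A: "A \<in> Obj (fib (full_sub F Q) X)"
  then obtain i where "i \<in> J" "P i X A" using common1[of X A] by auto
  then show "tr S X A = tr T X A" using alg_map_eqD(1)[OF assms X, of i A] A by simp
next
  fix X f assume X: "X \<in> Obj V" and f: "f \<in> Arr (fib (full_sub F Q) X)"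
  then have h: "f \<in> hom (fib F X) (src (fib F X) f) (trg (fib F X) f)" by (simp add: hom_def)
  obtain i where "i \<in> J" "P i X (src (fib F X) f)" "P i X (trg (fib F X) f)"
    using common2[of X "src (fib F X) f" X "trg (fib F X) f"] F.fib_hom_obj[OF X h] X f by auto
  then show "trA S X f = trA T X f" using alg_map_eqD(2)[OF assms X, of i f] f by simp
next
  fix \<phi> A assume \<phi>: "\<phi> \<in> Arr V" and A: "A \<in> Obj (fib (full_sub F Q) (src V \<phi>))"
  have h: "\<phi> \<in> hom V (src V \<phi>) (trg V \<phi>)" using \<phi> by (simp add: hom_def)
  obtain i where "i \<in> J" "P i (src V \<phi>) A" using common1[of "src V \<phi>" A] A F.src_obj[OF \<phi>] by auto
  then show "tr_act S \<phi> A = tr_act T \<phi> A" using alg_map_eqD(4)[OF assms h, of i A] A by simp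
next
  fix X Y A B assume X: "X \<in> Obj V" and Y: "Y \<in> Obj V" and A: "A \<in> Obj (fib (full_sub F Q) X)"
    and B: "B \<in> Obj (fib (full_sub F Q) Y)"
  then obtain i where "i \<in> J" "P i X A" "P i Y B" using common2[of X A Y B] by auto
  then show "tr_mu S X Y A B = tr_mu T X Y A B" using alg_map_eqD(5)[OF assms X Y, of i A B] A B by simp
next
  show "tr_eta S = tr_eta T" using nonempty alg_map_eqD(6)[OF assms] by blast
qed

theorem directed_union_colimit:
  "alg_colimit TYPE('p \<times> 'n) V J le (\<lambda>i. full_sub F (P i)) (\<lambda>i j. sub_incl V F)
     (full_sub F Q) (\<lambda>i. sub_incl V F)"
  unfolding alg_colimit_def
proof (intro conjI allI impI)
  show "alg_diagram V J le (\<lambda>i. full_sub F (P i)) (\<lambda>i j. sub_incl V F)"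
    unfolding alg_diagram_def
    by (auto intro: full_sub_algebra P_sub incl_map_P sub_incl_comp P_mono simp: alg_map_eq_def[of V _ S S for S])
  show "alg_cocone V J le (\<lambda>i. full_sub F (P i)) (\<lambda>i j. sub_incl V F) (full_sub F Q) (\<lambda>i. sub_incl V F)"
    unfolding alg_cocone_def
    by (auto intro!: full_sub_algebra Q_sub incl_map_Q sub_incl_comp[where P = Q] incl_map_Q sub_incl_comp simp: Q_union)
next
  fix G :: "('v, 'w, 'p, 'n) alg" and c
  assume c: "alg_cocone V J le (\<lambda>i. full_sub F (P i)) (\<lambda>i j. sub_incl V F) G c"
  obtain u where u: "\<And>i. i \<in> J \<Longrightarrow> alg_map_eq V (full_sub F (P i)) u (c i)"
    using cocone_glue[OF c] by blast
  have comp: "alg_map_eq V (full_sub F (P i)) (alg_map_comp V (full_sub F (P i)) G v (sub_incl V F)) v"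
    if "algebra_map V (full_sub F Q) G v" "i \<in> J" for v i
    by (rule sub_incl_comp[OF that(1)]) (use that Q_union in blast)
  \<comment> \<open>The glued \<open>u\<close> is first a map on each member, because it agrees
    there with the leg \<open>c i\<close>; only then does gluing pass to the union.\<close>
  have u_map: "algebra_map V (full_sub F Q) G u"
    by (rule algebra_map_glue, rule algebra_map_cong[OF _ u]) (use c in \<open>simp_all add: alg_cocone_def\<close>)
  show "\<exists>u. algebra_map V (full_sub F Q) G u \<and>
      (\<forall>i \<in> J. alg_map_eq V (full_sub F (P i)) (alg_map_comp V (full_sub F (P i)) G u (sub_incl V F)) (c i)) \<and>
      (\<forall>u'. algebra_map V (full_sub F Q) G u' \<longrightarrow>
         (\<forall>i \<in> J. alg_map_eq V (full_sub F (P i)) (alg_map_comp V (full_sub F (P i)) G u' (sub_incl V F)) (c i)) \<longrightarrow>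
         alg_map_eq V (full_sub F Q) u' u)"
  proof (intro exI[of _ u] conjI ballI allI impI)
    show "algebra_map V (full_sub F Q) G u" by (rule u_map)
    show "alg_map_eq V (full_sub F (P i)) (alg_map_comp V (full_sub F (P i)) G u (sub_incl V F)) (c i)"
      if "i \<in> J" for i
      using comp[OF u_map that] u[OF that] alg_map_eq_trans by blast
    fix u'
    assume u': "algebra_map V (full_sub F Q) G u'" and
      eq: "\<forall>i \<in> J. alg_map_eq V (full_sub F (P i)) (alg_map_comp V (full_sub F (P i)) G u' (sub_incl V F)) (c i)"
    show "alg_map_eq V (full_sub F Q) u' u"
    proof (rule alg_map_eq_glue)
      fix i assume i: "i \<in> J"
      show "alg_map_eq V (full_sub F (P i)) u' u"
        using alg_map_eq_sym[OF comp[OF u' i]] eq[rule_format, OF i] alg_map_eq_sym[OF u[OF i]]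
        by (blast intro: alg_map_eq_trans)
    qed
  qed
qed

end

section \<open>Wiring diagrams form a symmetric monoidal category\<close>

lemma lcase_simps [simp]:
  "lcase f g (InL x) = f x" "lcase f g (InR x) = g x"
  by (simp_all add: lcase_def)

lemma tfs_sum_simps [simp]:
  "lab (X +\<^sub>t Y) = InL ` lab X \<union> InR ` lab Y"
  "x \<in> lab X \<Longrightarrow> tau (X +\<^sub>t Y) (InL x) = tau X x"
  "y \<in> lab Y \<Longrightarrow> tau (X +\<^sub>t Y) (InR y) = tau Y y"
  by (auto simp: tfs_sum_def Let_def)

lemma box_sum_simps [simp]:
  "inp (box_sum X Y) = inp X +\<^sub>t inp Y" "outp (box_sum X Y) = outp X +\<^sub>t outp Y"
  by (simp_all add: box_sum_def)

lemma box_empty_simps [simp]: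
  "inp box_empty = tfs_empty" "outp box_empty = tfs_empty"
  by (simp_all add: box_empty_def)

lemma lab_tfs_empty [simp]: "lab tfs_empty = {}"
  by (simp add: tfs_empty_def)

lemma is_tfs_sum: "is_tfs K X \<Longrightarrow> is_tfs K Y \<Longrightarrow> is_tfs K (X +\<^sub>t Y)"
  unfolding is_tfs_def by (auto simp: PiE_iff extensional_def) (auto simp: tfs_sum_def Let_def)

lemma is_tfs_empty: "is_tfs K tfs_empty"
  by (simp add: is_tfs_def tfs_empty_def)

lemma is_box_sum: "is_box K X \<Longrightarrow> is_box K Y \<Longrightarrow> is_box K (box_sum X Y)"
  by (simp add: is_box_def is_tfs_sum)

lemma is_box_empty: "is_box K box_empty"
  by (simp add: is_box_def is_tfs_empty)

lemma wiring_simps [simp]: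
  "Obj (wiring K) = {X. is_box K X}" "Arr (wiring K) = {\<phi>. is_wd K \<phi>}"
  "src (wiring K) = wsrc" "trg (wiring K) = wtrg" "cmp (wiring K) = wd_comp"
  "ten (wiring K) = box_sum" "tenA (wiring K) = wd_sum" "unit_obj (wiring K) = box_empty"
  by (simp_all add: wiring_def)

lemma wiring_cells:
  "idn (wiring K) X = relabel X X id id"
  "assoc (wiring K) X Y Z = relabel (box_sum (box_sum X Y) Z) (box_sum X (box_sum Y Z))
     (lcase (lcase InL (InR \<circ> InL)) (InR \<circ> InR)) (lcase (InL \<circ> InL) (lcase (InL \<circ> InR) InR))"
  "lunit (wiring K) X = relabel (box_sum box_empty X) X (lcase id id) InR"
  "runit (wiring K) X = relabel (box_sum X box_empty) X (lcase id id) InL"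
  "braid (wiring K) X Y = relabel (box_sum X Y) (box_sum Y X) (lcase InR InL) (lcase InR InL)"
  by (simp_all add: wiring_def)

lemma hom_wiring: "hom (wiring K) X Y = {\<phi>. is_wd K \<phi> \<and> wsrc \<phi> = X \<and> wtrg \<phi> = Y}"
  by (simp add: hom_def)

lemma wd_eqI:
  assumes "wsrc \<phi> = wsrc \<psi>" "wtrg \<phi> = wtrg \<psi>"
    "\<And>i. win \<phi> i = win \<psi> i" "\<And>k. wout \<phi> k = wout \<psi> k"
  shows "\<phi> = (\<psi> :: 'c wd)"
  using assms by (intro wd.equality) auto

text \<open>Composites and sums of diagrams are case distinctions on values of \<open>win\<close>.
  With this rule, equations between diagrams are proved by following a single port.\<close>

lemma win_cases:
  assumes "is_wd K \<phi>" "i \<in> lab (inp (wsrc \<phi>))"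
  obtains (Out) x where "x \<in> lab (outp (wsrc \<phi>))" "win \<phi> i = InL x"
      "tau (outp (wsrc \<phi>)) x = tau (inp (wsrc \<phi>)) i"
  | (In) j where "j \<in> lab (inp (wtrg \<phi>))" "win \<phi> i = InR j"
      "tau (inp (wtrg \<phi>)) j = tau (inp (wsrc \<phi>)) i"
proof -
  have "win \<phi> i \<in> lab (outp (wsrc \<phi>) +\<^sub>t inp (wtrg \<phi>))"
    and t: "tau (outp (wsrc \<phi>) +\<^sub>t inp (wtrg \<phi>)) (win \<phi> i) = tau (inp (wsrc \<phi>)) i"
    using assms by (auto simp: is_wd_def typed_fun_def simp del: tfs_sum_simps)
  then consider x where "x \<in> lab (outp (wsrc \<phi>))" "win \<phi> i = InL x"
    | j where "j \<in> lab (inp (wtrg \<phi>))" "win \<phi> i = InR j" by auto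
  then show thesis by cases (use that t in simp_all)
qed

lemma is_wd_box: "is_wd K \<phi> \<Longrightarrow> is_box K (wsrc \<phi>)" "is_wd K \<phi> \<Longrightarrow> is_box K (wtrg \<phi>)"
  by (simp_all add: is_wd_def)

lemma win_undefined: "is_wd K \<phi> \<Longrightarrow> i \<notin> lab (inp (wsrc \<phi>)) \<Longrightarrow> win \<phi> i = undefined"
  by (auto simp: is_wd_def typed_fun_def PiE_iff extensional_def)

lemma wout_undefined: "is_wd K \<phi> \<Longrightarrow> k \<notin> lab (outp (wtrg \<phi>)) \<Longrightarrow> wout \<phi> k = undefined"
  by (auto simp: is_wd_def typed_fun_def PiE_iff extensional_def)

lemma wout_lab:
  assumes "is_wd K \<phi>" "k \<in> lab (outp (wtrg \<phi>))"
  shows "wout \<phi> k \<in> lab (outp (wsrc \<phi>))" "tau (outp (wsrc \<phi>)) (wout \<phi> k) = tau (outp (wtrg \<phi>)) k"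
  using assms by (auto simp: is_wd_def typed_fun_def)

lemma is_wdI:
  assumes "is_box K (wsrc \<phi>)" "is_box K (wtrg \<phi>)"
    and "\<And>i. i \<in> lab (inp (wsrc \<phi>)) \<Longrightarrow> 
      (\<exists>x \<in> lab (outp (wsrc \<phi>)). win \<phi> i = InL x \<and> tau (outp (wsrc \<phi>)) x = tau (inp (wsrc \<phi>)) i) \<or>
      (\<exists>j \<in> lab (inp (wtrg \<phi>)). win \<phi> i = InR j \<and> tau (inp (wtrg \<phi>)) j = tau (inp (wsrc \<phi>)) i)"
    and "\<And>i. i \<notin> lab (inp (wsrc \<phi>)) \<Longrightarrow> win \<phi> i = undefined"
    and "\<And>k. k \<in> lab (outp (wtrg \<phi>)) \<Longrightarrow>
      wout \<phi> k \<in> lab (outp (wsrc \<phi>)) \<and> tau (outp (wsrc \<phi>)) (wout \<phi> k) = tau (outp (wtrg \<phi>)) k"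
    and "\<And>k. k \<notin> lab (outp (wtrg \<phi>)) \<Longrightarrow> wout \<phi> k = undefined"
  shows "is_wd K \<phi>"
  unfolding is_wd_def typed_fun_def
proof (intro conjI CollectI PiE_I ballI)
  fix i assume "i \<in> lab (inp (wsrc \<phi>))"
  from assms(3)[OF this] show "win \<phi> i \<in> lab (outp (wsrc \<phi>) +\<^sub>t inp (wtrg \<phi>))"
    and "tau (outp (wsrc \<phi>) +\<^sub>t inp (wtrg \<phi>)) (win \<phi> i) = tau (inp (wsrc \<phi>)) i" by auto
qed (use assms in auto)

lemma wd_comp_simps [simp]: "wsrc (wd_comp \<psi> \<phi>) = wsrc \<phi>" "wtrg (wd_comp \<psi> \<phi>) = wtrg \<psi>"
  by (simp_all add: wd_comp_def)

lemma wd_sum_simps [simp]: "wsrc (wd_sum \<phi> \<psi>) = box_sum (wsrc \<phi>) (wsrc \<psi>)"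
    "wtrg (wd_sum \<phi> \<psi>) = box_sum (wtrg \<phi>) (wtrg \<psi>)"
  by (simp_all add: wd_sum_def)

lemma relabel_simps [simp]: "wsrc (relabel X Y g h) = X" "wtrg (relabel X Y g h) = Y"
  by (simp_all add: relabel_def)

lemma is_wd_comp:
  assumes \<phi>: "is_wd K \<phi>" and \<psi>: "is_wd K \<psi>" and eq: "wtrg \<phi> = wsrc \<psi>"
  shows "is_wd K (wd_comp \<psi> \<phi>)"
  by (rule is_wdI; use is_wd_box[OF \<phi>] is_wd_box[OF \<psi>] wout_lab[OF \<phi>] wout_lab[OF \<psi>] in \<open>simp add: wd_comp_def eq\<close>)
    (erule win_cases[OF \<phi>] win_cases[OF \<psi>]; use wout_lab[OF \<phi>] in \<open>simp add: eq\<close>)+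

lemma is_wd_sum:
  assumes \<phi>: "is_wd K \<phi>" and \<psi>: "is_wd K \<psi>"
  shows "is_wd K (wd_sum \<phi> \<psi>)"
  by (rule is_wdI; use is_wd_box[OF \<phi>] is_wd_box[OF \<psi>] wout_lab[OF \<phi>] wout_lab[OF \<psi>] in
      \<open>force simp: wd_sum_def is_box_sum elim: win_cases[OF \<phi>] win_cases[OF \<psi>]\<close>)

lemma is_wd_relabel:
  assumes "is_box K X" "is_box K Y"
    and "\<And>i. i \<in> lab (inp X) \<Longrightarrow> g i \<in> lab (inp Y) \<and> tau (inp Y) (g i) = tau (inp X) i"
    and "\<And>k. k \<in> lab (outp Y) \<Longrightarrow> h k \<in> lab (outp X) \<and> tau (outp X) (h k) = tau (outp Y) k"
  shows "is_wd K (relabel X Y g h)"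
  by (rule is_wdI) (use assms in \<open>auto simp: relabel_def\<close>)

section \<open>Diagrams without feedback\<close>

lemma relabel_cong:
  assumes "\<And>i. i \<in> lab (inp X) \<Longrightarrow> g i = g' i" "\<And>k. k \<in> lab (outp Y) \<Longrightarrow> h k = h' k"
  shows "relabel X Y g h = relabel X Y g' h'"
  using assms by (auto simp: relabel_def)

text \<open>Without feedback, diagrams compose as functions, forwards on inputs and backwards on
  outputs. This turns the coherence laws of wiring diagrams into equations between label
  functions.\<close>

lemma relabel_comp:
  assumes "\<And>i. i \<in> lab (inp X) \<Longrightarrow> g i \<in> lab (inp Y)" "\<And>k. k \<in> lab (outp Z) \<Longrightarrow> h' k \<in> lab (outp Y)"
  shows "wd_comp (relabel Y Z g' h') (relabel X Y g h) = relabel X Z (g' \<circ> g) (h \<circ> h')"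
  using assms by (auto simp: relabel_def wd_comp_def)

lemma relabel_sum:
  "wd_sum (relabel X Y g h) (relabel X' Y' g' h') = relabel (box_sum X X') (box_sum Y Y')
     (lcase (InL \<circ> g) (InR \<circ> g')) (lcase (InL \<circ> h) (InR \<circ> h'))"
  by (rule wd_eqI) (auto simp: relabel_def wd_sum_def)

lemma wd_comp_relabel_left:
  assumes "is_wd K \<phi>" "wtrg \<phi> = X"
  shows "wd_comp (relabel X Y g h) \<phi> = \<lparr>wsrc = wsrc \<phi>, wtrg = Y,
    win = (\<lambda>i \<in> lab (inp (wsrc \<phi>)). lcase InL (InR \<circ> g) (win \<phi> i)),
    wout = (\<lambda>k \<in> lab (outp Y). wout \<phi> (h k))\<rparr>"
proof (rule wd_eqI)
  fix i
  show "win (wd_comp (relabel X Y g h) \<phi>) i = win \<lparr>wsrc = wsrc \<phi>, wtrg = Y,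
    win = (\<lambda>i \<in> lab (inp (wsrc \<phi>)). lcase InL (InR \<circ> g) (win \<phi> i)),
    wout = (\<lambda>k \<in> lab (outp Y). wout \<phi> (h k))\<rparr> i"
  proof (cases "i \<in> lab (inp (wsrc \<phi>))")
    case True
    with assms(1) show ?thesis
      by (cases rule: win_cases) (use assms(2) in \<open>auto simp: wd_comp_def relabel_def\<close>)
  qed (simp add: wd_comp_def)
qed (auto simp: wd_comp_def relabel_def)

lemma wd_comp_relabel_right:
  assumes "\<And>i. i \<in> lab (inp X) \<Longrightarrow> g i \<in> lab (inp Y)" "is_wd K \<phi>" "wsrc \<phi> = Y"
  shows "wd_comp \<phi> (relabel X Y g h) = \<lparr>wsrc = X, wtrg = wtrg \<phi>,
    win = (\<lambda>i \<in> lab (inp X). lcase (InL \<circ> h) InR (win \<phi> (g i))),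
    wout = (\<lambda>k \<in> lab (outp (wtrg \<phi>)). h (wout \<phi> k))\<rparr>"
proof (rule wd_eqI)
  fix i
  show "win (wd_comp \<phi> (relabel X Y g h)) i = win \<lparr>wsrc = X, wtrg = wtrg \<phi>,
    win = (\<lambda>i \<in> lab (inp X). lcase (InL \<circ> h) InR (win \<phi> (g i))),
    wout = (\<lambda>k \<in> lab (outp (wtrg \<phi>)). h (wout \<phi> k))\<rparr> i"
  proof (cases "i \<in> lab (inp X)")
    case True
    then have "g i \<in> lab (inp (wsrc \<phi>))" using assms by simp
    with assms(2) show ?thesis
      by (cases rule: win_cases) (use assms True wout_lab(1)[OF assms(2)] in \<open>auto simp: wd_comp_def relabel_def\<close>)
  qed (simp add: wd_comp_def relabel_def)
qed (use assms wout_lab(1)[OF assms(2)] in \<open>auto simp: wd_comp_def relabel_def\<close>)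

text \<open>Both sides trace a port back to what feeds it, through at most three diagrams; the cases
  enumerate where the trace stops.\<close>

lemma wd_comp_assoc:
  assumes \<phi>: "is_wd K \<phi>" and \<psi>: "is_wd K \<psi>" and \<chi>: "is_wd K \<chi>"
    and eq: "wtrg \<phi> = wsrc \<psi>" "wtrg \<psi> = wsrc \<chi>"
  shows "wd_comp (wd_comp \<chi> \<psi>) \<phi> = wd_comp \<chi> (wd_comp \<psi> \<phi>)"
  by (rule wd_eqI) (auto simp: wd_comp_def eq wout_lab(1)[OF \<chi>] restrict_def,
    (erule win_cases[OF \<phi>] win_cases[OF \<psi>] win_cases[OF \<chi>]; simp add: eq)+)

lemma wd_sum_comp:
  assumes \<phi>: "is_wd K \<phi>" and \<psi>: "is_wd K \<psi>" and eq: "wtrg \<phi> = wsrc \<psi>"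
    and \<phi>': "is_wd K \<phi>'" and \<psi>': "is_wd K \<psi>'" and eq': "wtrg \<phi>' = wsrc \<psi>'"
  shows "wd_sum (wd_comp \<psi> \<phi>) (wd_comp \<psi>' \<phi>') = wd_comp (wd_sum \<psi> \<psi>') (wd_sum \<phi> \<phi>')"
  by (rule wd_eqI) (auto simp: wd_comp_def wd_sum_def eq eq' wout_lab(1)[OF \<psi>] wout_lab(1)[OF \<psi>'] restrict_def,
    (erule win_cases[OF \<phi>] win_cases[OF \<psi>] win_cases[OF \<phi>'] win_cases[OF \<psi>']; simp add: eq eq')+)

lemma wd_comp_id:
  assumes "is_wd K \<phi>"
  shows "wd_comp (relabel (wtrg \<phi>) (wtrg \<phi>) id id) \<phi> = \<phi>"
    and "wd_comp \<phi> (relabel (wsrc \<phi>) (wsrc \<phi>) id id) = \<phi>"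
proof -
  have *: "lcase InL InR (win \<phi> i) = win \<phi> i" if "i \<in> lab (inp (wsrc \<phi>))" for i
    using assms that by (cases rule: win_cases) auto
  show "wd_comp (relabel (wtrg \<phi>) (wtrg \<phi>) id id) \<phi> = \<phi>"
    by (subst wd_comp_relabel_left[OF assms refl], rule wd_eqI)
      (use * in \<open>auto simp: win_undefined[OF assms] wout_undefined[OF assms]\<close>)
  show "wd_comp \<phi> (relabel (wsrc \<phi>) (wsrc \<phi>) id id) = \<phi>"
    by (subst wd_comp_relabel_right[OF _ assms refl], simp, rule wd_eqI)
      (use * in \<open>auto simp: win_undefined[OF assms] wout_undefined[OF assms]\<close>)
qed

text \<open>Type preservation is asked of \<open>g\<close> and \<open>h\<close> alone: the inverse
  label functions inherit it.\<close>

lemma relabel_iso: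
  assumes "is_box K X" "is_box K Y"
    and g: "\<And>i. i \<in> lab (inp X) \<Longrightarrow> g i \<in> lab (inp Y) \<and> tau (inp Y) (g i) = tau (inp X) i \<and> g' (g i) = i"
    and h: "\<And>k. k \<in> lab (outp Y) \<Longrightarrow> h k \<in> lab (outp X) \<and> tau (outp X) (h k) = tau (outp Y) k \<and> h' (h k) = k"
    and g': "\<And>i. i \<in> lab (inp Y) \<Longrightarrow> g' i \<in> lab (inp X) \<and> g (g' i) = i"
    and h': "\<And>k. k \<in> lab (outp X) \<Longrightarrow> h' k \<in> lab (outp Y) \<and> h (h' k) = k"
  shows "relabel X Y g h \<in> isos (wiring K) X Y"
proof -
  have "relabel X Y g h \<in> hom (wiring K) X Y"
    using is_wd_relabel[of K X Y g h] assms by (simp add: hom_wiring)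
  moreover have "tau (inp X) (g' i) = tau (inp Y) i" if "i \<in> lab (inp Y)" for i
    using g[of "g' i"] g'[of i] that by simp
  moreover have "tau (outp Y) (h' k) = tau (outp X) k" if "k \<in> lab (outp X)" for k
    using h[of "h' k"] h'[of k] that by simp
  ultimately have "relabel Y X g' h' \<in> hom (wiring K) Y X"
    using is_wd_relabel[of K Y X g' h'] assms by (simp add: hom_wiring)
  moreover have "wd_comp (relabel Y X g' h') (relabel X Y g h) = relabel X X id id"
    "wd_comp (relabel X Y g h) (relabel Y X g' h') = relabel Y Y id id"
    using g h g' h' by (auto simp: relabel_comp intro!: relabel_cong)
  ultimately show ?thesis
    using \<open>relabel X Y g h \<in> hom (wiring K) X Y\<close> by (auto simp: isos_def wiring_cells)
qed

text \<open>A single criterion for naturality of the associator, the unitors and the braiding, all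
  of which are relabellings. Both composites have the same explicit form, in which only label
  functions remain to be compared.\<close>

lemma relabel_natural:
  assumes F: "is_wd K F" and G: "is_wd K G" and [simp]: "wtrg F = Y" "wsrc G = X'" "wsrc F = X" "wtrg G = Y'"
    and g: "\<And>i. i \<in> lab (inp X) \<Longrightarrow> g i \<in> lab (inp X')"
    and "\<And>i. i \<in> lab (inp X) \<Longrightarrow> lcase InL (InR \<circ> g') (win F i) = lcase (InL \<circ> h) InR (win G (g i))"
    and "\<And>k. k \<in> lab (outp Y') \<Longrightarrow> wout F (h' k) = h (wout G k)"
  shows "wd_comp (relabel Y Y' g' h') F = wd_comp G (relabel X X' g h)"
  using assms by (simp add: wd_comp_relabel_left[OF F] wd_comp_relabel_right[OF g G] cong: restrict_cong)

section \<open>Naturality and invertibility of the structural diagrams\<close>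

lemma wd_sum_win:
  "i \<in> lab (inp (wsrc \<phi>)) \<Longrightarrow> win (wd_sum \<phi> \<psi>) (InL i) = lcase (InL \<circ> InL) (InR \<circ> InL) (win \<phi> i)"
  "j \<in> lab (inp (wsrc \<psi>)) \<Longrightarrow> win (wd_sum \<phi> \<psi>) (InR j) = lcase (InL \<circ> InR) (InR \<circ> InR) (win \<psi> j)"
  "k \<in> lab (outp (wtrg \<phi>)) \<Longrightarrow> wout (wd_sum \<phi> \<psi>) (InL k) = InL (wout \<phi> k)"
  "k' \<in> lab (outp (wtrg \<psi>)) \<Longrightarrow> wout (wd_sum \<phi> \<psi>) (InR k') = InR (wout \<psi> k')"
  by (simp_all add: wd_sum_def)

lemma wd_sum_assoc:
  assumes f: "is_wd K f" and g: "is_wd K g" and h: "is_wd K h"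
  shows "wd_comp (assoc (wiring K) (wtrg f) (wtrg g) (wtrg h)) (wd_sum (wd_sum f g) h) =
    wd_comp (wd_sum f (wd_sum g h)) (assoc (wiring K) (wsrc f) (wsrc g) (wsrc h))"
  unfolding wiring_cells
  by (rule relabel_natural[OF is_wd_sum[OF is_wd_sum[OF f g] h] is_wd_sum[OF f is_wd_sum[OF g h]]])
    (auto simp: wd_sum_win wout_lab(1)[OF f] wout_lab(1)[OF g] wout_lab(1)[OF h],
      (erule win_cases[OF f] win_cases[OF g] win_cases[OF h]; simp)+)

lemma wd_sum_unit:
  assumes f: "is_wd K f"
  shows "wd_comp (lunit (wiring K) (wtrg f)) (wd_sum (idn (wiring K) box_empty) f) = wd_comp f (lunit (wiring K) (wsrc f))"
    "wd_comp (runit (wiring K) (wtrg f)) (wd_sum f (idn (wiring K) box_empty)) = wd_comp f (runit (wiring K) (wsrc f))"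
proof -
  have e: "is_wd K (relabel box_empty box_empty id id)" by (rule is_wd_relabel) (simp_all add: is_box_empty)
  show "wd_comp (lunit (wiring K) (wtrg f)) (wd_sum (idn (wiring K) box_empty) f) = wd_comp f (lunit (wiring K) (wsrc f))"
    unfolding wiring_cells
    by (rule relabel_natural[OF is_wd_sum[OF e f] f]) (auto simp: wd_sum_win wout_lab(1)[OF f], (erule win_cases[OF f]; simp)+)
  show "wd_comp (runit (wiring K) (wtrg f)) (wd_sum f (idn (wiring K) box_empty)) = wd_comp f (runit (wiring K) (wsrc f))"
    unfolding wiring_cells
    by (rule relabel_natural[OF is_wd_sum[OF f e] f]) (auto simp: wd_sum_win wout_lab(1)[OF f], (erule win_cases[OF f]; simp)+)
qed

lemma wd_sum_braid:
  assumes f: "is_wd K f" and g: "is_wd K g"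
  shows "wd_comp (braid (wiring K) (wtrg f) (wtrg g)) (wd_sum f g) =
    wd_comp (wd_sum g f) (braid (wiring K) (wsrc f) (wsrc g))"
  unfolding wiring_cells
  by (rule relabel_natural[OF is_wd_sum[OF f g] is_wd_sum[OF g f]])
    (auto simp: wd_sum_win wout_lab(1)[OF f] wout_lab(1)[OF g],
      (erule win_cases[OF f] win_cases[OF g]; simp)+)

text \<open>In each of these diagrams the label function on outputs inverts the one on inputs, so
  the two functions exchange their roles in the inverse diagram. This is the origin of
  \<open>g'\<close> and \<open>h'\<close>.\<close>

lemma wiring_isos:
  assumes X: "is_box K X"
  shows "is_box K Y \<Longrightarrow> is_box K Z \<Longrightarrow>
      assoc (wiring K) X Y Z \<in> isos (wiring K) (box_sum (box_sum X Y) Z) (box_sum X (box_sum Y Z))"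
    and "lunit (wiring K) X \<in> isos (wiring K) (box_sum box_empty X) X"
    and "runit (wiring K) X \<in> isos (wiring K) (box_sum X box_empty) X"
  unfolding wiring_cells
  subgoal by (rule relabel_iso[where g' = "lcase (InL \<circ> InL) (lcase (InL \<circ> InR) InR)"
          and h' = "lcase (lcase InL (InR \<circ> InL)) (InR \<circ> InR)"]) (use X in \<open>auto simp: is_box_sum\<close>)
  subgoal by (rule relabel_iso[where g' = InR and h' = "lcase id id"]) (use X in \<open>auto simp: is_box_sum is_box_empty\<close>)
  subgoal by (rule relabel_iso[where g' = InL and h' = "lcase id id"]) (use X in \<open>auto simp: is_box_sum is_box_empty\<close>)
  done

lemma wiring_symmetric_monoidal: "symmetric_monoidal (wiring K)"
  apply unfold_locales
  apply (unfold wiring_simps hom_wiring mem_Collect_eq)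
  subgoal by (rule is_wd_box)
  subgoal by (rule is_wd_box)
  subgoal by (simp add: wiring_cells is_wd_relabel)
  subgoal by (auto simp: is_wd_comp)
  subgoal by (auto simp: wiring_cells wd_comp_id)
  subgoal by (auto simp: wiring_cells wd_comp_id)
  subgoal by (auto intro: wd_comp_assoc)
  subgoal by (rule is_box_sum)
  subgoal by (auto simp: is_wd_sum)
  subgoal by (auto simp: wiring_cells relabel_sum intro!: relabel_cong)
  subgoal by (auto intro: wd_sum_comp)
  subgoal by (rule is_box_empty)
  subgoal by (rule wiring_isos)
  subgoal by (auto intro: wd_sum_assoc)
  subgoal by (rule wiring_isos)
  subgoal by (auto intro: wd_sum_unit)
  subgoal by (rule wiring_isos)
  subgoal by (auto intro: wd_sum_unit)
  subgoal by (auto simp: wiring_cells is_box_sum intro!: is_wd_relabel)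
  subgoal by (auto intro: wd_sum_braid)
  \<comment> \<open>From here on (symmetry, pentagon, triangle, hexagon) both sides consist of
    relabellings and collapse to one relabelling each, compared label by label.\<close>
  subgoal by (simp add: wiring_cells, subst relabel_comp) (auto intro!: relabel_cong)
  subgoal by (simp add: wiring_cells relabel_sum, (subst relabel_comp, fastforce, fastforce)+) (auto intro!: relabel_cong)
  subgoal by (simp add: wiring_cells relabel_sum, subst relabel_comp) (auto intro!: relabel_cong)
  subgoal by (simp add: wiring_cells relabel_sum, (subst relabel_comp, fastforce, fastforce)+) (auto intro!: relabel_cong)
  done

section \<open>Interval sheaves\<close>

lemma Int_cat_simps [simp]:
  "Obj Int_cat = {l. 0 \<le> l}"
  "(l', p, l) \<in> Arr Int_cat \<longleftrightarrow> 0 \<le> l' \<and> 0 \<le> p \<and> l' + p \<le> l"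
  "src Int_cat (l', p, l) = l'" "trg Int_cat (l', p, l) = l"
  "idn Int_cat l = (l, 0, l)"
  "(l', p, l) \<cdot>\<^bsub>Int_cat\<^esub> (l'', p', m) = (l'', p + p', l)"
  by (auto simp: Int_cat_def)

lemma mk_psh_simps [simp]:
  "sec (mk_psh s r) l = (if 0 \<le> l then s l else {})"
  "t \<in> Arr Int_cat \<Longrightarrow> x \<in> s (trg Int_cat t) \<Longrightarrow> res (mk_psh s r) t x = r t x"
  by (simp_all add: mk_psh_def)

lemma mk_map_simps [simp]:
  "pdom (mk_map A B f) = A" "pcod (mk_map A B f) = B"
  "x \<in> sec A l \<Longrightarrow> app (mk_map A B f) l x = f l x"
  by (simp_all add: mk_map_def)

lemma presheafD:
  assumes "presheaf X"
  shows "x \<in> sec X l \<Longrightarrow> 0 \<le> l"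
    and "0 \<le> l' \<Longrightarrow> 0 \<le> p \<Longrightarrow> l' + p \<le> l \<Longrightarrow> x \<in> sec X l \<Longrightarrow> res X (l', p, l) x \<in> sec X l'"
    and "x \<in> sec X l \<Longrightarrow> res X (l, 0, l) x = x"
    and "0 \<le> l'' \<Longrightarrow> 0 \<le> p' \<Longrightarrow> l'' + p' \<le> l' \<Longrightarrow> 0 \<le> p \<Longrightarrow> l' + p \<le> l \<Longrightarrow> x \<in> sec X l \<Longrightarrow>
      res X (l'', p', l') (res X (l', p, l) x) = res X (l'', p + p', l) x"
proof -
  show l: "0 \<le> l" if "x \<in> sec X l" for x l
    using assms that unfolding presheaf_def by (cases "0 \<le> l") auto
  show "res X (l', p, l) x \<in> sec X l'"
    if "0 \<le> l'" "0 \<le> p" "l' + p \<le> l" "x \<in> sec X l" for l' p l x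
  proof -
    have "(l', p, l) \<in> Arr Int_cat" using that by simp
    then have "res X (l', p, l) \<in> sec X l \<rightarrow>\<^sub>E sec X l'"
      using assms unfolding presheaf_def by fastforce
    then show ?thesis using that by blast
  qed
  show "res X (l, 0, l) x = x" if "x \<in> sec X l" for x l
    using assms that l unfolding presheaf_def by simp
  show "res X (l'', p', l') (res X (l', p, l) x) = res X (l'', p + p', l) x"
    if "0 \<le> l''" "0 \<le> p'" "l'' + p' \<le> l'" "0 \<le> p" "l' + p \<le> l" "x \<in> sec X l" for l'' p' l' p l x
  proof -
    have "(l'', p', l') \<in> hom Int_cat l'' l'" "(l', p, l) \<in> hom Int_cat l' l"
      using that by (simp_all add: hom_def)
    then have "res X ((l', p, l) \<cdot>\<^bsub>Int_cat\<^esub> (l'', p', l')) x = res X (l'', p', l') (res X (l', p, l) x)"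
      using assms that(6) unfolding presheaf_def by blast
    then show ?thesis by simp
  qed
qed

lemma presheafI:
  assumes "\<And>l' p l x. 0 \<le> l' \<Longrightarrow> 0 \<le> p \<Longrightarrow> l' + p \<le> l \<Longrightarrow> x \<in> s l \<Longrightarrow> r (l', p, l) x \<in> s l'"
    and "\<And>l x. 0 \<le> l \<Longrightarrow> x \<in> s l \<Longrightarrow> r (l, 0, l) x = x"
    and "\<And>l'' p' l' p l x. 0 \<le> l'' \<Longrightarrow> 0 \<le> p' \<Longrightarrow> l'' + p' \<le> l' \<Longrightarrow> 0 \<le> p \<Longrightarrow> l' + p \<le> l \<Longrightarrow>
      x \<in> s l \<Longrightarrow> r (l'', p', l') (r (l', p, l) x) = r (l'', p + p', l) x"
  shows "presheaf (mk_psh s r)"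
  unfolding presheaf_def
proof (intro conjI allI ballI impI)
  fix f assume f: "f \<in> Arr Int_cat"
  obtain l' p l where [simp]: "f = (l', p, l)" by (cases f)
  show "res (mk_psh s r) f \<in> sec (mk_psh s r) (trg Int_cat f) \<rightarrow>\<^sub>E sec (mk_psh s r) (src Int_cat f)"
    using f assms(1)[of l' p l] by (auto simp: mk_psh_def)
next
  fix l l' l'' f g x assume *: "f \<in> hom Int_cat l'' l'" "g \<in> hom Int_cat l' l" "x \<in> sec (mk_psh s r) l"
  obtain p p' where [simp]: "f = (l'', p', l')" "g = (l', p, l)"
    using * by (cases f; cases g) (auto simp: hom_def)
  have "0 \<le> l''" "0 \<le> p'" "l'' + p' \<le> l'" "0 \<le> p" "l' + p \<le> l" "x \<in> s l"
    using * by (auto simp: hom_def split: if_splits)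
  then show "res (mk_psh s r) (g \<cdot>\<^bsub>Int_cat\<^esub> f) x = res (mk_psh s r) f (res (mk_psh s r) g x)"
    using assms(1)[of l' p l x] assms(3)[of l'' p' l' p l x] by (simp add: algebra_simps)
qed (use assms in \<open>auto simp: mk_psh_def\<close>)

lemma sheafD:
  assumes "sheaf X"
  shows "presheaf X"
    and "\<lbrakk>x1 \<in> sec X l1; x2 \<in> sec X l2; res X (0, l1, l1) x1 = res X (0, 0, l2) x2\<rbrakk> \<Longrightarrow>
      \<exists>x \<in> sec X (l1 + l2). res X (l1, 0, l1 + l2) x = x1 \<and> res X (l2, l1, l1 + l2) x = x2"
    and "\<lbrakk>0 \<le> l1; 0 \<le> l2; x \<in> sec X (l1 + l2); y \<in> sec X (l1 + l2);
       res X (l1, 0, l1 + l2) x = res X (l1, 0, l1 + l2) y;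
       res X (l2, l1, l1 + l2) x = res X (l2, l1, l1 + l2) y\<rbrakk> \<Longrightarrow> x = y"
proof -
  show p: "presheaf X" using assms by (simp add: sheaf_def)
  have glue: "\<exists>!x. x \<in> sec X (l1 + l2) \<and> res X (l1, 0, l1 + l2) x = x1 \<and> res X (l2, l1, l1 + l2) x = x2"
    if "0 \<le> l1" "0 \<le> l2" "x1 \<in> sec X l1" "x2 \<in> sec X l2" "res X (0, l1, l1) x1 = res X (0, 0, l2) x2"
    for l1 l2 x1 x2
    using assms that unfolding sheaf_def restr_def by simp
  show "\<exists>x \<in> sec X (l1 + l2). res X (l1, 0, l1 + l2) x = x1 \<and> res X (l2, l1, l1 + l2) x = x2"
    if "x1 \<in> sec X l1" "x2 \<in> sec X l2" "res X (0, l1, l1) x1 = res X (0, 0, l2) x2" for x1 x2 l1 l2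
    using ex1_implies_ex[OF glue[OF _ _ that]] presheafD(1)[OF p] that by blast
  assume *: "0 \<le> l1" "0 \<le> l2" "x \<in> sec X (l1 + l2)" "y \<in> sec X (l1 + l2)"
    and eq: "res X (l1, 0, l1 + l2) x = res X (l1, 0, l1 + l2) y"
       "res X (l2, l1, l1 + l2) x = res X (l2, l1, l1 + l2) y"
  have "res X (l1, 0, l1 + l2) x \<in> sec X l1" "res X (l2, l1, l1 + l2) x \<in> sec X l2"
    using * presheafD(2)[OF p] by simp_all
  \<comment> \<open>Both restrictions of one section agree at the cut point, so the gluing axiom
    applies to them; its uniqueness part then identifies \<open>x\<close> and
    \<open>y\<close>.\<close>
  moreover have "res X (0, l1, l1) (res X (l1, 0, l1 + l2) x) = res X (0, 0, l2) (res X (l2, l1, l1 + l2) x)"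
    using * by (simp add: presheafD(4)[OF p])
  ultimately have "\<exists>!z. z \<in> sec X (l1 + l2) \<and> res X (l1, 0, l1 + l2) z = res X (l1, 0, l1 + l2) x \<and>
      res X (l2, l1, l1 + l2) z = res X (l2, l1, l1 + l2) x"
    using glue[OF *(1,2)] by simp
  then show "x = y" by (rule ex1E) (use *(3,4) eq in metis)
qed

lemma sheafI:
  assumes p: "presheaf X"
    and "\<And>l1 l2 x1 x2. \<lbrakk>0 \<le> l1; 0 \<le> l2; x1 \<in> sec X l1; x2 \<in> sec X l2; res X (0, l1, l1) x1 = res X (0, 0, l2) x2\<rbrakk> \<Longrightarrow>
      \<exists>x \<in> sec X (l1 + l2). res X (l1, 0, l1 + l2) x = x1 \<and> res X (l2, l1, l1 + l2) x = x2"
    and "\<And>l1 l2 x y. \<lbrakk>0 \<le> l1; 0 \<le> l2; x \<in> sec X (l1 + l2); y \<in> sec X (l1 + l2);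
       res X (l1, 0, l1 + l2) x = res X (l1, 0, l1 + l2) y;
       res X (l2, l1, l1 + l2) x = res X (l2, l1, l1 + l2) y\<rbrakk> \<Longrightarrow> x = y"
  shows "sheaf X"
  unfolding sheaf_def restr_def
proof (intro conjI allI impI ballI)
  fix l1 l2 :: real and x1 x2 assume *: "0 \<le> l1" "0 \<le> l2" "x1 \<in> sec X l1" "x2 \<in> sec X l2"
    "res X (0, l1, l1) x1 = res X (0, 0, l2) x2"
  from assms(2)[OF this] obtain x where
    "x \<in> sec X (l1 + l2)" "res X (l1, 0, l1 + l2) x = x1" "res X (l2, l1, l1 + l2) x = x2" by blast
  then show "\<exists>!x. x \<in> sec X (l1 + l2) \<and> res X (l1, 0, l1 + l2) x = x1 \<and> res X (l2, l1, l1 + l2) x = x2"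
    by (intro ex1I[of _ x]) (auto intro!: assms(3)[OF *(1,2)])
qed fact

lemma sheaf_mapD:
  assumes "sheaf_map f"
  shows "sheaf (pdom f)" "sheaf (pcod f)" "presheaf (pdom f)" "presheaf (pcod f)"
    and "x \<in> sec (pdom f) l \<Longrightarrow> app f l x \<in> sec (pcod f) l"
    and "x \<notin> sec (pdom f) l \<Longrightarrow> app f l x = undefined"
    and "0 \<le> l' \<Longrightarrow> 0 \<le> p \<Longrightarrow> l' + p \<le> l \<Longrightarrow> x \<in> sec (pdom f) l \<Longrightarrow>
      app f l' (res (pdom f) (l', p, l) x) = res (pcod f) (l', p, l) (app f l x)"
proof -
  have f: "app f l \<in> sec (pdom f) l \<rightarrow>\<^sub>E sec (pcod f) l" for l
    using assms by (simp add: sheaf_map_def)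
  show "sheaf (pdom f)" "sheaf (pcod f)" using assms by (simp_all add: sheaf_map_def)
  then show "presheaf (pdom f)" "presheaf (pcod f)" by (simp_all add: sheafD(1))
  show "x \<in> sec (pdom f) l \<Longrightarrow> app f l x \<in> sec (pcod f) l" by (rule PiE_mem[OF f])
  show "x \<notin> sec (pdom f) l \<Longrightarrow> app f l x = undefined" by (rule PiE_arb[OF f])
  assume "0 \<le> l'" "0 \<le> p" "l' + p \<le> l" and x: "x \<in> sec (pdom f) l"
  then have "(l', p, l) \<in> Arr Int_cat" by simp
  then show "app f l' (res (pdom f) (l', p, l) x) = res (pcod f) (l', p, l) (app f l x)"
    using assms x unfolding sheaf_map_def by fastforce
qed

lemma sheaf_map_mk:
  assumes "sheaf A" "sheaf B"
    and "\<And>l x. x \<in> sec A l \<Longrightarrow> f l x \<in> sec B l"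
    and "\<And>l' p l x. 0 \<le> l' \<Longrightarrow> 0 \<le> p \<Longrightarrow> l' + p \<le> l \<Longrightarrow> x \<in> sec A l \<Longrightarrow>
      f l' (res A (l', p, l) x) = res B (l', p, l) (f l x)"
  shows "sheaf_map (mk_map A B f)"
  unfolding sheaf_map_def
proof (intro conjI allI ballI)
  fix t x assume t: "t \<in> Arr Int_cat" and x: "x \<in> sec (pdom (mk_map A B f)) (trg Int_cat t)"
  obtain l' p l where [simp]: "t = (l', p, l)" by (cases t)
  show "app (mk_map A B f) (src Int_cat t) (res (pdom (mk_map A B f)) t x) =
      res (pcod (mk_map A B f)) t (app (mk_map A B f) (trg Int_cat t) x)"
    using t x assms(4)[of l' p l x] presheafD(2)[OF sheafD(1)[OF assms(1)], of l' p l x] by simp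
qed (use assms in \<open>auto simp: mk_map_def\<close>)

text \<open>Values off the carriers are fixed to \<open>undefined\<close>, so agreement on sections
  is equality of records.\<close>

lemma pmap_eqI:
  assumes "sheaf_map f" "sheaf_map g" "pdom f = pdom g" "pcod f = pcod g"
    and "\<And>l x. x \<in> sec (pdom f) l \<Longrightarrow> app f l x = app g l x"
  shows "f = (g :: 'a pmap)"
proof -
  have "app f l x = app g l x" for l x
    using assms sheaf_mapD(6)[OF assms(1)] sheaf_mapD(6)[OF assms(2)]
    by (cases "x \<in> sec (pdom f) l") auto
  then show ?thesis using assms(3,4) by (intro pmap.equality ext) auto
qed

section \<open>The category of interval sheaves and its slices\<close>

lemma IntSh_simps [simp]:
  "Obj IntSh = {X. sheaf X}" "Arr IntSh = {f. sheaf_map f}" "src IntSh = pdom" "trg IntSh = pcod"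
  "idn IntSh A = mk_map A A (\<lambda>l x. x)"
  by (simp_all add: IntSh_def)

lemma hom_IntSh: "hom IntSh A B = {f. sheaf_map f \<and> pdom f = A \<and> pcod f = B}"
  by (simp add: hom_def)

lemma cmp_IntSh [simp]:
  "pdom (g \<cdot>\<^bsub>IntSh\<^esub> f) = pdom f" "pcod (g \<cdot>\<^bsub>IntSh\<^esub> f) = pcod g"
  "x \<in> sec (pdom f) l \<Longrightarrow> app (g \<cdot>\<^bsub>IntSh\<^esub> f) l x = app g l (app f l x)"
  by (simp_all add: IntSh_def)

lemma sheaf_map_comp:
  assumes f: "sheaf_map f" and g: "sheaf_map g" and "pcod f = pdom g"
  shows "sheaf_map (g \<cdot>\<^bsub>IntSh\<^esub> f)"
  unfolding IntSh_def cat.simps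
  by (rule sheaf_map_mk) (use assms sheaf_mapD[OF f] sheaf_mapD[OF g] in auto)

lemma sheaf_map_idn: "sheaf A \<Longrightarrow> sheaf_map (mk_map A A (\<lambda>l x. x))"
  by (rule sheaf_map_mk) auto

lemma IntSh_category: "category IntSh"
proof unfold_locales
  fix A B C D :: "'a psh" and f g h :: "'a pmap"
  assume "f \<in> hom IntSh A B" "g \<in> hom IntSh B C" "h \<in> hom IntSh C D"
  then have f: "sheaf_map f" "pdom f = A" "pcod f = B" and g: "sheaf_map g" "pdom g = B" "pcod g = C"
    and h: "sheaf_map h" "pdom h = C" "pcod h = D" by (auto simp: hom_IntSh)
  show "(h \<cdot>\<^bsub>IntSh\<^esub> g) \<cdot>\<^bsub>IntSh\<^esub> f = h \<cdot>\<^bsub>IntSh\<^esub> g \<cdot>\<^bsub>IntSh\<^esub> f"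
    by (rule pmap_eqI) (use f g h sheaf_mapD(5)[OF f(1)] in \<open>auto intro!: sheaf_map_comp\<close>)
next
  fix A B :: "'a psh" and f assume "f \<in> hom IntSh A B"
  then have f: "sheaf_map f" "pdom f = A" "pcod f = B" by (auto simp: hom_IntSh)
  show "idn IntSh B \<cdot>\<^bsub>IntSh\<^esub> f = f"
    by (rule pmap_eqI) (use f sheaf_mapD[OF f(1)] in \<open>auto intro!: sheaf_map_comp sheaf_map_idn\<close>)
  show "f \<cdot>\<^bsub>IntSh\<^esub> idn IntSh A = f"
    by (rule pmap_eqI) (use f sheaf_mapD[OF f(1)] in \<open>auto intro!: sheaf_map_comp sheaf_map_idn\<close>)
qed (auto simp: hom_IntSh sheaf_mapD intro: sheaf_map_comp sheaf_map_idn)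

lemma slice_simps [simp]:
  "Obj (slice C B) = {p \<in> Arr C. trg C p = B}"
  "src (slice C B) (p, q, h) = p" "trg (slice C B) (p, q, h) = q"
  "idn (slice C B) p = (p, p, idn C (src C p))"
  "(q, r, k) \<cdot>\<^bsub>slice C B\<^esub> (p, q', h) = (p, r, k \<cdot>\<^bsub>C\<^esub> h)"
  "(p, q, h) \<in> Arr (slice C B) \<longleftrightarrow> p \<in> Arr C \<and> trg C p = B \<and> q \<in> Arr C \<and> trg C q = B \<and>
     h \<in> hom C (src C p) (src C q) \<and> q \<cdot>\<^bsub>C\<^esub> h = p"
  by (simp_all add: slice_def)

lemma hom_slice: "hom (slice C B) p q = {(p', q', h). p' = p \<and> q' = q \<and> p \<in> Arr C \<and> trg C p = B \<and>
    q \<in> Arr C \<and> trg C q = B \<and> h \<in> hom C (src C p) (src C q) \<and> q \<cdot>\<^bsub>C\<^esub> h = p}"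
  by (auto simp: hom_def[of "slice C B"])

lemma slice_category:
  assumes "category C"
  shows "category (slice C B)"
proof -
  interpret category C by fact
  have arr: "f \<in> hom C (src C f) (trg C f)" if "f \<in> Arr C" for f using that by (simp add: hom_def)
  show ?thesis
  proof unfold_locales
    fix p q r f g assume "f \<in> hom (slice C B) p q" "g \<in> hom (slice C B) q r"
    then obtain h k where *: "f = (p, q, h)" "g = (q, r, k)" "p \<in> Arr C" "trg C p = B" "q \<in> Arr C" "trg C q = B"
      "r \<in> Arr C" "trg C r = B" "h \<in> hom C (src C p) (src C q)" "k \<in> hom C (src C q) (src C r)"
      "q \<cdot>\<^bsub>C\<^esub> h = p" "r \<cdot>\<^bsub>C\<^esub> k = q" by (auto simp: hom_slice)
    then show "g \<cdot>\<^bsub>slice C B\<^esub> f \<in> hom (slice C B) p r"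
      using cmp_assoc[OF *(9,10) arr[OF *(7)]] cmp_hom[OF *(9,10)] by (simp add: hom_slice)
  next
    fix f A D assume "f \<in> hom (slice C B) A D"
    then show "idn (slice C B) D \<cdot>\<^bsub>slice C B\<^esub> f = f" "f \<cdot>\<^bsub>slice C B\<^esub> idn (slice C B) A = f"
      by (auto simp: hom_slice idn_left idn_right)
  qed (auto simp: hom_slice arr src_obj cmp_assoc idn_hom intro: idn_right[OF arr])
qed

section \<open>Finite products and pullbacks of sheaves\<close>

lemma presheaf_prod: "presheaf A \<Longrightarrow> presheaf B \<Longrightarrow> presheaf (A \<times>\<^sub>s B)"
  unfolding psh_prod_def by (rule presheafI) (auto simp: presheafD)

lemma sec_prod [simp]:
  "Tup a b \<in> sec (A \<times>\<^sub>s B) l \<longleftrightarrow> 0 \<le> l \<and> a \<in> sec A l \<and> b \<in> sec B l"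
  by (simp add: psh_prod_def)

lemma sec_prodE:
  assumes "u \<in> sec (A \<times>\<^sub>s B) l"
  obtains a b where "u = Tup a b" "0 \<le> l" "a \<in> sec A l" "b \<in> sec B l"
  using assms by (auto simp: psh_prod_def split: if_splits)

lemma res_prod [simp]:
  "0 \<le> l' \<Longrightarrow> 0 \<le> p \<Longrightarrow> l' + p \<le> l \<Longrightarrow> a \<in> sec A l \<Longrightarrow> b \<in> sec B l \<Longrightarrow>
    res (A \<times>\<^sub>s B) (l', p, l) (Tup a b) = Tup (res A (l', p, l) a) (res B (l', p, l) b)"
  by (simp add: psh_prod_def)

lemma sheaf_prod:
  assumes A: "sheaf A" and B: "sheaf B"
  shows "sheaf (A \<times>\<^sub>s B)"
proof (rule sheafI)
  fix l1 l2 u v assume *: "0 \<le> l1" "0 \<le> l2" "u \<in> sec (A \<times>\<^sub>s B) l1" "v \<in> sec (A \<times>\<^sub>s B) l2"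
    and eq: "res (A \<times>\<^sub>s B) (0, l1, l1) u = res (A \<times>\<^sub>s B) (0, 0, l2) v"
  obtain a b where u: "u = Tup a b" "a \<in> sec A l1" "b \<in> sec B l1" using *(3) by (rule sec_prodE)
  obtain c d where v: "v = Tup c d" "c \<in> sec A l2" "d \<in> sec B l2" using *(4) by (rule sec_prodE)
  obtain x where x: "x \<in> sec A (l1 + l2)" "res A (l1, 0, l1 + l2) x = a" "res A (l2, l1, l1 + l2) x = c"
    using sheafD(2)[OF A u(2) v(2)] eq u v * by auto
  obtain y where y: "y \<in> sec B (l1 + l2)" "res B (l1, 0, l1 + l2) y = b" "res B (l2, l1, l1 + l2) y = d"
    using sheafD(2)[OF B u(3) v(3)] eq u v * by auto
  show "\<exists>w \<in> sec (A \<times>\<^sub>s B) (l1 + l2). res (A \<times>\<^sub>s B) (l1, 0, l1 + l2) w = u \<and> res (A \<times>\<^sub>s B) (l2, l1, l1 + l2) w = v"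
    by (rule bexI[of _ "Tup x y"]) (use * u v x y in auto)
next
  fix l1 l2 u v assume *: "0 \<le> l1" "0 \<le> l2" "u \<in> sec (A \<times>\<^sub>s B) (l1 + l2)" "v \<in> sec (A \<times>\<^sub>s B) (l1 + l2)"
    and eq: "res (A \<times>\<^sub>s B) (l1, 0, l1 + l2) u = res (A \<times>\<^sub>s B) (l1, 0, l1 + l2) v"
      "res (A \<times>\<^sub>s B) (l2, l1, l1 + l2) u = res (A \<times>\<^sub>s B) (l2, l1, l1 + l2) v"
  from *(3,4) show "u = v"
    by (elim sec_prodE) (use *(1,2) eq sheafD(3)[OF A *(1,2)] sheafD(3)[OF B *(1,2)] in auto)
qed (use A B in \<open>simp add: presheaf_prod sheafD\<close>)

definition tfs_psh :: "'a psh tfs \<Rightarrow> bool" where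
  "tfs_psh X \<longleftrightarrow> (\<forall>x \<in> lab X. sheaf (tau X x))"

text \<open>The last conjunct expresses that the family is extensional. Hence sections are
  determined by their components on \<open>lab X\<close>, which is what \<open>hat_eqI\<close> rests
  on.\<close>

lemma sec_hat: "u \<in> sec (hat X) l \<longleftrightarrow> 0 \<le> l \<and> (\<forall>x \<in> lab X. fam u x \<in> sec (tau X x) l) \<and>
    u = Fam (restrict (fam u) (lab X))"
proof -
  have "(u \<in> Fam ` (\<Pi>\<^sub>E x \<in> lab X. sec (tau X x) l)) \<longleftrightarrow>
      (\<forall>x \<in> lab X. fam u x \<in> sec (tau X x) l) \<and> u = Fam (restrict (fam u) (lab X))"
  proof
    assume "(\<forall>x \<in> lab X. fam u x \<in> sec (tau X x) l) \<and> u = Fam (restrict (fam u) (lab X))"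
    then show "u \<in> Fam ` (\<Pi>\<^sub>E x \<in> lab X. sec (tau X x) l)"
      by (intro image_eqI[of _ _ "restrict (fam u) (lab X)"]) auto
  qed (auto simp: PiE_iff extensional_restrict)
  then show ?thesis by (simp add: hat_def)
qed

lemma sec_hatD: "u \<in> sec (hat X) l \<Longrightarrow> x \<in> lab X \<Longrightarrow> fam u x \<in> sec (tau X x) l"
    "u \<in> sec (hat X) l \<Longrightarrow> 0 \<le> l"
  by (simp_all add: sec_hat)

lemma sec_hatI: "0 \<le> l \<Longrightarrow> (\<And>x. x \<in> lab X \<Longrightarrow> g x \<in> sec (tau X x) l) \<Longrightarrow> Fam (restrict g (lab X)) \<in> sec (hat X) l"
  by (simp add: sec_hat)

lemma hat_eqI: "u \<in> sec (hat X) l \<Longrightarrow> v \<in> sec (hat X) l' \<Longrightarrow> (\<And>x. x \<in> lab X \<Longrightarrow> fam u x = fam v x) \<Longrightarrow> u = v"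
  unfolding sec_hat by (metis restrict_ext)

lemma res_hat: "0 \<le> l' \<Longrightarrow> 0 \<le> p \<Longrightarrow> l' + p \<le> l \<Longrightarrow> u \<in> sec (hat X) l \<Longrightarrow>
    res (hat X) (l', p, l) u = Fam (\<lambda>x \<in> lab X. res (tau X x) (l', p, l) (fam u x))"
  by (simp add: hat_def)

lemma fam_res_hat [simp]: "0 \<le> l' \<Longrightarrow> 0 \<le> p \<Longrightarrow> l' + p \<le> l \<Longrightarrow> u \<in> sec (hat X) l \<Longrightarrow> x \<in> lab X \<Longrightarrow>
    fam (res (hat X) (l', p, l) u) x = res (tau X x) (l', p, l) (fam u x)"
  by (simp add: res_hat)

lemma presheaf_hat:
  assumes "tfs_psh X"
  shows "presheaf (hat X)"
proof -
  have p: "presheaf (tau X x)" if "x \<in> lab X" for x using assms that by (simp add: tfs_psh_def sheafD)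
  show ?thesis
    unfolding hat_def
    by (rule presheafI) (auto intro!: restrict_ext simp: presheafD[OF p] image_iff PiE_iff extensional_restrict cong: restrict_cong)
qed

lemma res_sec_hat:
  "tfs_psh X \<Longrightarrow> 0 \<le> l' \<Longrightarrow> 0 \<le> p \<Longrightarrow> l' + p \<le> l \<Longrightarrow> u \<in> sec (hat X) l \<Longrightarrow> res (hat X) (l', p, l) u \<in> sec (hat X) l'"
  by (rule presheafD(2)[OF presheaf_hat])

lemma sheaf_hat:
  assumes X: "tfs_psh X"
  shows "sheaf (hat X)"
proof (rule sheafI)
  have s: "sheaf (tau X x)" if "x \<in> lab X" for x using X that by (simp add: tfs_psh_def)
  fix l1 l2 :: real assume l: "0 \<le> l1" "0 \<le> l2"
  {
    fix u v assume u: "u \<in> sec (hat X) l1" and v: "v \<in> sec (hat X) l2"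
      and eq: "res (hat X) (0, l1, l1) u = res (hat X) (0, 0, l2) v"
    have "\<exists>w \<in> sec (tau X x) (l1 + l2). res (tau X x) (l1, 0, l1 + l2) w = fam u x \<and>
        res (tau X x) (l2, l1, l1 + l2) w = fam v x" if x: "x \<in> lab X" for x
      using arg_cong[OF eq, of "\<lambda>z. fam z x"] l
      by (intro sheafD(2)[OF s[OF x] sec_hatD(1)[OF u x] sec_hatD(1)[OF v x]]) (simp add: u v x)
    then obtain w where w: "\<And>x. x \<in> lab X \<Longrightarrow> w x \<in> sec (tau X x) (l1 + l2) \<and>
        res (tau X x) (l1, 0, l1 + l2) (w x) = fam u x \<and> res (tau X x) (l2, l1, l1 + l2) (w x) = fam v x"
      by metis
    define z where "z = Fam (restrict w (lab X))"
    have z: "z \<in> sec (hat X) (l1 + l2)" unfolding z_def by (rule sec_hatI) (use l w in auto)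
    show "\<exists>w \<in> sec (hat X) (l1 + l2). res (hat X) (l1, 0, l1 + l2) w = u \<and> res (hat X) (l2, l1, l1 + l2) w = v"
    proof (intro bexI[of _ z] conjI z)
      show "res (hat X) (l1, 0, l1 + l2) z = u"
        by (rule hat_eqI[OF res_sec_hat[OF X] u]) (use l z in \<open>auto simp: z_def w\<close>)
      show "res (hat X) (l2, l1, l1 + l2) z = v"
        by (rule hat_eqI[OF res_sec_hat[OF X] v]) (use l z in \<open>auto simp: z_def w\<close>)
    qed
  next
    fix u v assume u: "u \<in> sec (hat X) (l1 + l2)" and v: "v \<in> sec (hat X) (l1 + l2)"
      and eq: "res (hat X) (l1, 0, l1 + l2) u = res (hat X) (l1, 0, l1 + l2) v"
        "res (hat X) (l2, l1, l1 + l2) u = res (hat X) (l2, l1, l1 + l2) v"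
    show "u = v"
    proof (rule hat_eqI[OF u v])
      fix x assume x: "x \<in> lab X"
      show "fam u x = fam v x"
        using arg_cong[OF eq(1), of "\<lambda>z. fam z x"] arg_cong[OF eq(2), of "\<lambda>z. fam z x"] l
        by (intro sheafD(3)[OF s[OF x] l sec_hatD(1)[OF u x] sec_hatD(1)[OF v x]]) (simp_all add: u v x)
    qed
  }
qed (rule presheaf_hat[OF X])

lemma sec_pullback [simp]:
  "Tup d s \<in> sec (pullback k p) l \<longleftrightarrow> 0 \<le> l \<and> d \<in> sec (pdom k) l \<and> s \<in> sec (pdom p) l \<and> app k l d = app p l s"
  by (simp add: pullback_def)

lemma sec_pullbackE:
  assumes "u \<in> sec (pullback k p) l"
  obtains d s where "u = Tup d s" "0 \<le> l" "d \<in> sec (pdom k) l" "s \<in> sec (pdom p) l" "app k l d = app p l s"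
  using assms by (auto simp: pullback_def split: if_splits)

lemma res_pullback [simp]:
  "0 \<le> l' \<Longrightarrow> 0 \<le> q \<Longrightarrow> l' + q \<le> l \<Longrightarrow> Tup d s \<in> sec (pullback k p) l \<Longrightarrow>
    res (pullback k p) (l', q, l) (Tup d s) = Tup (res (pdom k) (l', q, l) d) (res (pdom p) (l', q, l) s)"
  by (auto simp: pullback_def split: if_splits)

lemma sheaf_pullback:
  assumes k: "sheaf_map k" and p: "sheaf_map p" and cod: "pcod k = pcod p"
  shows "sheaf (pullback k p)"
proof -
  note kD = sheaf_mapD[OF k] and pD = sheaf_mapD[OF p]
  note kg = sheafD[OF kD(1)] and pg = sheafD[OF pD(1)] and cg = sheafD[OF kD(2)]
  have pre: "presheaf (pullback k p)"
    unfolding pullback_def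
    by (rule presheafI) (auto simp: presheafD[OF kg(1)] presheafD[OF pg(1)] kD(7) pD(7) cod)
  show ?thesis
  proof (rule sheafI[OF pre])
    fix l1 l2 u v assume l: "0 \<le> l1" "0 \<le> l2" and u: "u \<in> sec (pullback k p) l1" and v: "v \<in> sec (pullback k p) l2"
      and eq: "res (pullback k p) (0, l1, l1) u = res (pullback k p) (0, 0, l2) v"
    obtain a b where u': "u = Tup a b" "a \<in> sec (pdom k) l1" "b \<in> sec (pdom p) l1" "app k l1 a = app p l1 b"
      using u by (rule sec_pullbackE)
    obtain c d where v': "v = Tup c d" "c \<in> sec (pdom k) l2" "d \<in> sec (pdom p) l2" "app k l2 c = app p l2 d"
      using v by (rule sec_pullbackE)
    obtain x where x: "x \<in> sec (pdom k) (l1 + l2)" "res (pdom k) (l1, 0, l1 + l2) x = a"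
        "res (pdom k) (l2, l1, l1 + l2) x = c"
      using kg(2)[OF u'(2) v'(2)] eq u u' v v' l by auto
    obtain y where y: "y \<in> sec (pdom p) (l1 + l2)" "res (pdom p) (l1, 0, l1 + l2) y = b"
        "res (pdom p) (l2, l1, l1 + l2) y = d"
      using pg(2)[OF u'(3) v'(3)] eq u u' v v' l by auto
    \<comment> \<open>The glued components form a section of the pullback because a section of the
      common codomain is determined by its restrictions to the two subintervals.\<close>
    have "app k (l1 + l2) x = app p (l1 + l2) y"
    proof (rule cg(3)[OF l])
      show "res (pcod k) (l1, 0, l1 + l2) (app k (l1 + l2) x) = res (pcod k) (l1, 0, l1 + l2) (app p (l1 + l2) y)"
        using kD(7)[of l1 0 "l1 + l2" x] pD(7)[of l1 0 "l1 + l2" y] l x y u'(4) cod by simp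
      show "res (pcod k) (l2, l1, l1 + l2) (app k (l1 + l2) x) = res (pcod k) (l2, l1, l1 + l2) (app p (l1 + l2) y)"
        using kD(7)[of l2 l1 "l1 + l2" x] pD(7)[of l2 l1 "l1 + l2" y] l x y v'(4) cod by simp
    qed (use x y kD(5) pD(5) cod in auto)
    then show "\<exists>w \<in> sec (pullback k p) (l1 + l2). res (pullback k p) (l1, 0, l1 + l2) w = u \<and>
        res (pullback k p) (l2, l1, l1 + l2) w = v"
      by (intro bexI[of _ "Tup x y"]) (use l u' v' x y in auto)
  next
    fix l1 l2 u v assume l: "0 \<le> l1" "0 \<le> l2" and u: "u \<in> sec (pullback k p) (l1 + l2)"
      and v: "v \<in> sec (pullback k p) (l1 + l2)"
      and eq: "res (pullback k p) (l1, 0, l1 + l2) u = res (pullback k p) (l1, 0, l1 + l2) v"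
        "res (pullback k p) (l2, l1, l1 + l2) u = res (pullback k p) (l2, l1, l1 + l2) v"
    from u v show "u = v"
      by (elim sec_pullbackE) (use l eq u v kg(3)[OF l] pg(3)[OF l] in auto)
  qed
qed

section \<open>The extension functor\<close>

lemma sec_Ext: "0 \<le> e \<Longrightarrow> sec (Ext e A) l = (if 0 \<le> l then sec A (l + e) else {})"
  by (simp add: Ext_def)

lemma res_Ext: "0 \<le> l' \<Longrightarrow> 0 \<le> p \<Longrightarrow> l' + p \<le> l \<Longrightarrow> x \<in> sec A (l + e) \<Longrightarrow>
    res (Ext e A) (l', p, l) x = res A (l' + e, p, l + e) x"
  by (simp add: Ext_def)

text \<open>As sections of \<open>A\<close> the two pieces overlap on an interval of length
  \<open>e\<close>, while \<open>A\<close> glues along a point. So \<open>x\<close> is glued with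
  what remains of \<open>y\<close> beyond its first \<open>e\<close>, and agreement with all of
  \<open>y\<close> is verified afterwards.\<close>

lemma sheaf_Ext:
  assumes A: "sheaf A" and e: "0 \<le> e"
  shows "sheaf (Ext e A)"
proof -
  note p = presheafD[OF sheafD(1)[OF A]]
  have pre: "presheaf (Ext e A)"
    unfolding Ext_def by (rule presheafI) (use e in \<open>auto simp: p\<close>)
  show ?thesis
  proof (rule sheafI[OF pre])
    fix l1 l2 x y assume l: "0 \<le> l1" "0 \<le> l2" and "x \<in> sec (Ext e A) l1" "y \<in> sec (Ext e A) l2"
      and "res (Ext e A) (0, l1, l1) x = res (Ext e A) (0, 0, l2) y"
    then have x: "x \<in> sec A (l1 + e)" and y: "y \<in> sec A (l2 + e)"
      and eq: "res A (e, l1, l1 + e) x = res A (e, 0, l2 + e) y"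
      using e by (simp_all add: sec_Ext res_Ext)
    \<comment> \<open>The part of \<open>y\<close> beyond the overlap. It begins where
      \<open>x\<close> ends, because \<open>x\<close> and \<open>y\<close> agree on the overlap and
      in particular at its right end.\<close>
    let ?y = "res A (l2, e, l2 + e) y"
    have "res A (0, l1 + e, l1 + e) x = res A (0, e, e) (res A (e, l1, l1 + e) x)"
      using l e x by (simp add: p)
    also have "\<dots> = res A (0, 0, l2) ?y" unfolding eq using l e y by (simp add: p)
    finally obtain z where z: "z \<in> sec A (l1 + e + l2)" "res A (l1 + e, 0, l1 + e + l2) z = x"
        "res A (l2, l1 + e, l1 + e + l2) z = ?y"
      using sheafD(2)[OF A x, of ?y l2] l e y p(2) by fastforce
    have [simp]: "l1 + e + l2 = l1 + l2 + e" by simp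
    have c: "l2 + e = e + l2" by simp
    note z' = z[simplified]
    \<comment> \<open>Tested after cutting at \<open>e\<close>: the initial piece is the overlap,
      where \<open>z\<close> is given by \<open>x\<close>, and the rest is
      \<open>?y\<close>.\<close>
    have "res A (e + l2, l1, l1 + l2 + e) z = y"
    proof (rule sheafD(3)[OF A, of e l2])
      have "res A (e, 0, e + l2) (res A (e + l2, l1, l1 + l2 + e) z) = res A (e, l1, l1 + e) (res A (l1 + e, 0, l1 + l2 + e) z)"
        using l e z'(1) by (simp add: p)
      then show "res A (e, 0, e + l2) (res A (e + l2, l1, l1 + l2 + e) z) = res A (e, 0, e + l2) y"
        using z'(2) eq c by simp
      have "res A (l2, e, e + l2) (res A (e + l2, l1, l1 + l2 + e) z) = res A (l2, l1 + e, l1 + l2 + e) z"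
        using l e z'(1) by (simp add: p)
      then show "res A (l2, e, e + l2) (res A (e + l2, l1, l1 + l2 + e) z) = res A (l2, e, e + l2) y"
        using z'(3) c by simp
      show "res A (e + l2, l1, l1 + l2 + e) z \<in> sec A (e + l2)" "y \<in> sec A (e + l2)"
        using l e z'(1) y c by (simp_all add: p(2))
    qed (use l e in simp_all)
    then have "res A (l2 + e, l1, l1 + l2 + e) z = y" by (simp add: c)
    then show "\<exists>w \<in> sec (Ext e A) (l1 + l2). res (Ext e A) (l1, 0, l1 + l2) w = x \<and> res (Ext e A) (l2, l1, l1 + l2) w = y"
      using l e z' by (intro bexI[of _ z]) (simp_all add: sec_Ext res_Ext)
  next
    fix l1 l2 x y assume l: "0 \<le> l1" "0 \<le> l2" and "x \<in> sec (Ext e A) (l1 + l2)" "y \<in> sec (Ext e A) (l1 + l2)"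
      and "res (Ext e A) (l1, 0, l1 + l2) x = res (Ext e A) (l1, 0, l1 + l2) y"
        "res (Ext e A) (l2, l1, l1 + l2) x = res (Ext e A) (l2, l1, l1 + l2) y"
    then have x: "x \<in> sec A (l1 + l2 + e)" and y: "y \<in> sec A (l1 + l2 + e)"
      and eq: "res A (l1 + e, 0, l1 + l2 + e) x = res A (l1 + e, 0, l1 + l2 + e) y"
        "res A (l2 + e, l1, l1 + l2 + e) x = res A (l2 + e, l1, l1 + l2 + e) y"
      using e by (simp_all add: sec_Ext res_Ext)
    \<comment> \<open>The two restrictions overlap. The second is trimmed to the last
      \<open>l2\<close>, so that together they fit the uniqueness condition with cut point
      \<open>l1 + e\<close>.\<close>
    have "res A (l2, e, l2 + e) (res A (l2 + e, l1, l1 + l2 + e) x) =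
        res A (l2, e, l2 + e) (res A (l2 + e, l1, l1 + l2 + e) y)" using eq(2) by simp
    then have eq2: "res A (l2, l1 + e, l1 + l2 + e) x = res A (l2, l1 + e, l1 + l2 + e) y"
      using l e x y by (simp add: p)
    have [simp]: "l1 + e + l2 = l1 + l2 + e" by simp
    show "x = y"
      by (rule sheafD(3)[OF A, of "l1 + e" l2]) (use l e x y eq(1) eq2 in simp_all)
  qed
qed

section \<open>Machines, elementwise\<close>

text \<open>Keeps the parameter of \<open>IntW\<close> in the one form in which the abbreviations
  below state it.\<close>

declare IntSh_simps(1) [simp del]

section \<open>Wiring diagrams acting on sections\<close>

abbreviation psh_box :: "'a psh box \<Rightarrow> bool" where "psh_box \<equiv> is_box (Obj IntSh)"
abbreviation psh_wd :: "'a psh wd \<Rightarrow> bool" where "psh_wd \<equiv> is_wd (Obj IntSh)"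

lemma psh_box_tfs: "psh_box X \<Longrightarrow> tfs_psh (inp X)" "psh_box X \<Longrightarrow> tfs_psh (outp X)"
  by (auto simp: is_box_def is_tfs_def tfs_psh_def IntSh_simps(1))

lemma sheaf_hat_box [simp]: "psh_box X \<Longrightarrow> sheaf (hat (inp X))" "psh_box X \<Longrightarrow> sheaf (hat (outp X))"
  by (simp_all add: psh_box_tfs sheaf_hat)

lemma presheaf_hat_box [simp]: "psh_box X \<Longrightarrow> presheaf (hat (inp X))" "psh_box X \<Longrightarrow> presheaf (hat (outp X))"
  by (simp_all add: sheafD)

text \<open>The input that the inner machine receives when the outer input is \<open>y\<close> and
  its own output is \<open>x\<close>. Feedback is the dependence on \<open>x\<close>.\<close>

definition din :: "'a psh wd \<Rightarrow> real \<Rightarrow> 'a univ \<Rightarrow> 'a univ \<Rightarrow> 'a univ" where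
  "din \<phi> l y x = app (wd_in \<phi>) l (Tup y x)"

abbreviation dout :: "'a psh wd \<Rightarrow> real \<Rightarrow> 'a univ \<Rightarrow> 'a univ" where
  "dout \<phi> l x \<equiv> app (wd_out \<phi>) l x"

lemma din_eq:
  assumes "y \<in> sec (hat (inp (wtrg \<phi>))) l" "x \<in> sec (hat (outp (wsrc \<phi>))) l"
  shows "din \<phi> l y x = Fam (\<lambda>i \<in> lab (inp (wsrc \<phi>)). lcase (fam x) (fam y) (win \<phi> i))"
  using assms by (simp add: din_def wd_in_def sec_hatD(2))

lemma dout_eq:
  assumes "x \<in> sec (hat (outp (wsrc \<phi>))) l"
  shows "dout \<phi> l x = Fam (\<lambda>k \<in> lab (outp (wtrg \<phi>)). fam x (wout \<phi> k))"
  using assms by (simp add: wd_out_def)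

lemma fam_din:
  assumes "y \<in> sec (hat (inp (wtrg \<phi>))) l" "x \<in> sec (hat (outp (wsrc \<phi>))) l" "i \<in> lab (inp (wsrc \<phi>))"
  shows "fam (din \<phi> l y x) i = lcase (fam x) (fam y) (win \<phi> i)"
  using assms by (simp add: din_eq)

lemma fam_dout:
  assumes "x \<in> sec (hat (outp (wsrc \<phi>))) l" "k \<in> lab (outp (wtrg \<phi>))"
  shows "fam (dout \<phi> l x) k = fam x (wout \<phi> k)"
  using assms by (simp add: dout_eq)

lemma sec_din:
  assumes \<phi>: "psh_wd \<phi>" and y: "y \<in> sec (hat (inp (wtrg \<phi>))) l" and x: "x \<in> sec (hat (outp (wsrc \<phi>))) l"
  shows "din \<phi> l y x \<in> sec (hat (inp (wsrc \<phi>))) l"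
  unfolding din_eq[OF y x]
proof (rule sec_hatI)
  fix i assume "i \<in> lab (inp (wsrc \<phi>))"
  with \<phi> show "lcase (fam x) (fam y) (win \<phi> i) \<in> sec (tau (inp (wsrc \<phi>)) i) l"
    by (cases rule: win_cases) (use sec_hatD(1)[OF y] sec_hatD(1)[OF x] in force)+
qed (rule sec_hatD(2)[OF y])

lemma sec_dout:
  assumes \<phi>: "psh_wd \<phi>" and x: "x \<in> sec (hat (outp (wsrc \<phi>))) l"
  shows "dout \<phi> l x \<in> sec (hat (outp (wtrg \<phi>))) l"
  unfolding dout_eq[OF x]
  by (rule sec_hatI) (use wout_lab[OF \<phi>] sec_hatD[OF x] in fastforce)+

lemma sheaf_map_wd_in:
  assumes \<phi>: "psh_wd \<phi>"
  shows "sheaf_map (wd_in \<phi>)"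
  unfolding wd_in_def
proof (rule sheaf_map_mk)
  note b = is_wd_box[OF \<phi>]
  note r = res_sec_hat[OF psh_box_tfs(1)[OF b(2)]] res_sec_hat[OF psh_box_tfs(2)[OF b(1)]]
    res_sec_hat[OF psh_box_tfs(1)[OF b(1)]]
  fix l u assume "u \<in> sec (hat (inp (wtrg \<phi>)) \<times>\<^sub>s hat (outp (wsrc \<phi>))) l"
  then obtain y x where u: "u = Tup y x" and y: "y \<in> sec (hat (inp (wtrg \<phi>))) l" and x: "x \<in> sec (hat (outp (wsrc \<phi>))) l"
    by (rule sec_prodE)
  show "Fam (\<lambda>i \<in> lab (inp (wsrc \<phi>)). lcase (fam (tsnd u)) (fam (tfst u)) (win \<phi> i)) \<in> sec (hat (inp (wsrc \<phi>))) l"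
    using sec_din[OF \<phi> y x] by (simp add: din_eq[OF y x] u)
  fix l' p :: real assume l: "0 \<le> l'" "0 \<le> p" "l' + p \<le> l"
  have "din \<phi> l' (res (hat (inp (wtrg \<phi>))) (l', p, l) y) (res (hat (outp (wsrc \<phi>))) (l', p, l) x) =
      res (hat (inp (wsrc \<phi>))) (l', p, l) (din \<phi> l y x)"
  proof (rule hat_eqI[OF sec_din[OF \<phi>] r(3)[OF l sec_din[OF \<phi> y x]]])
    fix i assume i: "i \<in> lab (inp (wsrc \<phi>))"
    from \<phi> i show "fam (din \<phi> l' (res (hat (inp (wtrg \<phi>))) (l', p, l) y) (res (hat (outp (wsrc \<phi>))) (l', p, l) x)) i =
      fam (res (hat (inp (wsrc \<phi>))) (l', p, l) (din \<phi> l y x)) i"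
      by (cases rule: win_cases) (simp_all add: l i x y r fam_din sec_din[OF \<phi>])
  qed (use l x y r in auto)
  then show "Fam (\<lambda>i \<in> lab (inp (wsrc \<phi>)). lcase (fam (tsnd (res (hat (inp (wtrg \<phi>)) \<times>\<^sub>s hat (outp (wsrc \<phi>))) (l', p, l) u)))
      (fam (tfst (res (hat (inp (wtrg \<phi>)) \<times>\<^sub>s hat (outp (wsrc \<phi>))) (l', p, l) u))) (win \<phi> i)) =
    res (hat (inp (wsrc \<phi>))) (l', p, l)
      (Fam (\<lambda>i \<in> lab (inp (wsrc \<phi>)). lcase (fam (tsnd u)) (fam (tfst u)) (win \<phi> i)))"
    using l x y r by (simp add: din_eq u)
qed (use is_wd_box[OF \<phi>] in \<open>simp_all add: sheaf_prod\<close>)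

lemma sheaf_map_wd_out:
  assumes \<phi>: "psh_wd \<phi>"
  shows "sheaf_map (wd_out \<phi>)"
  unfolding wd_out_def
proof (rule sheaf_map_mk)
  note b = is_wd_box[OF \<phi>]
  note r = res_sec_hat[OF psh_box_tfs(2)[OF b(1)]] res_sec_hat[OF psh_box_tfs(2)[OF b(2)]]
  fix l x assume x: "x \<in> sec (hat (outp (wsrc \<phi>))) l"
  show "Fam (\<lambda>k \<in> lab (outp (wtrg \<phi>)). fam x (wout \<phi> k)) \<in> sec (hat (outp (wtrg \<phi>))) l"
    using sec_dout[OF \<phi> x] by (simp add: dout_eq[OF x])
  fix l' p :: real assume l: "0 \<le> l'" "0 \<le> p" "l' + p \<le> l"
  have "dout \<phi> l' (res (hat (outp (wsrc \<phi>))) (l', p, l) x) = res (hat (outp (wtrg \<phi>))) (l', p, l) (dout \<phi> l x)"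
    by (rule hat_eqI[OF sec_dout[OF \<phi>] r(2)[OF l sec_dout[OF \<phi> x]]])
      (use l x r wout_lab[OF \<phi>] in \<open>auto simp: fam_dout sec_dout[OF \<phi>]\<close>)
  then show "Fam (\<lambda>k \<in> lab (outp (wtrg \<phi>)). fam (res (hat (outp (wsrc \<phi>))) (l', p, l) x) (wout \<phi> k)) =
    res (hat (outp (wtrg \<phi>))) (l', p, l) (Fam (\<lambda>k \<in> lab (outp (wtrg \<phi>)). fam x (wout \<phi> k)))"
    using l x r by (simp add: dout_eq)
qed (use is_wd_box[OF \<phi>] in simp_all)

lemma wd_in_simps [simp]: "pdom (wd_in \<phi>) = hat (inp (wtrg \<phi>)) \<times>\<^sub>s hat (outp (wsrc \<phi>))"
  "pcod (wd_in \<phi>) = hat (inp (wsrc \<phi>))"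
  by (simp_all add: wd_in_def)

lemma wd_out_simps [simp]: "pdom (wd_out \<phi>) = hat (outp (wsrc \<phi>))" "pcod (wd_out \<phi>) = hat (outp (wtrg \<phi>))"
  by (simp_all add: wd_out_def)

lemma din_res:
  assumes "psh_wd \<phi>" "y \<in> sec (hat (inp (wtrg \<phi>))) l" "x \<in> sec (hat (outp (wsrc \<phi>))) l"
    "0 \<le> l'" "0 \<le> p" "l' + p \<le> l"
  shows "din \<phi> l' (res (hat (inp (wtrg \<phi>))) (l', p, l) y) (res (hat (outp (wsrc \<phi>))) (l', p, l) x) =
      res (hat (inp (wsrc \<phi>))) (l', p, l) (din \<phi> l y x)"
  using sheaf_mapD(7)[OF sheaf_map_wd_in[OF assms(1)], of l' p l "Tup y x"] assms by (simp add: din_def)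

lemma dout_res:
  assumes "psh_wd \<phi>" "x \<in> sec (hat (outp (wsrc \<phi>))) l" "0 \<le> l'" "0 \<le> p" "l' + p \<le> l"
  shows "dout \<phi> l' (res (hat (outp (wsrc \<phi>))) (l', p, l) x) = res (hat (outp (wtrg \<phi>))) (l', p, l) (dout \<phi> l x)"
  using sheaf_mapD(7)[OF sheaf_map_wd_out[OF assms(1)]] assms by simp

lemma wd_comp_win: "i \<in> lab (inp (wsrc \<phi>)) \<Longrightarrow>
    win (wd_comp \<psi> \<phi>) i = lcase InL (\<lambda>j. lcase (\<lambda>y. InL (wout \<phi> y)) InR (win \<psi> j)) (win \<phi> i)"
  "k \<in> lab (outp (wtrg \<psi>)) \<Longrightarrow> wout (wd_comp \<psi> \<phi>) k = wout \<phi> (wout \<psi> k)"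
  by (simp_all add: wd_comp_def)

lemma dout_comp:
  assumes \<phi>: "psh_wd \<phi>" and \<psi>: "psh_wd \<psi>" and eq: "wtrg \<phi> = wsrc \<psi>"
    and x: "x \<in> sec (hat (outp (wsrc \<phi>))) l"
  shows "dout (wd_comp \<psi> \<phi>) l x = dout \<psi> l (dout \<phi> l x)"
proof -
  have x': "x \<in> sec (hat (outp (wsrc (wd_comp \<psi> \<phi>)))) l" using x by simp
  have y: "dout \<phi> l x \<in> sec (hat (outp (wsrc \<psi>))) l" using sec_dout[OF \<phi> x] eq by simp
  show ?thesis
    by (rule hat_eqI[OF sec_dout[OF is_wd_comp[OF \<phi> \<psi> eq] x']])
      (use x x' y sec_dout[OF \<psi> y] wout_lab[OF \<psi>] eq in \<open>auto simp: fam_dout wd_comp_win\<close>)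
qed

text \<open>The middle box shows as its output what \<open>\<phi>\<close> exposes of
  \<open>x\<close>; with it \<open>\<psi>\<close> computes the middle input, which
  \<open>\<phi>\<close> passes on. Thus the middle interface in a cell \<open>fcmp\<close> is a
  function of \<open>z\<close> and \<open>x\<close>.\<close>

lemma din_comp:
  assumes \<phi>: "psh_wd \<phi>" and \<psi>: "psh_wd \<psi>" and eq: "wtrg \<phi> = wsrc \<psi>"
    and z: "z \<in> sec (hat (inp (wtrg \<psi>))) l" and x: "x \<in> sec (hat (outp (wsrc \<phi>))) l"
  shows "din (wd_comp \<psi> \<phi>) l z x = din \<phi> l (din \<psi> l z (dout \<phi> l x)) x"
proof -
  have zx: "z \<in> sec (hat (inp (wtrg (wd_comp \<psi> \<phi>)))) l" "x \<in> sec (hat (outp (wsrc (wd_comp \<psi> \<phi>)))) l"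
    using x z by simp_all
  have y: "dout \<phi> l x \<in> sec (hat (outp (wsrc \<psi>))) l" using sec_dout[OF \<phi> x] eq by simp
  have w: "din \<psi> l z (dout \<phi> l x) \<in> sec (hat (inp (wtrg \<phi>))) l" using sec_din[OF \<psi> z y] eq by simp
  show ?thesis
    unfolding din_eq[OF zx] din_eq[OF w x] unfolding din_eq[OF z y] unfolding dout_eq[OF x]
    by (simp, rule restrict_ext, simp add: wd_comp_win,
      (erule win_cases[OF \<phi>] win_cases[OF \<psi>]; simp add: eq)+)
qed

lemma fam_din_relabel:
  assumes "y \<in> sec (hat (inp Y)) l" "x \<in> sec (hat (outp X)) l" "i \<in> lab (inp X)"
  shows "fam (din (relabel X Y g h) l y x) i = fam y (g i)"
proof -
  have "win (relabel X Y g h) i = InR (g i)" using assms(3) by (simp add: relabel_def)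
  then show ?thesis using fam_din[of y "relabel X Y g h" l x i] assms by simp
qed

section \<open>Maps into and between products and pullbacks\<close>

lemma map_pair_simps [simp]:
  "pdom (map_pair f g) = pdom f" "pcod (map_pair f g) = pcod f \<times>\<^sub>s pcod g"
  "x \<in> sec (pdom f) l \<Longrightarrow> app (map_pair f g) l x = Tup (app f l x) (app g l x)"
  by (simp_all add: map_pair_def)

lemma proj2_simps [simp]:
  "pdom (proj2 A B) = A \<times>\<^sub>s B" "pcod (proj2 A B) = B"
  "Tup a b \<in> sec (A \<times>\<^sub>s B) l \<Longrightarrow> app (proj2 A B) l (Tup a b) = b"
  by (simp_all add: proj2_def del: sec_prod)

lemma map_prod_s_simps [simp]:
  "pdom (map_prod_s f g) = pdom f \<times>\<^sub>s pdom g" "pcod (map_prod_s f g) = pcod f \<times>\<^sub>s pcod g"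
  "Tup a b \<in> sec (pdom f \<times>\<^sub>s pdom g) l \<Longrightarrow> app (map_prod_s f g) l (Tup a b) = Tup (app f l a) (app g l b)"
  by (simp_all add: map_prod_s_def del: sec_prod)

lemma pullback_map_simps [simp]:
  "pdom (pullback_map k p) = pullback k p" "pcod (pullback_map k p) = pdom k"
  "Tup d s \<in> sec (pullback k p) l \<Longrightarrow> app (pullback_map k p) l (Tup d s) = d"
  by (simp_all add: pullback_map_def del: sec_pullback)

lemma sheaf_map_pair:
  assumes f: "sheaf_map f" and g: "sheaf_map g" and eq: "pdom f = pdom g"
  shows "sheaf_map (map_pair f g)"
  unfolding map_pair_def
  by (rule sheaf_map_mk)
    (use sheaf_mapD[OF f] sheaf_mapD[OF g] eq presheafD(1)[OF sheaf_mapD(3)[OF f]] in \<open>auto simp: sheaf_prod\<close>)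

lemma sheaf_map_proj2: "sheaf A \<Longrightarrow> sheaf B \<Longrightarrow> sheaf_map (proj2 A B)"
  unfolding proj2_def by (rule sheaf_map_mk) (auto simp: sheaf_prod elim!: sec_prodE)

lemma sheaf_map_prod_s:
  assumes f: "sheaf_map f" and g: "sheaf_map g"
  shows "sheaf_map (map_prod_s f g)"
  unfolding map_prod_s_def
  by (rule sheaf_map_mk) (use sheaf_mapD[OF f] sheaf_mapD[OF g] in \<open>auto simp: sheaf_prod elim!: sec_prodE\<close>)

lemma sheaf_map_pullback:
  assumes "sheaf_map k" "sheaf_map p" "pcod k = pcod p"
  shows "sheaf_map (pullback_map k p)"
  unfolding pullback_map_def
  by (rule sheaf_map_mk) (use assms in \<open>auto simp: sheaf_pullback sheaf_mapD elim!: sec_pullbackE\<close>)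

text \<open>Membership in the fibre of \<open>Mch\<close>; over a box of sheaves it is equivalent to
  \<open>machine\<close>.\<close>

definition mach :: "'a psh box \<Rightarrow> 'a pmap \<Rightarrow> bool" where
  "mach X m \<longleftrightarrow> sheaf_map m \<and> pcod m = iface X"

lemma mach_app:
  assumes "mach X m" "s \<in> sec (pdom m) l"
  obtains a b where "app m l s = Tup a b" "a \<in> sec (hat (inp X)) l" "b \<in> sec (hat (outp X)) l"
  using assms sheaf_mapD(5)[of m s l] by (auto simp: mach_def iface_def elim: sec_prodE)

lemma mach_sec_nonneg: "mach X m \<Longrightarrow> s \<in> sec (pdom m) l \<Longrightarrow> 0 \<le> l"
  unfolding mach_def by (auto intro: presheafD(1) sheaf_mapD(3))

lemma mach_sec_res: "mach X m \<Longrightarrow> s \<in> sec (pdom m) l \<Longrightarrow> 0 \<le> l' \<Longrightarrow> 0 \<le> p \<Longrightarrow> l' + p \<le> l \<Longrightarrow>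
    res (pdom m) (l', p, l) s \<in> sec (pdom m) l'"
  unfolding mach_def by (auto intro: presheafD(2) sheaf_mapD(3))

lemma mach_sheaf: "mach X m \<Longrightarrow> sheaf (pdom m)"
  unfolding mach_def by (auto intro: sheaf_mapD(1))

lemma mach_mch_act:
  assumes \<phi>: "psh_wd \<phi>" and m: "mach (wsrc \<phi>) m"
  shows "mach (wtrg \<phi>) (mch_act \<phi> m)"
proof -
  let ?k = "map_pair (wd_in \<phi>) (proj2 (hat (inp (wtrg \<phi>))) (hat (outp (wsrc \<phi>))))"
  note b = is_wd_box[OF \<phi>]
  have k: "sheaf_map ?k"
    by (rule sheaf_map_pair) (use b in \<open>auto intro: sheaf_map_wd_in[OF \<phi>] sheaf_map_proj2\<close>)
  have "sheaf_map (pullback_map ?k m)"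
    by (rule sheaf_map_pullback[OF k]) (use m in \<open>auto simp: mach_def iface_def\<close>)
  moreover have "sheaf_map (map_prod_s (idn IntSh (hat (inp (wtrg \<phi>)))) (wd_out \<phi>))"
    by (rule sheaf_map_prod_s) (use b in \<open>auto intro: sheaf_map_idn sheaf_map_wd_out[OF \<phi>]\<close>)
  ultimately show ?thesis
    unfolding mach_def mch_act_def by (auto intro!: sheaf_map_comp simp: iface_def)
qed

text \<open>The pullback condition recovers the recorded \<open>x\<close> from \<open>s\<close>.
  Only the outer input \<open>y\<close> is information beyond \<open>s\<close>.\<close>

lemma sec_act:
  assumes "mach (wsrc \<phi>) m"
  shows "Tup (Tup y x) s \<in> sec (pdom (mch_act \<phi> m)) l \<longleftrightarrow> 0 \<le> l \<and> y \<in> sec (hat (inp (wtrg \<phi>))) l \<and>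
    x \<in> sec (hat (outp (wsrc \<phi>))) l \<and> s \<in> sec (pdom m) l \<and> app m l s = Tup (din \<phi> l y x) x"
  by (auto simp: mch_act_def din_def)

lemma sec_actE:
  assumes "u \<in> sec (pdom (mch_act \<phi> m)) l"
  obtains y x s where "u = Tup (Tup y x) s" "0 \<le> l" "y \<in> sec (hat (inp (wtrg \<phi>))) l"
    "x \<in> sec (hat (outp (wsrc \<phi>))) l" "s \<in> sec (pdom m) l" "app m l s = Tup (din \<phi> l y x) x"
  using assms by (auto simp: mch_act_def din_def elim!: sec_pullbackE sec_prodE)

lemma app_act:
  assumes "Tup (Tup y x) s \<in> sec (pdom (mch_act \<phi> m)) l"
  shows "app (mch_act \<phi> m) l (Tup (Tup y x) s) = Tup y (dout \<phi> l x)"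
  using assms by (auto simp: mch_act_def)

lemma res_act:
  assumes "Tup (Tup y x) s \<in> sec (pdom (mch_act \<phi> m)) l" "0 \<le> l'" "0 \<le> p" "l' + p \<le> l"
  shows "res (pdom (mch_act \<phi> m)) (l', p, l) (Tup (Tup y x) s) =
    Tup (Tup (res (hat (inp (wtrg \<phi>))) (l', p, l) y) (res (hat (outp (wsrc \<phi>))) (l', p, l) x))
      (res (pdom m) (l', p, l) s)"
  using assms by (auto simp: mch_act_def)

section \<open>Families over a disjoint union of labels\<close>

lemma fam_join_sec:
  assumes "a \<in> sec (hat A) l" "b \<in> sec (hat B) l"
  shows "fam_join A B a b \<in> sec (hat (A +\<^sub>t B)) l"
  unfolding fam_join_def
  by (rule sec_hatI) (use sec_hatD(1)[OF assms(1)] sec_hatD(1)[OF assms(2)] sec_hatD(2)[OF assms(1)] in auto)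

lemma fam_join_fam [simp]:
  "x \<in> lab A \<Longrightarrow> fam (fam_join A B a b) (InL x) = fam a x"
  "y \<in> lab B \<Longrightarrow> fam (fam_join A B a b) (InR y) = fam b y"
  by (simp_all add: fam_join_def)

lemma part_fam [simp]:
  "x \<in> lab A \<Longrightarrow> fam (left_part A u) x = fam u (InL x)"
  "y \<in> lab B \<Longrightarrow> fam (right_part B u) y = fam u (InR y)"
  by (simp_all add: left_part_def right_part_def)

lemma sec_parts:
  assumes "u \<in> sec (hat (A +\<^sub>t B)) l"
  shows "left_part A u \<in> sec (hat A) l" "right_part B u \<in> sec (hat B) l"
  unfolding left_part_def right_part_def
proof -
  have "fam u (InL x) \<in> sec (tau A x) l" if "x \<in> lab A" for x
    using sec_hatD(1)[OF assms, of "InL x"] that by simp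
  then show "Fam (\<lambda>x \<in> lab A. fam u (InL x)) \<in> sec (hat A) l" by (intro sec_hatI sec_hatD(2)[OF assms])
  have "fam u (InR x) \<in> sec (tau B x) l" if "x \<in> lab B" for x
    using sec_hatD(1)[OF assms, of "InR x"] that by simp
  then show "Fam (\<lambda>x \<in> lab B. fam u (InR x)) \<in> sec (hat B) l" by (intro sec_hatI sec_hatD(2)[OF assms])
qed

lemma join_parts:
  assumes "u \<in> sec (hat (A +\<^sub>t B)) l"
  shows "fam_join A B (left_part A u) (right_part B u) = u"
  by (rule hat_eqI[OF fam_join_sec[OF sec_parts[OF assms]] assms]) auto

lemma parts_join:
  assumes "a \<in> sec (hat A) l" "b \<in> sec (hat B) l"
  shows "left_part A (fam_join A B a b) = a" "right_part B (fam_join A B a b) = b"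
proof -
  note j = sec_parts[OF fam_join_sec[OF assms]]
  show "left_part A (fam_join A B a b) = a" by (rule hat_eqI[OF j(1) assms(1)]) simp
  show "right_part B (fam_join A B a b) = b" by (rule hat_eqI[OF j(2) assms(2)]) simp
qed

lemma tfs_psh_sum: "tfs_psh A \<Longrightarrow> tfs_psh B \<Longrightarrow> tfs_psh (A +\<^sub>t B)"
  by (auto simp: tfs_psh_def)

lemma res_join:
  assumes A: "tfs_psh A" and B: "tfs_psh B" and a: "a \<in> sec (hat A) l" and b: "b \<in> sec (hat B) l"
    and l: "0 \<le> l'" "0 \<le> p" "l' + p \<le> l"
  shows "res (hat (A +\<^sub>t B)) (l', p, l) (fam_join A B a b) =
    fam_join A B (res (hat A) (l', p, l) a) (res (hat B) (l', p, l) b)"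
  by (rule hat_eqI[OF res_sec_hat[OF tfs_psh_sum[OF A B] l fam_join_sec[OF a b]]
        fam_join_sec[OF res_sec_hat[OF A l a] res_sec_hat[OF B l b]]])
    (use l a b fam_join_sec[OF a b] in auto)

lemma res_parts:
  assumes A: "tfs_psh A" and B: "tfs_psh B" and u: "u \<in> sec (hat (A +\<^sub>t B)) l"
    and l: "0 \<le> l'" "0 \<le> p" "l' + p \<le> l"
  shows "left_part A (res (hat (A +\<^sub>t B)) (l', p, l) u) = res (hat A) (l', p, l) (left_part A u)"
    "right_part B (res (hat (A +\<^sub>t B)) (l', p, l) u) = res (hat B) (l', p, l) (right_part B u)"
proof -
  note r = res_sec_hat[OF tfs_psh_sum[OF A B] l u]
  show "left_part A (res (hat (A +\<^sub>t B)) (l', p, l) u) = res (hat A) (l', p, l) (left_part A u)"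
    by (rule hat_eqI[OF sec_parts(1)[OF r] res_sec_hat[OF A l sec_parts(1)[OF u]]])
      (use l u sec_parts[OF u] in simp)
  show "right_part B (res (hat (A +\<^sub>t B)) (l', p, l) u) = res (hat B) (l', p, l) (right_part B u)"
    by (rule hat_eqI[OF sec_parts(2)[OF r] res_sec_hat[OF B l sec_parts(2)[OF u]]])
      (use l u sec_parts[OF u] in simp)
qed

section \<open>Products of machines and the unit machine\<close>

lemma iface_join_simps [simp]:
  "pdom (iface_join X Y) = iface X \<times>\<^sub>s iface Y" "pcod (iface_join X Y) = iface (box_sum X Y)"
  "Tup (Tup a b) (Tup c d) \<in> sec (iface X \<times>\<^sub>s iface Y) l \<Longrightarrow> app (iface_join X Y) l (Tup (Tup a b) (Tup c d)) =
    Tup (fam_join (inp X) (inp Y) a c) (fam_join (outp X) (outp Y) b d)"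
  by (simp_all add: iface_join_def del: sec_prod)

lemma sheaf_map_iface_join:
  assumes X: "psh_box X" and Y: "psh_box Y"
  shows "sheaf_map (iface_join X Y)"
  unfolding iface_join_def
  by (rule sheaf_map_mk) (use assms in
    \<open>auto simp: sheaf_prod sheaf_hat tfs_psh_sum iface_def fam_join_sec res_join psh_box_tfs
      res_sec_hat elim!: sec_prodE\<close>)

lemma mch_mu_simps [simp]:
  "pdom (mch_mu X Y m n) = pdom m \<times>\<^sub>s pdom n" "pcod (mch_mu X Y m n) = iface (box_sum X Y)"
  by (simp_all add: mch_mu_def)

lemma mach_mu:
  assumes X: "psh_box X" and Y: "psh_box Y" and m: "mach X m" and n: "mach Y n"
  shows "mach (box_sum X Y) (mch_mu X Y m n)"
  unfolding mach_def mch_mu_def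
  using sheaf_map_comp[OF sheaf_map_prod_s sheaf_map_iface_join[OF X Y], of m n] m n
  by (simp add: mach_def)

lemma app_mu:
  assumes m: "mach X m" and n: "mach Y n" and s: "s \<in> sec (pdom m) l" and t: "t \<in> sec (pdom n) l"
    and "app m l s = Tup a b" "app n l t = Tup c d"
  shows "app (mch_mu X Y m n) l (Tup s t) = Tup (fam_join (inp X) (inp Y) a c) (fam_join (outp X) (outp Y) b d)"
proof -
  have "app m l s \<in> sec (iface X) l" "app n l t \<in> sec (iface Y) l"
    using m n s t sheaf_mapD(5)[of m s l] sheaf_mapD(5)[of n t l] by (auto simp: mach_def)
  then show ?thesis
    using assms mach_sec_nonneg[OF m s] by (simp add: mch_mu_def)
qed

lemma mach_eta: "mach box_empty mch_eta"
  unfolding mach_def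
proof
  have e: "tfs_psh tfs_empty" by (simp add: tfs_psh_def)
  have s: "sheaf (hat (tfs_empty :: 'a psh tfs))" by (rule sheaf_hat[OF e])
  show "sheaf_map (mch_eta :: 'a pmap)"
    unfolding mch_eta_def
    by (rule sheaf_map_mk) (auto simp: s iface_def sheaf_prod sec_hatD(2))
qed (simp add: mch_eta_def)

lemma eta_simps [simp]: "pdom mch_eta = hat tfs_empty"
  "u \<in> sec (hat tfs_empty) l \<Longrightarrow> app mch_eta l u = Tup u u"
  by (simp_all add: mch_eta_def)

text \<open>The empty product is terminal, and its section is the same element at all
  lengths.\<close>

lemma sec_hat_empty: "u \<in> sec (hat tfs_empty) l \<longleftrightarrow> 0 \<le> l \<and> u = Fam (\<lambda>x. undefined)"
  by (simp add: sec_hat restrict_def)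

section \<open>Arrows between machines, by their action on states\<close>

abbreviation sl :: "'a psh box \<Rightarrow> ('a pmap, 'a pmap \<times> 'a pmap \<times> 'a pmap) cat" where
  "sl X \<equiv> slice IntSh (iface X)"

abbreviation ap :: "'b \<times> 'c \<times> 'a pmap \<Rightarrow> real \<Rightarrow> 'a univ \<Rightarrow> 'a univ" where
  "ap f \<equiv> app (snd (snd f))"

lemma Obj_sl [simp]: "m \<in> Obj (sl X) \<longleftrightarrow> mach X m"
  by (simp add: mach_def)

lemma hom_sl: "hom (sl X) m n = {(m', n', h). m' = m \<and> n' = n \<and> mach X m \<and> mach X n \<and>
    sheaf_map h \<and> pdom h = pdom m \<and> pcod h = pdom n \<and> n \<cdot>\<^bsub>IntSh\<^esub> h = m}"
  by (auto simp: hom_slice hom_IntSh mach_def)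

lemma sl_category: "category (sl X)"
  by (rule slice_category[OF IntSh_category])

lemma ap_mk_arr [simp]: "u \<in> sec (pdom m) l \<Longrightarrow> ap (mk_arr m n f) l u = f l u"
  by (simp add: mk_arr_def)

lemma hom_slD:
  assumes "f \<in> hom (sl X) m n"
  shows "mach X m" "mach X n" "f = (m, n, snd (snd f))" "sheaf_map (snd (snd f))"
    "pdom (snd (snd f)) = pdom m" "pcod (snd (snd f)) = pdom n"
    "u \<in> sec (pdom m) l \<Longrightarrow> ap f l u \<in> sec (pdom n) l"
    "u \<in> sec (pdom m) l \<Longrightarrow> app n l (ap f l u) = app m l u"
    "u \<in> sec (pdom m) l \<Longrightarrow> 0 \<le> l' \<Longrightarrow> 0 \<le> p \<Longrightarrow> l' + p \<le> l \<Longrightarrow>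
      ap f l' (res (pdom m) (l', p, l) u) = res (pdom n) (l', p, l) (ap f l u)"
proof -
  obtain h where f: "f = (m, n, h)" and h: "sheaf_map h" "pdom h = pdom m" "pcod h = pdom n"
    and c: "n \<cdot>\<^bsub>IntSh\<^esub> h = m" and m: "mach X m" "mach X n"
    using assms by (auto simp: hom_sl)
  show "u \<in> sec (pdom m) l \<Longrightarrow> ap f l u \<in> sec (pdom n) l" using sheaf_mapD(5)[OF h(1), of u l] f h by simp
  show "app n l (ap f l u) = app m l u" if "u \<in> sec (pdom m) l"
  proof -
    have "app (n \<cdot>\<^bsub>IntSh\<^esub> h) l u = app n l (app h l u)" using that h by simp
    then show ?thesis using f by (simp only: c snd_conv)
  qed
  show "u \<in> sec (pdom m) l \<Longrightarrow> 0 \<le> l' \<Longrightarrow> 0 \<le> p \<Longrightarrow> l' + p \<le> l \<Longrightarrow>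
      ap f l' (res (pdom m) (l', p, l) u) = res (pdom n) (l', p, l) (ap f l u)"
    using sheaf_mapD(7)[OF h(1), of l' p l u] f h by simp
qed (use assms in \<open>simp_all only: hom_sl mem_Collect_eq case_prod_unfold prod_eq_iff fst_conv snd_conv simp_thms\<close>)

lemma ap_cmp [simp]:
  assumes "f \<in> hom (sl X) A B" "g \<in> hom (sl X) B C" "u \<in> sec (pdom A) l"
  shows "ap (g \<cdot>\<^bsub>sl Y\<^esub> f) l u = ap g l (ap f l u)"
proof -
  obtain h k where "f = (A, B, h)" "g = (B, C, k)" "pdom h = pdom A"
    using hom_slD(3,5)[OF assms(1)] hom_slD(3)[OF assms(2)] by metis
  then show ?thesis using assms(3) by simp
qed

lemma ap_idn [simp]: "u \<in> sec (pdom A) l \<Longrightarrow> ap (idn (sl X) A) l u = u"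
  by simp

lemma hom_sl_eqI:
  assumes f: "f \<in> hom (sl X) A B" and g: "g \<in> hom (sl X) A B"
    and eq: "\<And>l u. u \<in> sec (pdom A) l \<Longrightarrow> ap f l u = ap g l u"
  shows "f = g"
proof -
  have "snd (snd f) = snd (snd g)"
    by (rule pmap_eqI[OF hom_slD(4)[OF f] hom_slD(4)[OF g]])
      (use hom_slD(5,6)[OF f] hom_slD(5,6)[OF g] eq in simp_all)
  then show ?thesis using hom_slD(3)[OF f] hom_slD(3)[OF g] by simp
qed

lemma mk_arr_hom:
  assumes m: "mach X m" and n: "mach X n"
    and sec: "\<And>l u. u \<in> sec (pdom m) l \<Longrightarrow> f l u \<in> sec (pdom n) l"
    and leg: "\<And>l u. u \<in> sec (pdom m) l \<Longrightarrow> app n l (f l u) = app m l u"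
    and nat: "\<And>l' p l u. 0 \<le> l' \<Longrightarrow> 0 \<le> p \<Longrightarrow> l' + p \<le> l \<Longrightarrow> u \<in> sec (pdom m) l \<Longrightarrow>
      f l' (res (pdom m) (l', p, l) u) = res (pdom n) (l', p, l) (f l u)"
  shows "mk_arr m n f \<in> hom (sl X) m n"
proof -
  have h: "sheaf_map (mk_map (pdom m) (pdom n) f)"
    by (rule sheaf_map_mk) (use m n mach_sheaf sec nat in auto)
  have "n \<cdot>\<^bsub>IntSh\<^esub> mk_map (pdom m) (pdom n) f = m"
    by (rule pmap_eqI) (use m n h leg in \<open>auto simp: mach_def intro: sheaf_map_comp\<close>)
  then show ?thesis using h m n by (simp add: hom_sl mk_arr_def)
qed

text \<open>The inverse of a bijection that is natural and lies over the interface is natural and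
  over the interface as well. So invertibility of a cell is a matter of sets, one length at a
  time.\<close>

lemma mk_arr_iso:
  assumes f: "mk_arr m n f \<in> hom (sl X) m n"
    and inj: "\<And>l u v. u \<in> sec (pdom m) l \<Longrightarrow> v \<in> sec (pdom m) l \<Longrightarrow> f l u = f l v \<Longrightarrow> u = v"
    and surj: "\<And>l w. w \<in> sec (pdom n) l \<Longrightarrow> \<exists>u \<in> sec (pdom m) l. f l u = w"
  shows "mk_arr m n f \<in> isos (sl X) m n"
proof -
  define g where "g l = inv_into (sec (pdom m) l) (f l)" for l
  have g: "g l w \<in> sec (pdom m) l" "f l (g l w) = w" if "w \<in> sec (pdom n) l" for l w
    using inv_into_into[of w "f l" "sec (pdom m) l"] f_inv_into_f[of w "f l" "sec (pdom m) l"]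
      surj[OF that] unfolding g_def by blast+
  have gf: "g l (f l u) = u" if "u \<in> sec (pdom m) l" for l u
    unfolding g_def by (rule inv_into_f_f) (use inj that in \<open>auto intro: inj_onI\<close>)
  note fD = hom_slD[OF f]
  have h: "mk_arr n m g \<in> hom (sl X) n m"
  proof (rule mk_arr_hom[OF fD(2,1)])
    fix l w assume w: "w \<in> sec (pdom n) l"
    show "g l w \<in> sec (pdom m) l" by (rule g(1)[OF w])
    show "app m l (g l w) = app n l w" using fD(8)[OF g(1)[OF w]] g[OF w] by simp
    fix l' p :: real assume l: "0 \<le> l'" "0 \<le> p" "l' + p \<le> l"
    have "f l' (res (pdom m) (l', p, l) (g l w)) = res (pdom n) (l', p, l) w"
      using fD(9)[OF g(1)[OF w] l] g[OF w] mach_sec_res[OF fD(1) g(1)[OF w] l] by simp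
    then show "g l' (res (pdom n) (l', p, l) w) = res (pdom m) (l', p, l) (g l w)"
      using gf[OF mach_sec_res[OF fD(1) g(1)[OF w] l]] by simp
  qed
  interpret category "sl X" by (rule sl_category)
  have "mk_arr n m g \<cdot>\<^bsub>sl X\<^esub> mk_arr m n f = idn (sl X) m"
    by (rule hom_sl_eqI[OF cmp_hom[OF f h] idn_hom]) (use fD(1,7) gf in \<open>auto simp: ap_cmp[OF f h] mach_def simp del: slice_simps(4)\<close>)
  moreover have "mk_arr m n f \<cdot>\<^bsub>sl X\<^esub> mk_arr n m g = idn (sl X) n"
    by (rule hom_sl_eqI[OF cmp_hom[OF h f] idn_hom]) (use fD(2) g in \<open>auto simp: ap_cmp[OF h f] mach_def simp del: slice_simps(4)\<close>)
  ultimately show ?thesis using f h by (auto simp: isos_def)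
qed

text \<open>Covers the unit, associativity, unitality and braiding cells at once.\<close>

lemma relabel_act_iso:
  assumes \<phi>: "psh_wd (relabel X Y g h)"
    and g: "\<And>i. i \<in> lab (inp X) \<Longrightarrow> g i \<in> lab (inp Y) \<and> g' (g i) = i"
    and g': "\<And>j. j \<in> lab (inp Y) \<Longrightarrow> g' j \<in> lab (inp X) \<and> g (g' j) = j"
    and m: "mach X m" and n: "mach Y n"
    and r: "\<And>l s. s \<in> sec (pdom m) l \<Longrightarrow> r s \<in> sec (pdom n) l"
    and leg: "\<And>l s a b. s \<in> sec (pdom m) l \<Longrightarrow> app m l s = Tup a b \<Longrightarrow> a \<in> sec (hat (inp X)) l \<Longrightarrow>
      b \<in> sec (hat (outp X)) l \<Longrightarrow> app n l (r s) =
      Tup (Fam (\<lambda>j \<in> lab (inp Y). fam a (g' j))) (Fam (\<lambda>k \<in> lab (outp Y). fam b (h k)))"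
    and nat: "\<And>l' p l s. 0 \<le> l' \<Longrightarrow> 0 \<le> p \<Longrightarrow> l' + p \<le> l \<Longrightarrow> s \<in> sec (pdom m) l \<Longrightarrow>
      r (res (pdom m) (l', p, l) s) = res (pdom n) (l', p, l) (r s)"
    and inj: "\<And>l s t. s \<in> sec (pdom m) l \<Longrightarrow> t \<in> sec (pdom m) l \<Longrightarrow> r s = r t \<Longrightarrow> s = t"
    and surj: "\<And>l w. w \<in> sec (pdom n) l \<Longrightarrow> \<exists>s \<in> sec (pdom m) l. r s = w"
  shows "mk_arr (mch_act (relabel X Y g h) m) n (\<lambda>l u. r (tsnd u)) \<in>
    isos (sl Y) (mch_act (relabel X Y g h) m) n"
proof -
  let ?\<phi> = "relabel X Y g h"
  have m': "mach (wsrc ?\<phi>) m" using m by simp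
  have am: "mach Y (mch_act ?\<phi> m)" using mach_mch_act[OF \<phi> m'] by simp
  \<comment> \<open>Without feedback every outer input port is visible inside, so the outer input
    can be read back from the inner one through \<open>g'\<close>.\<close>
  have y_eq: "Fam (\<lambda>j \<in> lab (inp Y). fam (din ?\<phi> l y x) (g' j)) = y"
    if y: "y \<in> sec (hat (inp Y)) l" and x: "x \<in> sec (hat (outp X)) l" for l y x
  proof -
    have "Fam (\<lambda>j \<in> lab (inp Y). fam (din ?\<phi> l y x) (g' j)) = Fam (restrict (fam y) (lab (inp Y)))"
      using g' by (auto simp: fam_din_relabel[OF y x] intro!: restrict_ext)
    then show ?thesis using y by (simp add: sec_hat)
  qed
  have hom: "mk_arr (mch_act ?\<phi> m) n (\<lambda>l u. r (tsnd u)) \<in> hom (sl Y) (mch_act ?\<phi> m) n"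
  proof (rule mk_arr_hom[OF am n])
    fix l u assume u: "u \<in> sec (pdom (mch_act ?\<phi> m)) l"
    then obtain y x s where u': "u = Tup (Tup y x) s" "y \<in> sec (hat (inp Y)) l"
      "x \<in> sec (hat (outp X)) l" "s \<in> sec (pdom m) l" "app m l s = Tup (din ?\<phi> l y x) x"
      by (rule sec_actE) simp
    show "r (tsnd u) \<in> sec (pdom n) l" using r u' by simp
    have "din ?\<phi> l y x \<in> sec (hat (inp X)) l" using sec_din[OF \<phi>, of y l x] u' by simp
    then have "app n l (r s) = Tup y (Fam (\<lambda>k \<in> lab (outp Y). fam x (h k)))"
      using leg[OF u'(4,5)] u' y_eq by simp
    moreover have "dout ?\<phi> l x = Fam (\<lambda>k \<in> lab (outp Y). fam x (h k))"
      using dout_eq[of x ?\<phi> l] u'(3) by (auto simp: relabel_def intro!: restrict_ext)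
    ultimately show "app n l (r (tsnd u)) = app (mch_act ?\<phi> m) l u"
      using app_act[of y x s ?\<phi> m l] u u' by simp
    fix l' p :: real assume l: "0 \<le> l'" "0 \<le> p" "l' + p \<le> l"
    then show "r (tsnd (res (pdom (mch_act ?\<phi> m)) (l', p, l) u)) = res (pdom n) (l', p, l) (r (tsnd u))"
      using u u' by (simp add: res_act nat)
  qed
  show ?thesis
  proof (rule mk_arr_iso[OF hom])
    fix l u v assume u: "u \<in> sec (pdom (mch_act ?\<phi> m)) l" and v: "v \<in> sec (pdom (mch_act ?\<phi> m)) l"
      and eq: "r (tsnd u) = r (tsnd v)"
    obtain y x s where u': "u = Tup (Tup y x) s" "y \<in> sec (hat (inp Y)) l"
      "x \<in> sec (hat (outp X)) l" "s \<in> sec (pdom m) l" "app m l s = Tup (din ?\<phi> l y x) x"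
      using u by (rule sec_actE) simp
    obtain y' x' s' where v': "v = Tup (Tup y' x') s'" "y' \<in> sec (hat (inp Y)) l"
      "x' \<in> sec (hat (outp X)) l" "s' \<in> sec (pdom m) l" "app m l s' = Tup (din ?\<phi> l y' x') x'"
      using v by (rule sec_actE) simp
    have "s = s'" using inj[OF u'(4) v'(4)] eq u' v' by simp
    then have "Tup (din ?\<phi> l y x) x = Tup (din ?\<phi> l y' x') x'" using u'(5) v'(5) by metis
    then have xd: "x = x'" "din ?\<phi> l y x = din ?\<phi> l y' x'" by blast+
    have "y = y'" using y_eq[OF u'(2,3), unfolded xd(2)] y_eq[OF v'(2,3)] by (rule trans[OF sym])
    then show "u = v" using \<open>s = s'\<close> xd(1) u'(1) v'(1) by simp
  next
    fix l w assume "w \<in> sec (pdom n) l"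
    then obtain s where s: "s \<in> sec (pdom m) l" "r s = w" using surj by blast
    obtain a b where ab: "app m l s = Tup a b" "a \<in> sec (hat (inp X)) l" "b \<in> sec (hat (outp X)) l"
      using mach_app[OF m s(1)] by blast
    \<comment> \<open>The only possible outer input, by \<open>y_eq\<close>. It is a section because
      \<open>leg\<close> identifies it with the input component of \<open>n\<close> at
      \<open>r s\<close>.\<close>
    let ?y = "Fam (\<lambda>j \<in> lab (inp Y). fam a (g' j))"
    have y: "?y \<in> sec (hat (inp Y)) l"
      using leg[OF s(1) ab] r[OF s(1)] by (elim mach_app[OF n]) simp
    have "din ?\<phi> l ?y b = a"
      by (rule hat_eqI[OF _ ab(2)]) (use sec_din[OF \<phi>, of ?y l b] y ab g in \<open>auto simp: fam_din_relabel\<close>)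
    then have "Tup (Tup ?y b) s \<in> sec (pdom (mch_act ?\<phi> m)) l"
      using y ab s mach_sec_nonneg[OF m s(1)] by (simp add: sec_act[OF m'])
    then show "\<exists>u \<in> sec (pdom (mch_act ?\<phi> m)) l. r (tsnd u) = w"
      using s by force
  qed
qed

text \<open>Ports of one summand are never wired to the other, so the inner inputs are computed
  separately from the parts.\<close>

lemma din_sum:
  assumes \<phi>: "psh_wd \<phi>" and \<psi>: "psh_wd \<psi>"
    and y: "y \<in> sec (hat (inp (wtrg \<phi>) +\<^sub>t inp (wtrg \<psi>))) l"
    and x: "x \<in> sec (hat (outp (wsrc \<phi>) +\<^sub>t outp (wsrc \<psi>))) l"
  shows "din (wd_sum \<phi> \<psi>) l y x = fam_join (inp (wsrc \<phi>)) (inp (wsrc \<psi>))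
    (din \<phi> l (left_part (inp (wtrg \<phi>)) y) (left_part (outp (wsrc \<phi>)) x))
    (din \<psi> l (right_part (inp (wtrg \<psi>)) y) (right_part (outp (wsrc \<psi>)) x))"
proof -
  have yx: "y \<in> sec (hat (inp (wtrg (wd_sum \<phi> \<psi>)))) l" "x \<in> sec (hat (outp (wsrc (wd_sum \<phi> \<psi>)))) l"
    using y x by simp_all
  show ?thesis
    unfolding fam_join_def din_eq[OF yx] din_eq[OF sec_parts(1)[OF y] sec_parts(1)[OF x]]
      din_eq[OF sec_parts(2)[OF y] sec_parts(2)[OF x]]
    by (simp, rule restrict_ext, auto simp: wd_sum_win, (erule win_cases[OF \<phi>] win_cases[OF \<psi>]; simp)+)
qed

lemma dout_sum:
  assumes \<phi>: "psh_wd \<phi>" and \<psi>: "psh_wd \<psi>"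
    and x: "x \<in> sec (hat (outp (wsrc \<phi>) +\<^sub>t outp (wsrc \<psi>))) l"
  shows "dout (wd_sum \<phi> \<psi>) l x = fam_join (outp (wtrg \<phi>)) (outp (wtrg \<psi>))
    (dout \<phi> l (left_part (outp (wsrc \<phi>)) x)) (dout \<psi> l (right_part (outp (wsrc \<psi>)) x))"
proof -
  have x': "x \<in> sec (hat (outp (wsrc (wd_sum \<phi> \<psi>)))) l" using x by simp
  show ?thesis
    by (rule hat_eqI[OF sec_dout[OF is_wd_sum[OF \<phi> \<psi>] x', simplified]
          fam_join_sec[OF sec_dout[OF \<phi> sec_parts(1)[OF x]] sec_dout[OF \<psi> sec_parts(2)[OF x]]]])
      (use fam_dout[OF x'] fam_dout[OF sec_parts(1)[OF x]] fam_dout[OF sec_parts(2)[OF x]]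
        wout_lab(1)[OF \<phi>] wout_lab(1)[OF \<psi>] in \<open>auto simp: wd_sum_win\<close>)
qed

section \<open>The cells of the algebra of machines\<close>

lemma Mch_simps [simp]:
  "fib Mch X = sl X" "act Mch = mch_act" "mu Mch = mch_mu" "eta Mch = mch_eta"
  by (simp_all add: Mch_def)

text \<open>The cells without \<open>let\<close> and tuple patterns: an arrow enters only through
  its ends and through \<open>ap\<close>, which the rules above can evaluate.\<close>

lemma Mch_cells:
  "actA Mch \<phi> f = mk_arr (mch_act \<phi> (fst f)) (mch_act \<phi> (fst (snd f))) (\<lambda>l u. Tup (tfst u) (ap f l (tsnd u)))"
  "muA Mch X Y f g = mk_arr (mch_mu X Y (fst f) (fst g)) (mch_mu X Y (fst (snd f)) (fst (snd g)))
     (\<lambda>l u. Tup (ap f l (tfst u)) (ap g l (tsnd u)))"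
  "fcmp Mch \<psi> \<phi> m = mk_arr (mch_act (wd_comp \<psi> \<phi>) m) (mch_act \<psi> (mch_act \<phi> m))
     (\<lambda>l u. Tup (Tup (tfst (tfst u)) (dout \<phi> l (tsnd (tfst u))))
       (Tup (Tup (din \<psi> l (tfst (tfst u)) (dout \<phi> l (tsnd (tfst u)))) (tsnd (tfst u))) (tsnd u)))"
  "fidn Mch X m = mk_arr (mch_act (idn IntW X) m) m (\<lambda>l u. tsnd u)"
  "muN Mch \<phi> \<psi> m n = mk_arr (mch_act (wd_sum \<phi> \<psi>) (mch_mu (wsrc \<phi>) (wsrc \<psi>) m n))
     (mch_mu (wtrg \<phi>) (wtrg \<psi>) (mch_act \<phi> m) (mch_act \<psi> n))
     (\<lambda>l u. Tup
       (Tup (Tup (left_part (inp (wtrg \<phi>)) (tfst (tfst u))) (left_part (outp (wsrc \<phi>)) (tsnd (tfst u)))) (tfst (tsnd u)))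
       (Tup (Tup (right_part (inp (wtrg \<psi>)) (tfst (tfst u))) (right_part (outp (wsrc \<psi>)) (tsnd (tfst u)))) (tsnd (tsnd u))))"
  "mu_assoc Mch X Y Z m n k = mk_arr
     (mch_act (assoc IntW X Y Z) (mch_mu (box_sum X Y) Z (mch_mu X Y m n) k))
     (mch_mu X (box_sum Y Z) m (mch_mu Y Z n k))
     (\<lambda>l u. Tup (tfst (tfst (tsnd u))) (Tup (tsnd (tfst (tsnd u))) (tsnd (tsnd u))))"
  "mu_lunit Mch X m = mk_arr (mch_act (lunit IntW X) (mch_mu box_empty X mch_eta m)) m (\<lambda>l u. tsnd (tsnd u))"
  "mu_runit Mch X m = mk_arr (mch_act (runit IntW X) (mch_mu X box_empty m mch_eta)) m (\<lambda>l u. tfst (tsnd u))"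
  "mu_braid Mch X Y m n = mk_arr (mch_act (braid IntW X Y) (mch_mu X Y m n)) (mch_mu Y X n m)
     (\<lambda>l u. Tup (tsnd (tsnd u)) (tfst (tsnd u)))"
  by (simp_all add: Mch_def case_prod_unfold Let_def din_def)

lemma hom_IntWD:
  assumes "\<phi> \<in> hom IntW X Y"
  shows "psh_wd \<phi>" "wsrc \<phi> = X" "wtrg \<phi> = Y" "psh_box X" "psh_box Y"
  using assms by (auto simp: hom_wiring is_wd_box)

lemma hom_sl_ends: "f \<in> hom (sl X) m n \<Longrightarrow> fst f = m" "f \<in> hom (sl X) m n \<Longrightarrow> fst (snd f) = n"
  by (drule hom_slD(3), metis fst_conv snd_conv)+

lemma mach_act:
  assumes "\<phi> \<in> hom IntW X Y" "mach X m"
  shows "mach Y (mch_act \<phi> m)"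
  using mach_mch_act[of \<phi> m] assms by (auto simp: hom_wiring)

lemma sec_act_cases:
  assumes "u \<in> sec (pdom (mch_act \<phi> m)) l" "\<phi> \<in> hom IntW X Y"
  obtains y x s where "u = Tup (Tup y x) s" "0 \<le> l" "y \<in> sec (hat (inp Y)) l" "x \<in> sec (hat (outp X)) l"
    "s \<in> sec (pdom m) l" "app m l s = Tup (din \<phi> l y x) x"
  using assms(1) by (rule sec_actE) (use that hom_IntWD[OF assms(2)] in auto)

lemma actA_hom:
  assumes \<phi>: "\<phi> \<in> hom IntW X Y" and f: "f \<in> hom (sl X) m n"
  shows "actA Mch \<phi> f \<in> hom (sl Y) (mch_act \<phi> m) (mch_act \<phi> n)"
proof -
  note f' = hom_slD[OF f]
  note p = hom_IntWD[OF \<phi>]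
  have mn: "mach (wsrc \<phi>) m" "mach (wsrc \<phi>) n" using f' p by simp_all
  have "mk_arr (mch_act \<phi> m) (mch_act \<phi> n) (\<lambda>l u. Tup (tfst u) (ap f l (tsnd u)))
      \<in> hom (sl Y) (mch_act \<phi> m) (mch_act \<phi> n)"
  proof (rule mk_arr_hom[OF mach_act[OF \<phi> f'(1)] mach_act[OF \<phi> f'(2)]])
    fix l u assume "u \<in> sec (pdom (mch_act \<phi> m)) l"
    then obtain y x s where u: "u = Tup (Tup y x) s" "Tup (Tup y x) s \<in> sec (pdom (mch_act \<phi> m)) l"
      "s \<in> sec (pdom m) l" by (metis sec_actE)
    then have v: "Tup (Tup y x) (ap f l s) \<in> sec (pdom (mch_act \<phi> n)) l"
      using f'(7,8) by (auto simp: sec_act[OF mn(1)] sec_act[OF mn(2)])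
    show "Tup (tfst u) (ap f l (tsnd u)) \<in> sec (pdom (mch_act \<phi> n)) l" using v u by simp
    show "app (mch_act \<phi> n) l (Tup (tfst u) (ap f l (tsnd u))) = app (mch_act \<phi> m) l u"
      using u by (simp add: app_act[OF v] app_act[OF u(2)])
    fix l' p :: real assume l: "0 \<le> l'" "0 \<le> p" "l' + p \<le> l"
    show "Tup (tfst (res (pdom (mch_act \<phi> m)) (l', p, l) u)) (ap f l' (tsnd (res (pdom (mch_act \<phi> m)) (l', p, l) u))) =
        res (pdom (mch_act \<phi> n)) (l', p, l) (Tup (tfst u) (ap f l (tsnd u)))"
      using u l by (simp add: res_act[OF v] res_act[OF u(2)] f'(9))
  qed
  then show ?thesis by (simp add: Mch_cells(1) hom_sl_ends[OF f])
qed

lemma muA_hom: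
  assumes X: "psh_box X" and Y: "psh_box Y" and f: "f \<in> hom (sl X) m m'" and g: "g \<in> hom (sl Y) n n'"
  shows "muA Mch X Y f g \<in> hom (sl (box_sum X Y)) (mch_mu X Y m n) (mch_mu X Y m' n')"
proof -
  note f' = hom_slD[OF f] and g' = hom_slD[OF g]
  have "mk_arr (mch_mu X Y m n) (mch_mu X Y m' n') (\<lambda>l u. Tup (ap f l (tfst u)) (ap g l (tsnd u)))
      \<in> hom (sl (box_sum X Y)) (mch_mu X Y m n) (mch_mu X Y m' n')"
  proof (rule mk_arr_hom[OF mach_mu[OF X Y f'(1) g'(1)] mach_mu[OF X Y f'(2) g'(2)]])
    fix l u assume "u \<in> sec (pdom (mch_mu X Y m n)) l"
    then obtain s t where u: "u = Tup s t" "0 \<le> l" "s \<in> sec (pdom m) l" "t \<in> sec (pdom n) l"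
      by (auto elim: sec_prodE)
    show "Tup (ap f l (tfst u)) (ap g l (tsnd u)) \<in> sec (pdom (mch_mu X Y m' n')) l"
      using u f'(7) g'(7) by simp
    obtain a b where ab: "app m l s = Tup a b" using mach_app[OF f'(1) u(3)] by blast
    obtain c d where cd: "app n l t = Tup c d" using mach_app[OF g'(1) u(4)] by blast
    have "app m' l (ap f l s) = Tup a b" "app n' l (ap g l t) = Tup c d"
      using f'(8)[OF u(3)] g'(8)[OF u(4)] ab cd by simp_all
    then show "app (mch_mu X Y m' n') l (Tup (ap f l (tfst u)) (ap g l (tsnd u))) = app (mch_mu X Y m n) l u"
      using app_mu[OF f'(1) g'(1) u(3,4) ab cd] app_mu[OF f'(2) g'(2) f'(7)[OF u(3)] g'(7)[OF u(4)]] u(1) by simp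
    fix l' p :: real assume l: "0 \<le> l'" "0 \<le> p" "l' + p \<le> l"
    show "Tup (ap f l' (tfst (res (pdom (mch_mu X Y m n)) (l', p, l) u)))
        (ap g l' (tsnd (res (pdom (mch_mu X Y m n)) (l', p, l) u))) =
      res (pdom (mch_mu X Y m' n')) (l', p, l) (Tup (ap f l (tfst u)) (ap g l (tsnd u)))"
      using u l f'(7,9) g'(7,9) by simp
  qed
  then show ?thesis by (simp add: Mch_cells(2) hom_sl_ends[OF f] hom_sl_ends[OF g])
qed

text \<open>An iterated state differs from a state over the composite only by a record of the middle
  interface, and the two pullback conditions determine that record from the outer input and the
  inner output.\<close>

lemma fcmp_iso:
  assumes \<phi>: "\<phi> \<in> hom IntW X Y" and \<psi>: "\<psi> \<in> hom IntW Y Z" and m: "mach X m"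
  shows "fcmp Mch \<psi> \<phi> m \<in> isos (sl Z) (mch_act (wd_comp \<psi> \<phi>) m) (mch_act \<psi> (mch_act \<phi> m))"
proof -
  note p = hom_IntWD[OF \<phi>] and q = hom_IntWD[OF \<psi>]
  have \<psi>\<phi>: "wd_comp \<psi> \<phi> \<in> hom IntW X Z" using p q by (simp add: hom_wiring is_wd_comp)
  note pq = hom_IntWD[OF \<psi>\<phi>]
  have eq: "wtrg \<phi> = wsrc \<psi>" using p q by simp
  note am = mach_act[OF \<phi> m]
  have M: "mach (wsrc \<phi>) m" "mach (wsrc (wd_comp \<psi> \<phi>)) m" "mach (wsrc \<psi>) (mch_act \<phi> m)"
    using m am p q by simp_all
  let ?f = "\<lambda>l u. Tup (Tup (tfst (tfst u)) (dout \<phi> l (tsnd (tfst u))))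
       (Tup (Tup (din \<psi> l (tfst (tfst u)) (dout \<phi> l (tsnd (tfst u)))) (tsnd (tfst u))) (tsnd u))"
  have key: "?f l (Tup (Tup z x) s) \<in> sec (pdom (mch_act \<psi> (mch_act \<phi> m))) l \<and>
      Tup (Tup (din \<psi> l z (dout \<phi> l x)) x) s \<in> sec (pdom (mch_act \<phi> m)) l"
    if "Tup (Tup z x) s \<in> sec (pdom (mch_act (wd_comp \<psi> \<phi>) m)) l" for l z x s
  proof -
    have u: "0 \<le> l" "z \<in> sec (hat (inp Z)) l" "x \<in> sec (hat (outp X)) l" "s \<in> sec (pdom m) l"
      "app m l s = Tup (din (wd_comp \<psi> \<phi>) l z x) x"
      using that p(2,3) q(2,3) by (auto simp: sec_act[OF M(2)])
    have y: "dout \<phi> l x \<in> sec (hat (outp Y)) l" using sec_dout[OF p(1), of x l] u p by simp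
    have w: "din \<psi> l z (dout \<phi> l x) \<in> sec (hat (inp Y)) l" using sec_din[OF q(1), of z l] u y q by simp
    have "app m l s = Tup (din \<phi> l (din \<psi> l z (dout \<phi> l x)) x) x"
      using din_comp[OF p(1) q(1) eq, of z l x] u p q by simp
    then have i: "Tup (Tup (din \<psi> l z (dout \<phi> l x)) x) s \<in> sec (pdom (mch_act \<phi> m)) l"
      using u w p by (simp add: sec_act[OF M(1)])
    then show ?thesis
      using u y q by (simp add: sec_act[OF M(3)] app_act)
  qed
  have hom: "mk_arr (mch_act (wd_comp \<psi> \<phi>) m) (mch_act \<psi> (mch_act \<phi> m)) ?f \<in>
      hom (sl Z) (mch_act (wd_comp \<psi> \<phi>) m) (mch_act \<psi> (mch_act \<phi> m))"
  proof (rule mk_arr_hom[OF mach_act[OF \<psi>\<phi> m] mach_act[OF \<psi> am]])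
    fix l u assume u: "u \<in> sec (pdom (mch_act (wd_comp \<psi> \<phi>) m)) l"
    obtain z x s where u': "u = Tup (Tup z x) s" "z \<in> sec (hat (inp Z)) l" "x \<in> sec (hat (outp X)) l" "s \<in> sec (pdom m) l"
      using sec_act_cases[OF u \<psi>\<phi>] by blast
    have k: "?f l u \<in> sec (pdom (mch_act \<psi> (mch_act \<phi> m))) l"
       "Tup (Tup (din \<psi> l z (dout \<phi> l x)) x) s \<in> sec (pdom (mch_act \<phi> m)) l"
      using key[of z x s l] u u'(1) by blast+
    show "?f l u \<in> sec (pdom (mch_act \<psi> (mch_act \<phi> m))) l" by (rule k(1))
    show "app (mch_act \<psi> (mch_act \<phi> m)) l (?f l u) = app (mch_act (wd_comp \<psi> \<phi>) m) l u"
      using app_act k(1) u u' p q dout_comp[OF p(1) q(1) eq, of x l] by (simp add: app_act)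
    fix l' r :: real assume l: "0 \<le> l'" "0 \<le> r" "l' + r \<le> l"
    have y: "dout \<phi> l x \<in> sec (hat (outp Y)) l" using sec_dout[OF p(1), of x l] u' p by simp
    have "dout \<phi> l' (res (hat (outp X)) (l', r, l) x) = res (hat (outp Y)) (l', r, l) (dout \<phi> l x)"
      using dout_res[OF p(1), of x l] u' l p by simp
    moreover have "din \<psi> l' (res (hat (inp Z)) (l', r, l) z) (res (hat (outp Y)) (l', r, l) (dout \<phi> l x)) =
        res (hat (inp Y)) (l', r, l) (din \<psi> l z (dout \<phi> l x))"
      using din_res[OF q(1), of z l "dout \<phi> l x"] u' l y q by simp
    ultimately show "?f l' (res (pdom (mch_act (wd_comp \<psi> \<phi>) m)) (l', r, l) u) =
        res (pdom (mch_act \<psi> (mch_act \<phi> m))) (l', r, l) (?f l u)"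
      using k u l p q unfolding u'(1) by (simp add: res_act)
  qed
  show ?thesis unfolding Mch_cells
  proof (rule mk_arr_iso[OF hom])
    fix l u v assume "u \<in> sec (pdom (mch_act (wd_comp \<psi> \<phi>) m)) l" "v \<in> sec (pdom (mch_act (wd_comp \<psi> \<phi>) m)) l"
      "?f l u = ?f l v"
    then show "u = v" by (elim sec_actE) simp
  next
    fix l w assume w: "w \<in> sec (pdom (mch_act \<psi> (mch_act \<phi> m))) l"
    obtain z y v where w': "w = Tup (Tup z y) v" "0 \<le> l" "z \<in> sec (hat (inp Z)) l" "y \<in> sec (hat (outp Y)) l"
      "v \<in> sec (pdom (mch_act \<phi> m)) l" "app (mch_act \<phi> m) l v = Tup (din \<psi> l z y) y"
      using sec_act_cases[OF w \<psi>] by blast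
    obtain b x s where v: "v = Tup (Tup b x) s" "b \<in> sec (hat (inp Y)) l" "x \<in> sec (hat (outp X)) l"
      "s \<in> sec (pdom m) l" "app m l s = Tup (din \<phi> l b x) x"
      using sec_act_cases[OF w'(5) \<phi>] by blast
    \<comment> \<open>The pullback condition of the outer action compares the wired inputs and
      outputs with the interface value of \<open>v\<close>, which yields both middle
      coordinates.\<close>
    have e: "b = din \<psi> l z y" "dout \<phi> l x = y" using w'(5,6) v(1) by (auto simp: app_act)
    have "Tup (Tup z x) s \<in> sec (pdom (mch_act (wd_comp \<psi> \<phi>) m)) l"
      using din_comp[OF p(1) q(1) eq, of z l x] w' v e p q by (simp add: sec_act[OF M(2)])
    then show "\<exists>u \<in> sec (pdom (mch_act (wd_comp \<psi> \<phi>) m)) l. ?f l u = w"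
      by (rule bexI[rotated]) (simp add: w' v e)
  qed
qed

text \<open>Both sides hold the same data, with interface values joined over the disjoint union on
  one side and kept apart on the other. The substance is that the pullback conditions correspond, by
  \<open>din_sum\<close> and injectivity of joining.\<close>

lemma muN_iso:
  assumes \<phi>: "\<phi> \<in> hom IntW X Y" and \<psi>: "\<psi> \<in> hom IntW X' Y'" and m: "mach X m" and n: "mach X' n"
  shows "muN Mch \<phi> \<psi> m n \<in> isos (sl (box_sum Y Y')) (mch_act (wd_sum \<phi> \<psi>) (mch_mu X X' m n))
    (mch_mu Y Y' (mch_act \<phi> m) (mch_act \<psi> n))"
proof -
  note p = hom_IntWD[OF \<phi>] and q = hom_IntWD[OF \<psi>]
  have s: "wd_sum \<phi> \<psi> \<in> hom IntW (box_sum X X') (box_sum Y Y')" using p q by (simp add: hom_wiring is_wd_sum)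
  note am = mach_act[OF \<phi> m] and an = mach_act[OF \<psi> n]
  note mn = mach_mu[OF p(4) q(4) m n]
  have M: "mach (wsrc \<phi>) m" "mach (wsrc \<psi>) n" "mach (wsrc (wd_sum \<phi> \<psi>)) (mch_mu X X' m n)"
    using m n mn p q by simp_all
  let ?A = "mch_act (wd_sum \<phi> \<psi>) (mch_mu X X' m n)" and ?B = "mch_mu Y Y' (mch_act \<phi> m) (mch_act \<psi> n)"
  let ?f = "\<lambda>(l :: real) u. Tup
       (Tup (Tup (left_part (inp Y) (tfst (tfst u))) (left_part (outp X) (tsnd (tfst u)))) (tfst (tsnd u)))
       (Tup (Tup (right_part (inp Y') (tfst (tfst u))) (right_part (outp X') (tsnd (tfst u)))) (tsnd (tsnd u)))"
  have key: "Tup (Tup (left_part (inp Y) y) (left_part (outp X) x)) s \<in> sec (pdom (mch_act \<phi> m)) l \<and>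
      Tup (Tup (right_part (inp Y') y) (right_part (outp X') x)) t \<in> sec (pdom (mch_act \<psi> n)) l"
    if "Tup (Tup y x) (Tup s t) \<in> sec (pdom ?A) l" for l y x s t
  proof -
    have u: "0 \<le> l" "y \<in> sec (hat (inp Y +\<^sub>t inp Y')) l" "x \<in> sec (hat (outp X +\<^sub>t outp X')) l" "s \<in> sec (pdom m) l"
      "t \<in> sec (pdom n) l" "app (mch_mu X X' m n) l (Tup s t) = Tup (din (wd_sum \<phi> \<psi>) l y x) x"
      using that p(2,3) q(2,3) by (auto simp: sec_act[OF M(3)])
    obtain a b where ab: "app m l s = Tup a b" "a \<in> sec (hat (inp X)) l" "b \<in> sec (hat (outp X)) l"
      using mach_app[OF m u(4)] by blast
    obtain c d where cd: "app n l t = Tup c d" "c \<in> sec (hat (inp X')) l" "d \<in> sec (hat (outp X')) l"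
      using mach_app[OF n u(5)] by blast
    note yp = sec_parts[OF u(2)] and xp = sec_parts[OF u(3)]
    have e: "Tup (fam_join (inp X) (inp X') a c) (fam_join (outp X) (outp X') b d) = Tup (din (wd_sum \<phi> \<psi>) l y x) x"
      using app_mu[OF m n u(4,5) ab(1) cd(1)] u(6) by (rule trans[OF sym])
    have "din (wd_sum \<phi> \<psi>) l y x = fam_join (inp X) (inp X')
        (din \<phi> l (left_part (inp Y) y) (left_part (outp X) x)) (din \<psi> l (right_part (inp Y') y) (right_part (outp X') x))"
      using din_sum[OF p(1) q(1), of y l x] u(2,3) p(2,3) q(2,3) by simp
    then have j: "fam_join (inp X) (inp X') a c = fam_join (inp X) (inp X')
        (din \<phi> l (left_part (inp Y) y) (left_part (outp X) x)) (din \<psi> l (right_part (inp Y') y) (right_part (outp X') x))"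
      and x: "fam_join (outp X) (outp X') b d = x"
      using e by (metis univ.inject(2), blast)
    have d: "din \<phi> l (left_part (inp Y) y) (left_part (outp X) x) \<in> sec (hat (inp X)) l"
      "din \<psi> l (right_part (inp Y') y) (right_part (outp X') x) \<in> sec (hat (inp X')) l"
      using sec_din[OF p(1), of _ l] sec_din[OF q(1), of _ l] yp xp p q by simp_all
    \<comment> \<open>Taking parts undoes joining, so the joint pullback condition splits into one
      for each machine.\<close>
    have "a = din \<phi> l (left_part (inp Y) y) (left_part (outp X) x)"
      "c = din \<psi> l (right_part (inp Y') y) (right_part (outp X') x)"
      using arg_cong[OF j, of "left_part (inp X)"] arg_cong[OF j, of "right_part (inp X')"]
      unfolding parts_join[OF ab(2) cd(2)] parts_join[OF d] .
    moreover have "b = left_part (outp X) x" "d = right_part (outp X') x"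
      using parts_join[OF ab(3) cd(3)] x by simp_all
    ultimately show ?thesis
      using u yp xp ab cd p q by (simp add: sec_act[OF M(1)] sec_act[OF M(2)])
  qed
  have elim: "\<exists>y x s t. u = Tup (Tup y x) (Tup s t) \<and> y \<in> sec (hat (inp Y +\<^sub>t inp Y')) l \<and>
      x \<in> sec (hat (outp X +\<^sub>t outp X')) l \<and> s \<in> sec (pdom m) l \<and> t \<in> sec (pdom n) l \<and> 0 \<le> l"
    if "u \<in> sec (pdom ?A) l" for u l
    by (rule sec_act_cases[OF that s]) (auto elim!: sec_prodE)
  have hom: "mk_arr ?A ?B ?f \<in> hom (sl (box_sum Y Y')) ?A ?B"
  proof (rule mk_arr_hom[OF mach_act[OF s mn] mach_mu[OF p(5) q(5) am an]])
    fix l u assume u: "u \<in> sec (pdom ?A) l"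
    obtain y x s t where u': "u = Tup (Tup y x) (Tup s t)" "y \<in> sec (hat (inp Y +\<^sub>t inp Y')) l"
      "x \<in> sec (hat (outp X +\<^sub>t outp X')) l" "s \<in> sec (pdom m) l" "t \<in> sec (pdom n) l" "0 \<le> l"
      using elim[OF u] by blast
    note k = key[OF u[unfolded u'(1)], THEN conjunct1] key[OF u[unfolded u'(1)], THEN conjunct2]
    show "?f l u \<in> sec (pdom ?B) l" using k u' by simp
    show "app ?B l (?f l u) = app ?A l u"
      using app_mu[OF am an k app_act[OF k(1)] app_act[OF k(2)]] join_parts[OF u'(2)] u u'
        dout_sum[OF p(1) q(1), of x l] p q by (simp add: app_act)
    fix l' r :: real assume l: "0 \<le> l'" "0 \<le> r" "l' + r \<le> l"
    show "?f l' (res (pdom ?A) (l', r, l) u) = res (pdom ?B) (l', r, l) (?f l u)"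
      using u k l u'(2-) p q unfolding u'(1)
      by (simp add: res_act res_parts psh_box_tfs)
  qed
  have "mk_arr ?A ?B ?f \<in> isos (sl (box_sum Y Y')) ?A ?B"
  proof (rule mk_arr_iso[OF hom])
    fix l u v assume u: "u \<in> sec (pdom ?A) l" and v: "v \<in> sec (pdom ?A) l" and eq: "?f l u = ?f l v"
    obtain y x s t where u': "u = Tup (Tup y x) (Tup s t)" "y \<in> sec (hat (inp Y +\<^sub>t inp Y')) l"
      "x \<in> sec (hat (outp X +\<^sub>t outp X')) l" using elim[OF u] by blast
    obtain y' x' s' t' where v': "v = Tup (Tup y' x') (Tup s' t')" "y' \<in> sec (hat (inp Y +\<^sub>t inp Y')) l"
      "x' \<in> sec (hat (outp X +\<^sub>t outp X')) l" using elim[OF v] by blast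
    have e: "left_part (inp Y) y = left_part (inp Y) y'" "right_part (inp Y') y = right_part (inp Y') y'"
      "left_part (outp X) x = left_part (outp X) x'" "right_part (outp X') x = right_part (outp X') x'"
      "s = s'" "t = t'" using eq unfolding u'(1) v'(1) by simp_all
    have "y = y'" using join_parts[OF u'(2), unfolded e] join_parts[OF v'(2)] by (rule trans[OF sym])
    moreover have "x = x'" using join_parts[OF u'(3), unfolded e] join_parts[OF v'(3)] by (rule trans[OF sym])
    ultimately show "u = v" unfolding u'(1) v'(1) e by simp
  next
    fix l w assume w: "w \<in> sec (pdom ?B) l"
    then obtain v v' where vv: "w = Tup v v'" "0 \<le> l" "v \<in> sec (pdom (mch_act \<phi> m)) l" "v' \<in> sec (pdom (mch_act \<psi> n)) l"
      by (auto elim: sec_prodE)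
    obtain y x s where v: "v = Tup (Tup y x) s" "y \<in> sec (hat (inp Y)) l" "x \<in> sec (hat (outp X)) l"
      "s \<in> sec (pdom m) l" "app m l s = Tup (din \<phi> l y x) x" using sec_act_cases[OF vv(3) \<phi>] by blast
    obtain y' x' s' where v': "v' = Tup (Tup y' x') s'" "y' \<in> sec (hat (inp Y')) l" "x' \<in> sec (hat (outp X')) l"
      "s' \<in> sec (pdom n) l" "app n l s' = Tup (din \<psi> l y' x') x'" using sec_act_cases[OF vv(4) \<psi>] by blast
    let ?y = "fam_join (inp Y) (inp Y') y y'" and ?x = "fam_join (outp X) (outp X') x x'"
    have yx: "?y \<in> sec (hat (inp Y +\<^sub>t inp Y')) l" "?x \<in> sec (hat (outp X +\<^sub>t outp X')) l"
      using v v' by (simp_all add: fam_join_sec)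
    have "din (wd_sum \<phi> \<psi>) l ?y ?x = fam_join (inp X) (inp X') (din \<phi> l y x) (din \<psi> l y' x')"
      using din_sum[OF p(1) q(1), of ?y l ?x] yx p q parts_join[OF v(2) v'(2)] parts_join[OF v(3) v'(3)] by simp
    then have "Tup (Tup ?y ?x) (Tup s s') \<in> sec (pdom ?A) l"
      using app_mu[OF m n v(4) v'(4) v(5) v'(5)] vv yx v v' p q by (simp add: sec_act[OF M(3)])
    then show "\<exists>u \<in> sec (pdom ?A) l. ?f l u = w"
      by (rule bexI[rotated]) (simp add: vv v v' parts_join[OF v(2) v'(2)] parts_join[OF v(3) v'(3)])
  qed
  then show ?thesis using p q by (simp add: Mch_cells)
qed

lemma sec_hat_restrict: "u \<in> sec (hat A) l \<Longrightarrow> Fam (\<lambda>x \<in> lab A. fam u x) = u"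
  by (simp add: sec_hat)

text \<open>For the associator and the braiding, the inverse label function on inputs coincides with
  the label function on outputs. One identity per cell therefore treats both components of the
  interface.\<close>

lemma join_relabel:
  "Fam (\<lambda>j \<in> lab (A +\<^sub>t (B +\<^sub>t C)). fam (fam_join (A +\<^sub>t B) C (fam_join A B a b) c)
      (lcase (InL \<circ> InL) (lcase (InL \<circ> InR) InR) j)) = fam_join A (B +\<^sub>t C) a (fam_join B C b c)"
  "Fam (\<lambda>j \<in> lab (B +\<^sub>t A). fam (fam_join A B a b) (lcase InR InL j)) = fam_join B A b a"
  by (auto simp: fam_join_def intro!: restrict_ext)

lemma join_unit:
  assumes "a \<in> sec (hat A) l"
  shows "Fam (\<lambda>j \<in> lab A. fam (fam_join tfs_empty A e a) (InR j)) = a"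
    "Fam (\<lambda>j \<in> lab A. fam (fam_join A tfs_empty a e) (InL j)) = a"
  using sec_hat_restrict[OF assms] by (simp_all cong: restrict_cong)

lemma IntW_symmetric_monoidal: "symmetric_monoidal IntW"
  by (rule wiring_symmetric_monoidal)

lemma IntW_structure:
  "psh_box X \<Longrightarrow> idn IntW X \<in> hom IntW X X"
  "psh_box X \<Longrightarrow> psh_box Y \<Longrightarrow> psh_box Z \<Longrightarrow> assoc IntW X Y Z \<in>
    hom IntW (box_sum (box_sum X Y) Z) (box_sum X (box_sum Y Z))"
  "psh_box X \<Longrightarrow> lunit IntW X \<in> hom IntW (box_sum box_empty X) X"
  "psh_box X \<Longrightarrow> runit IntW X \<in> hom IntW (box_sum X box_empty) X"
  "psh_box X \<Longrightarrow> psh_box Y \<Longrightarrow> braid IntW X Y \<in> hom IntW (box_sum X Y) (box_sum Y X)"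
proof -
  interpret symmetric_monoidal "IntW :: ('a psh box, 'a psh wd) smcat" by (rule IntW_symmetric_monoidal)
  show "psh_box X \<Longrightarrow> idn IntW X \<in> hom IntW X X" using idn_hom[of X] by simp
  show "psh_box X \<Longrightarrow> psh_box Y \<Longrightarrow> psh_box Z \<Longrightarrow> assoc IntW X Y Z \<in>
      hom IntW (box_sum (box_sum X Y) Z) (box_sum X (box_sum Y Z))" using assoc_iso[THEN isos_hom, of X Y Z] by simp
  show "psh_box X \<Longrightarrow> lunit IntW X \<in> hom IntW (box_sum box_empty X) X" using lunit_iso[THEN isos_hom, of X] by simp
  show "psh_box X \<Longrightarrow> runit IntW X \<in> hom IntW (box_sum X box_empty) X" using runit_iso[THEN isos_hom, of X] by simp
  show "psh_box X \<Longrightarrow> psh_box Y \<Longrightarrow> braid IntW X Y \<in> hom IntW (box_sum X Y) (box_sum Y X)"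
    using braid_hom[of X Y] by simp
qed

lemma fidn_iso:
  assumes X: "psh_box X" and m: "mach X m"
  shows "fidn Mch X m \<in> isos (sl X) (mch_act (idn IntW X) m) m"
  unfolding Mch_cells wiring_cells
proof (rule relabel_act_iso[where g' = id and r = "\<lambda>s. s"])
  show "psh_wd (relabel X X id id)" using hom_IntWD(1)[OF IntW_structure(1)[OF X]] by (simp add: wiring_cells)
qed (use m in \<open>auto simp: sec_hat_restrict\<close>)

lemma mu_assoc_iso:
  assumes X: "psh_box X" and Y: "psh_box Y" and Z: "psh_box Z" and m: "mach X m" and n: "mach Y n" and k: "mach Z k"
  shows "mu_assoc Mch X Y Z m n k \<in> isos (sl (box_sum X (box_sum Y Z)))
    (mch_act (assoc IntW X Y Z) (mch_mu (box_sum X Y) Z (mch_mu X Y m n) k))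
    (mch_mu X (box_sum Y Z) m (mch_mu Y Z n k))"
proof -
  note mn = mach_mu[OF X Y m n] and nk = mach_mu[OF Y Z n k]
  note XY = is_box_sum[OF X Y] and YZ = is_box_sum[OF Y Z]
  show ?thesis
    unfolding Mch_cells wiring_cells
  proof (rule relabel_act_iso[where g' = "lcase (InL \<circ> InL) (lcase (InL \<circ> InR) InR)"
        and r = "\<lambda>u. Tup (tfst (tfst u)) (Tup (tsnd (tfst u)) (tsnd u))"])
    show "psh_wd (relabel (box_sum (box_sum X Y) Z) (box_sum X (box_sum Y Z))
        (lcase (lcase InL (InR \<circ> InL)) (InR \<circ> InR)) (lcase (InL \<circ> InL) (lcase (InL \<circ> InR) InR)))"
      using hom_IntWD(1)[OF IntW_structure(2)[OF X Y Z]] by (simp add: wiring_cells)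
    show "mach (box_sum (box_sum X Y) Z) (mch_mu (box_sum X Y) Z (mch_mu X Y m n) k)"
      by (rule mach_mu[OF XY Z mn k])
    show "mach (box_sum X (box_sum Y Z)) (mch_mu X (box_sum Y Z) m (mch_mu Y Z n k))"
      by (rule mach_mu[OF X YZ m nk])
  next
    fix l u a b assume u: "u \<in> sec (pdom (mch_mu (box_sum X Y) Z (mch_mu X Y m n) k)) l"
      and ab: "app (mch_mu (box_sum X Y) Z (mch_mu X Y m n) k) l u = Tup a b"
    obtain s t q where u': "u = Tup (Tup s t) q" "s \<in> sec (pdom m) l" "t \<in> sec (pdom n) l" "q \<in> sec (pdom k) l"
      using u by (auto elim!: sec_prodE)
    then have l: "0 \<le> l" using mach_sec_nonneg m by blast
    obtain a1 b1 where 1: "app m l s = Tup a1 b1" using mach_app[OF m u'(2)] by blast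
    obtain a2 b2 where 2: "app n l t = Tup a2 b2" using mach_app[OF n u'(3)] by blast
    obtain a3 b3 where 3: "app k l q = Tup a3 b3" using mach_app[OF k u'(4)] by blast
    note 12 = app_mu[OF m n u'(2,3) 1 2] and 23 = app_mu[OF n k u'(3,4) 2 3]
    have st: "Tup s t \<in> sec (pdom (mch_mu X Y m n)) l" "Tup t q \<in> sec (pdom (mch_mu Y Z n k)) l" using u' l by simp_all
    have "Tup a b = Tup (fam_join (inp X +\<^sub>t inp Y) (inp Z) (fam_join (inp X) (inp Y) a1 a2) a3)
       (fam_join (outp X +\<^sub>t outp Y) (outp Z) (fam_join (outp X) (outp Y) b1 b2) b3)"
      using app_mu[OF mn k st(1) u'(4) 12 3] ab u'(1) by simp
    then show "app (mch_mu X (box_sum Y Z) m (mch_mu Y Z n k)) l (Tup (tfst (tfst u)) (Tup (tsnd (tfst u)) (tsnd u))) =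
      Tup (Fam (\<lambda>j \<in> lab (inp (box_sum X (box_sum Y Z))). fam a (lcase (InL \<circ> InL) (lcase (InL \<circ> InR) InR) j)))
       (Fam (\<lambda>k \<in> lab (outp (box_sum X (box_sum Y Z))). fam b (lcase (InL \<circ> InL) (lcase (InL \<circ> InR) InR) k)))"
      using app_mu[OF m nk u'(2) st(2) 1 23] by (simp only: u'(1) box_sum_simps join_relabel univ.inject univ.sel)
  next
    fix l w assume "w \<in> sec (pdom (mch_mu X (box_sum Y Z) m (mch_mu Y Z n k))) l"
    then show "\<exists>s \<in> sec (pdom (mch_mu (box_sum X Y) Z (mch_mu X Y m n) k)) l.
        Tup (tfst (tfst s)) (Tup (tsnd (tfst s)) (tsnd s)) = w"
      by (intro bexI[of _ "Tup (Tup (tfst w) (tfst (tsnd w))) (tsnd (tsnd w))"]) (auto elim!: sec_prodE)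
  qed (auto elim!: sec_prodE)
qed

text \<open>The unit machine has exactly one state of each length, so projecting its state away is a
  bijection.\<close>

lemma mu_lunit_iso:
  assumes X: "psh_box X" and m: "mach X m"
  shows "mu_lunit Mch X m \<in> isos (sl X) (mch_act (lunit IntW X) (mch_mu box_empty X mch_eta m)) m"
  unfolding Mch_cells wiring_cells
proof (rule relabel_act_iso[where g' = InR and r = tsnd])
  show "psh_wd (relabel (box_sum box_empty X) X (lcase id id) InR)"
    using hom_IntWD(1)[OF IntW_structure(3)[OF X]] by (simp add: wiring_cells)
  show "mach (box_sum box_empty X) (mch_mu box_empty X mch_eta m)" by (rule mach_mu[OF is_box_empty X mach_eta m])
  fix l u a b assume u: "u \<in> sec (pdom (mch_mu box_empty X mch_eta m)) l" and
    ab: "app (mch_mu box_empty X mch_eta m) l u = Tup a b"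
  obtain e s where u': "u = Tup e s" "e \<in> sec (hat tfs_empty) l" "s \<in> sec (pdom m) l"
    using u by (auto elim: sec_prodE)
  obtain c d where cd: "app m l s = Tup c d" "c \<in> sec (hat (inp X)) l" "d \<in> sec (hat (outp X)) l"
    using mach_app[OF m u'(3)] by blast
  have e: "e \<in> sec (pdom mch_eta) l" "app mch_eta l e = Tup e e" using u'(2) by simp_all
  have "Tup a b = Tup (fam_join tfs_empty (inp X) e c) (fam_join tfs_empty (outp X) e d)"
    using app_mu[OF mach_eta m e(1) u'(3) e(2) cd(1)] ab u'(1) by simp
  then show "app m l (tsnd u) = Tup (Fam (\<lambda>j \<in> lab (inp X). fam a (InR j))) (Fam (\<lambda>k \<in> lab (outp X). fam b (InR k)))"
    using cd by (simp add: u'(1) join_unit[OF cd(2)] join_unit[OF cd(3)])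
next
  fix l w assume "w \<in> sec (pdom m) l"
  then show "\<exists>s \<in> sec (pdom (mch_mu box_empty X mch_eta m)) l. tsnd s = w"
    using mach_sec_nonneg[OF m] by (intro bexI[of _ "Tup (Fam (\<lambda>x. undefined)) w"]) (auto simp: sec_hat_empty)
qed (use m in \<open>auto elim!: sec_prodE simp: sec_hat_empty\<close>)

lemma mu_runit_iso:
  assumes X: "psh_box X" and m: "mach X m"
  shows "mu_runit Mch X m \<in> isos (sl X) (mch_act (runit IntW X) (mch_mu X box_empty m mch_eta)) m"
  unfolding Mch_cells wiring_cells
proof (rule relabel_act_iso[where g' = InL and r = tfst])
  show "psh_wd (relabel (box_sum X box_empty) X (lcase id id) InL)"
    using hom_IntWD(1)[OF IntW_structure(4)[OF X]] by (simp add: wiring_cells)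
  show "mach (box_sum X box_empty) (mch_mu X box_empty m mch_eta)" by (rule mach_mu[OF X is_box_empty m mach_eta])
  fix l u a b assume u: "u \<in> sec (pdom (mch_mu X box_empty m mch_eta)) l" and
    ab: "app (mch_mu X box_empty m mch_eta) l u = Tup a b"
  obtain e s where u': "u = Tup s e" "e \<in> sec (hat tfs_empty) l" "s \<in> sec (pdom m) l"
    using u by (auto elim: sec_prodE)
  obtain c d where cd: "app m l s = Tup c d" "c \<in> sec (hat (inp X)) l" "d \<in> sec (hat (outp X)) l"
    using mach_app[OF m u'(3)] by blast
  have e: "e \<in> sec (pdom mch_eta) l" "app mch_eta l e = Tup e e" using u'(2) by simp_all
  have "Tup a b = Tup (fam_join (inp X) tfs_empty c e) (fam_join (outp X) tfs_empty d e)"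
    using app_mu[OF m mach_eta u'(3) e(1) cd(1) e(2)] ab u'(1) by simp
  then show "app m l (tfst u) = Tup (Fam (\<lambda>j \<in> lab (inp X). fam a (InL j))) (Fam (\<lambda>k \<in> lab (outp X). fam b (InL k)))"
    using cd by (simp add: u'(1) join_unit[OF cd(2)] join_unit[OF cd(3)])
next
  fix l w assume "w \<in> sec (pdom m) l"
  then show "\<exists>s \<in> sec (pdom (mch_mu X box_empty m mch_eta)) l. tfst s = w"
    using mach_sec_nonneg[OF m] by (intro bexI[of _ "Tup w (Fam (\<lambda>x. undefined))"]) (auto simp: sec_hat_empty)
qed (use m in \<open>auto elim!: sec_prodE simp: sec_hat_empty\<close>)

lemma mu_braid_iso:
  assumes X: "psh_box X" and Y: "psh_box Y" and m: "mach X m" and n: "mach Y n"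
  shows "mu_braid Mch X Y m n \<in> isos (sl (box_sum Y X)) (mch_act (braid IntW X Y) (mch_mu X Y m n)) (mch_mu Y X n m)"
  unfolding Mch_cells wiring_cells
proof (rule relabel_act_iso[where g' = "lcase InR InL" and r = "\<lambda>u. Tup (tsnd u) (tfst u)"])
  show "psh_wd (relabel (box_sum X Y) (box_sum Y X) (lcase InR InL) (lcase InR InL))"
    using hom_IntWD(1)[OF IntW_structure(5)[OF X Y]] by (simp add: wiring_cells)
  show "mach (box_sum X Y) (mch_mu X Y m n)" by (rule mach_mu[OF X Y m n])
  show "mach (box_sum Y X) (mch_mu Y X n m)" by (rule mach_mu[OF Y X n m])
  fix l u a b assume u: "u \<in> sec (pdom (mch_mu X Y m n)) l" and ab: "app (mch_mu X Y m n) l u = Tup a b"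
  obtain s t where u': "u = Tup s t" "s \<in> sec (pdom m) l" "t \<in> sec (pdom n) l"
    using u by (auto elim: sec_prodE)
  obtain a1 b1 where 1: "app m l s = Tup a1 b1" using mach_app[OF m u'(2)] by blast
  obtain a2 b2 where 2: "app n l t = Tup a2 b2" using mach_app[OF n u'(3)] by blast
  have "Tup a b = Tup (fam_join (inp X) (inp Y) a1 a2) (fam_join (outp X) (outp Y) b1 b2)"
    using app_mu[OF m n u'(2,3) 1 2] ab u'(1) by simp
  then show "app (mch_mu Y X n m) l (Tup (tsnd u) (tfst u)) =
      Tup (Fam (\<lambda>j \<in> lab (inp (box_sum Y X)). fam a (lcase InR InL j)))
        (Fam (\<lambda>k \<in> lab (outp (box_sum Y X)). fam b (lcase InR InL k)))"
    using app_mu[OF n m u'(3,2) 2 1] by (simp only: u'(1) box_sum_simps join_relabel univ.inject univ.sel)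
next
  fix l w assume "w \<in> sec (pdom (mch_mu Y X n m)) l"
  then show "\<exists>s \<in> sec (pdom (mch_mu X Y m n)) l. Tup (tsnd s) (tfst s) = w"
    by (intro bexI[of _ "Tup (tsnd w) (tfst w)"]) (auto elim!: sec_prodE)
qed (auto elim!: sec_prodE)

section \<open>Tracking states through structure cells\<close>

text \<open>A core is a view of structured states. Those built below drop the interface values
  recorded by each \<open>mch_act\<close> and keep the tuple of states of the machines
  involved.\<close>

type_synonym 'a core = "real \<Rightarrow> 'a univ \<Rightarrow> 'a univ"

definition core_id :: "'a core" where "core_id = (\<lambda>l u. u)"
definition core_act :: "'a core \<Rightarrow> 'a core" where "core_act c = (\<lambda>l u. c l (tsnd u))"
definition core_mu :: "'a core \<Rightarrow> 'a core \<Rightarrow> 'a core" where "core_mu c d = (\<lambda>l u. Tup (c l (tfst u)) (d l (tsnd u)))"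
text \<open>Views the source of an arrow through its target. Seen this way an arbitrary arrow acts
  as the identity, which lets naturality axioms be treated like coherence axioms.\<close>

definition core_pre :: "'b \<times> 'c \<times> 'a pmap \<Rightarrow> 'a core \<Rightarrow> 'a core" where "core_pre f d = (\<lambda>l u. d l (ap f l u))"

lemmas core_defs = core_id_def core_act_def core_mu_def core_pre_def

text \<open>
  The underlying state must fix the output by itself: an outer box need not expose the outputs of
  the inner one, yet with feedback these are needed to recover the inner inputs.
\<close>

definition detects :: "'a pmap \<Rightarrow> 'a core \<Rightarrow> bool" where
  "detects A d \<longleftrightarrow> (\<forall>l. \<forall>u \<in> sec (pdom A) l. \<forall>v \<in> sec (pdom A) l. d l u = d l v \<longrightarrow>
     tsnd (app A l u) = tsnd (app A l v) \<and> (tfst (app A l u) = tfst (app A l v) \<longrightarrow> u = v))"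

text \<open>The arrow \<open>f : A \<rightarrow> B\<close> acts as \<open>r\<close> on states viewed through \<open>c\<close> and \<open>d\<close>.\<close>

definition tracks :: "'a psh box \<Rightarrow> 'a pmap \<times> 'a pmap \<times> 'a pmap \<Rightarrow> 'a pmap \<Rightarrow> 'a core \<Rightarrow> 'a pmap \<Rightarrow> 'a core \<Rightarrow>
    ('a univ \<Rightarrow> 'a univ) \<Rightarrow> bool" where
  "tracks X f A c B d r \<longleftrightarrow> f \<in> hom (sl X) A B \<and> (\<forall>l. \<forall>u \<in> sec (pdom A) l. d l (ap f l u) = r (c l u))"

lemma detectsD:
  assumes "detects A d" "u \<in> sec (pdom A) l" "v \<in> sec (pdom A) l" "d l u = d l v"
  shows "tsnd (app A l u) = tsnd (app A l v)" "tfst (app A l u) = tfst (app A l v) \<Longrightarrow> u = v"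
  using assms unfolding detects_def by blast+

lemma detects_id: "detects A core_id"
  by (simp add: detects_def core_id_def)

text \<open>Equal cores give equal inner outputs, by the first clause for \<open>A\<close>. If the
  outer inputs agree too, so do the inner inputs, being computed from these two, and the second
  clause gives equal inner states.\<close>

lemma detects_act:
  assumes \<phi>: "\<phi> \<in> hom IntW X Y" and d: "detects A d"
  shows "detects (mch_act \<phi> A) (core_act d)"
  unfolding detects_def
proof (intro allI ballI impI)
  fix l u v assume u: "u \<in> sec (pdom (mch_act \<phi> A)) l" and v: "v \<in> sec (pdom (mch_act \<phi> A)) l"
    and eq: "core_act d l u = core_act d l v"
  obtain y x s where u': "u = Tup (Tup y x) s" "x \<in> sec (hat (outp X)) l" "s \<in> sec (pdom A) l"
    "app A l s = Tup (din \<phi> l y x) x" using sec_act_cases[OF u \<phi>] by blast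
  obtain y' x' s' where v': "v = Tup (Tup y' x') s'" "x' \<in> sec (hat (outp X)) l" "s' \<in> sec (pdom A) l"
    "app A l s' = Tup (din \<phi> l y' x') x'" using sec_act_cases[OF v \<phi>] by blast
  have ds: "d l s = d l s'" using eq by (simp add: core_act_def u'(1) v'(1))
  have x: "x = x'" using detectsD(1)[OF d u'(3) v'(3) ds] u'(4) v'(4) by simp
  have "s = s'" if "y = y'" using detectsD(2)[OF d u'(3) v'(3) ds] u'(4) v'(4) x that by simp
  moreover have "app (mch_act \<phi> A) l u = Tup y (dout \<phi> l x)" "app (mch_act \<phi> A) l v = Tup y' (dout \<phi> l x')"
    using u v unfolding u'(1) v'(1) by (simp_all only: app_act)
  ultimately show "tsnd (app (mch_act \<phi> A) l u) = tsnd (app (mch_act \<phi> A) l v) \<and>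
      (tfst (app (mch_act \<phi> A) l u) = tfst (app (mch_act \<phi> A) l v) \<longrightarrow> u = v)"
    using x by (simp add: u'(1) v'(1))
qed

text \<open>The hypothesis for each factor applies separately, because joining families is
  injective.\<close>

lemma detects_mu:
  assumes A: "mach X A" and B: "mach Y B" and c: "detects A c" and d: "detects B d"
  shows "detects (mch_mu X Y A B) (core_mu c d)"
  unfolding detects_def
proof (intro allI ballI impI)
  fix l u v assume "u \<in> sec (pdom (mch_mu X Y A B)) l" "v \<in> sec (pdom (mch_mu X Y A B)) l" and eq: "core_mu c d l u = core_mu c d l v"
  then obtain s t s' t' where u: "u = Tup s t" "s \<in> sec (pdom A) l" "t \<in> sec (pdom B) l"
    and v: "v = Tup s' t'" "s' \<in> sec (pdom A) l" "t' \<in> sec (pdom B) l"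
    by (auto elim!: sec_prodE)
  obtain a1 b1 where 1: "app A l s = Tup a1 b1" "a1 \<in> sec (hat (inp X)) l" "b1 \<in> sec (hat (outp X)) l"
    using mach_app[OF A u(2)] by blast
  obtain a2 b2 where 2: "app B l t = Tup a2 b2" "a2 \<in> sec (hat (inp Y)) l" "b2 \<in> sec (hat (outp Y)) l"
    using mach_app[OF B u(3)] by blast
  obtain a3 b3 where 3: "app A l s' = Tup a3 b3" "a3 \<in> sec (hat (inp X)) l" "b3 \<in> sec (hat (outp X)) l"
    using mach_app[OF A v(2)] by blast
  obtain a4 b4 where 4: "app B l t' = Tup a4 b4" "a4 \<in> sec (hat (inp Y)) l" "b4 \<in> sec (hat (outp Y)) l"
    using mach_app[OF B v(3)] by blast
  have ds: "c l s = c l s'" "d l t = d l t'" using eq by (simp_all add: core_mu_def u(1) v(1))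
  have b: "b1 = b3" "b2 = b4" 
    using detectsD(1)[OF c u(2) v(2) ds(1)] detectsD(1)[OF d u(3) v(3) ds(2)] 1(1) 2(1) 3(1) 4(1) by simp_all
  have st: "s = s'" if "a1 = a3" using detectsD(2)[OF c u(2) v(2) ds(1)] 1(1) 3(1) that by simp
  have tt: "t = t'" if "a2 = a4" using detectsD(2)[OF d u(3) v(3) ds(2)] 2(1) 4(1) that by simp
  have "a1 = a3 \<and> a2 = a4" if "fam_join (inp X) (inp Y) a1 a2 = fam_join (inp X) (inp Y) a3 a4"
    using arg_cong[OF that, of "left_part (inp X)"] arg_cong[OF that, of "right_part (inp Y)"]
    unfolding parts_join[OF 1(2) 2(2)] parts_join[OF 3(2) 4(2)] by (rule conjI)
  then show "tsnd (app (mch_mu X Y A B) l u) = tsnd (app (mch_mu X Y A B) l v) \<and>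
      (tfst (app (mch_mu X Y A B) l u) = tfst (app (mch_mu X Y A B) l v) \<longrightarrow> u = v)"
    using app_mu[OF A B u(2,3) 1(1) 2(1)] app_mu[OF A B v(2,3) 3(1) 4(1)] b st tt
    unfolding u(1) v(1) by auto
qed

lemma tracksD: "tracks X f A c B d r \<Longrightarrow> f \<in> hom (sl X) A B"
  "tracks X f A c B d r \<Longrightarrow> u \<in> sec (pdom A) l \<Longrightarrow> d l (ap f l u) = r (c l u)"
  by (simp_all add: tracks_def del: slice_simps)

text \<open>Arrows of a slice preserve the interface, so both images of a state have the same
  interface value. If they also have the same core, \<open>detects\<close> makes them equal.\<close>

lemma tracks_eqI:
  assumes f: "tracks X f A c B d r" and g: "tracks X g A c B d q" and d: "detects B d"
    and eq: "\<And>l u. r (c l u) = q (c l u)"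
  shows "f = g"
proof (rule hom_sl_eqI[OF tracksD(1)[OF f] tracksD(1)[OF g]])
  fix l u assume u: "u \<in> sec (pdom A) l"
  note f' = hom_slD[OF tracksD(1)[OF f]] and g' = hom_slD[OF tracksD(1)[OF g]]
  show "ap f l u = ap g l u"
    by (rule detectsD(2)[OF d f'(7)[OF u] g'(7)[OF u]])
      (simp_all add: tracksD(2)[OF f u] tracksD(2)[OF g u] eq f'(8)[OF u] g'(8)[OF u])
qed

lemma tracks_idn: "mach X A \<Longrightarrow> tracks X (idn (sl X) A) A d A d (\<lambda>u. u)"
  unfolding tracks_def using category.idn_hom[OF sl_category, of A X] by (simp add: mach_def)

lemma tracks_cmp:
  assumes g: "tracks X g B d C e q" and f: "tracks X f A c B d r"
  shows "tracks X (g \<cdot>\<^bsub>sl X\<^esub> f) A c C e (\<lambda>u. q (r u))"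
  unfolding tracks_def
proof (intro conjI allI ballI)
  show "g \<cdot>\<^bsub>sl X\<^esub> f \<in> hom (sl X) A C" by (rule category.cmp_hom[OF sl_category tracksD(1)[OF f] tracksD(1)[OF g]])
  fix l u assume u: "u \<in> sec (pdom A) l"
  show "e l (ap (g \<cdot>\<^bsub>sl X\<^esub> f) l u) = q (r (c l u))"
    using tracksD(2)[OF f u] tracksD(2)[OF g hom_slD(7)[OF tracksD(1)[OF f] u]] ap_cmp[OF tracksD(1)[OF f] tracksD(1)[OF g] u] by simp
qed

lemma tracks_hom: "f \<in> hom (sl X) A B \<Longrightarrow> tracks X f A (core_pre f d) B d (\<lambda>u. u)"
  by (simp add: tracks_def core_pre_def)

lemma tracks_actA:
  assumes \<phi>: "\<phi> \<in> hom IntW X Y" and f: "tracks X f A c B d r"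
  shows "tracks Y (actA Mch \<phi> f) (mch_act \<phi> A) (core_act c) (mch_act \<phi> B) (core_act d) r"
  unfolding tracks_def
proof (intro conjI allI ballI)
  show "actA Mch \<phi> f \<in> hom (sl Y) (mch_act \<phi> A) (mch_act \<phi> B)" by (rule actA_hom[OF \<phi> tracksD(1)[OF f]])
  fix l u assume u: "u \<in> sec (pdom (mch_act \<phi> A)) l"
  obtain y x s where "u = Tup (Tup y x) s" "s \<in> sec (pdom A) l" using sec_act_cases[OF u \<phi>] by blast
  then show "core_act d l (ap (actA Mch \<phi> f) l u) = r (core_act c l u)"
    using u tracksD(2)[OF f] by (simp add: Mch_cells hom_sl_ends[OF tracksD(1)[OF f]] core_act_def)
qed

lemma tracks_muA:
  assumes X: "psh_box X" and Y: "psh_box Y" and f: "tracks X f A c A' c' r" and g: "tracks Y g B d B' d' q"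
  shows "tracks (box_sum X Y) (muA Mch X Y f g) (mch_mu X Y A B) (core_mu c d) (mch_mu X Y A' B') (core_mu c' d')
    (\<lambda>u. Tup (r (tfst u)) (q (tsnd u)))"
  unfolding tracks_def
proof (intro conjI allI ballI)
  show "muA Mch X Y f g \<in> hom (sl (box_sum X Y)) (mch_mu X Y A B) (mch_mu X Y A' B')"
    by (rule muA_hom[OF X Y tracksD(1)[OF f] tracksD(1)[OF g]])
  fix l u assume u: "u \<in> sec (pdom (mch_mu X Y A B)) l"
  then obtain s t where "u = Tup s t" "s \<in> sec (pdom A) l" "t \<in> sec (pdom B) l" by (auto elim: sec_prodE)
  then show "core_mu c' d' l (ap (muA Mch X Y f g) l u) = Tup (r (tfst (core_mu c d l u))) (q (tsnd (core_mu c d l u)))"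
    using u tracksD(2)[OF f] tracksD(2)[OF g]
    by (simp add: Mch_cells hom_sl_ends[OF tracksD(1)[OF f]] hom_sl_ends[OF tracksD(1)[OF g]] core_mu_def)
qed

text \<open>Cells that come from wiring alone change nothing but recorded interface values and so
  act as the identity on cores. Only the associativity, unit and braiding cells rearrange
  tuples.\<close>

lemma tracks_fcmp:
  assumes \<phi>: "\<phi> \<in> hom IntW X Y" and \<psi>: "\<psi> \<in> hom IntW Y Z" and A: "mach X A"
  shows "tracks Z (fcmp Mch \<psi> \<phi> A) (mch_act (wd_comp \<psi> \<phi>) A) (core_act c) (mch_act \<psi> (mch_act \<phi> A)) (core_act (core_act c)) (\<lambda>u. u)"
  unfolding tracks_def using fcmp_iso[OF assms, THEN isos_hom] by (simp add: Mch_cells core_act_def)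

lemma tracks_fidn:
  assumes X: "psh_box X" and A: "mach X A"
  shows "tracks X (fidn Mch X A) (mch_act (idn IntW X) A) (core_act c) A c (\<lambda>u. u)"
  unfolding tracks_def using fidn_iso[OF assms, THEN isos_hom] by (simp add: Mch_cells core_act_def)

lemma tracks_muN:
  assumes \<phi>: "\<phi> \<in> hom IntW X Y" and \<psi>: "\<psi> \<in> hom IntW X' Y'" and A: "mach X A" and B: "mach X' B"
  shows "tracks (box_sum Y Y') (muN Mch \<phi> \<psi> A B) (mch_act (wd_sum \<phi> \<psi>) (mch_mu X X' A B)) (core_act (core_mu c d))
    (mch_mu Y Y' (mch_act \<phi> A) (mch_act \<psi> B)) (core_mu (core_act c) (core_act d)) (\<lambda>u. u)"
  unfolding tracks_def using muN_iso[OF assms, THEN isos_hom]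
  by (simp add: Mch_cells core_act_def core_mu_def hom_IntWD[OF \<phi>] hom_IntWD[OF \<psi>])

lemma tracks_mu_assoc:
  assumes "psh_box X" "psh_box Y" "psh_box Z" "mach X A" "mach Y B" "mach Z C"
  shows "tracks (box_sum X (box_sum Y Z)) (mu_assoc Mch X Y Z A B C)
    (mch_act (assoc IntW X Y Z) (mch_mu (box_sum X Y) Z (mch_mu X Y A B) C)) (core_act (core_mu (core_mu c d) e))
    (mch_mu X (box_sum Y Z) A (mch_mu Y Z B C)) (core_mu c (core_mu d e))
    (\<lambda>u. Tup (tfst (tfst u)) (Tup (tsnd (tfst u)) (tsnd u)))"
  unfolding tracks_def using mu_assoc_iso[OF assms, THEN isos_hom] by (simp add: Mch_cells core_act_def core_mu_def)

lemma tracks_mu_lunit: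
  assumes "psh_box X" "mach X A"
  shows "tracks X (mu_lunit Mch X A) (mch_act (lunit IntW X) (mch_mu box_empty X mch_eta A)) (core_act (core_mu core_id c)) A c tsnd"
  unfolding tracks_def using mu_lunit_iso[OF assms, THEN isos_hom] by (simp add: Mch_cells core_act_def core_mu_def)

lemma tracks_mu_runit:
  assumes "psh_box X" "mach X A"
  shows "tracks X (mu_runit Mch X A) (mch_act (runit IntW X) (mch_mu X box_empty A mch_eta)) (core_act (core_mu c core_id)) A c tfst"
  unfolding tracks_def using mu_runit_iso[OF assms, THEN isos_hom] by (simp add: Mch_cells core_act_def core_mu_def)

lemma tracks_mu_braid:
  assumes "psh_box X" "psh_box Y" "mach X A" "mach Y B"
  shows "tracks (box_sum Y X) (mu_braid Mch X Y A B) (mch_act (braid IntW X Y) (mch_mu X Y A B)) (core_act (core_mu c d))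
    (mch_mu Y X B A) (core_mu d c) (\<lambda>u. Tup (tsnd u) (tfst u))"
  unfolding tracks_def using mu_braid_iso[OF assms, THEN isos_hom] by (simp add: Mch_cells core_act_def core_mu_def)

text \<open>The judgement \<open>tracks\<close> for pasting triples. A triple stands for an arrow
  out of \<open>mch_act (fst t) A\<close>, whence the \<open>core_act\<close> on the source; the
  typing of the diagram is included so that pasting can be checked compositionally.\<close>

definition ptracks :: "'a psh wd \<times> 'a pmap \<times> 'a pmap \<times> 'a pmap \<times> 'a pmap \<Rightarrow> 'a psh box \<Rightarrow> 'a pmap \<Rightarrow> 'a core \<Rightarrow>
    'a psh box \<Rightarrow> 'a pmap \<Rightarrow> 'a core \<Rightarrow> ('a univ \<Rightarrow> 'a univ) \<Rightarrow> bool" where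
  "ptracks t X A c Y B d r \<longleftrightarrow> fst t \<in> hom IntW X Y \<and> fst (snd t) = A \<and> mach X A \<and>
     tracks Y (snd (snd t)) (mch_act (fst t) A) (core_act c) B d r"

lemma ptracks_cmp:
  assumes s: "ptracks s Y B d Z C e q" and t: "ptracks t X A c Y B d r"
  shows "ptracks (pcmp IntW Mch s t) X A c Z C e (\<lambda>u. q (r u))"
proof -
  obtain \<psi> g where s': "s = (\<psi>, B, g)" "\<psi> \<in> hom IntW Y Z" "tracks Z g (mch_act \<psi> B) (core_act d) C e q"
    using s by (cases s) (auto simp: ptracks_def)
  obtain \<phi> f where t': "t = (\<phi>, A, f)" "\<phi> \<in> hom IntW X Y" "tracks Y f (mch_act \<phi> A) (core_act c) B d r" "mach X A"
    using t by (cases t) (auto simp: ptracks_def)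
  have "wd_comp \<psi> \<phi> \<in> hom IntW X Z"
    using hom_IntWD[OF s'(2)] hom_IntWD[OF t'(2)] by (simp add: hom_wiring is_wd_comp)
  moreover have "tracks Z (g \<cdot>\<^bsub>sl Z\<^esub> actA Mch \<psi> f \<cdot>\<^bsub>sl Z\<^esub> fcmp Mch \<psi> \<phi> A) (mch_act (wd_comp \<psi> \<phi>) A) (core_act c) C e (\<lambda>u. q (r u))"
    by (rule tracks_cmp[OF s'(3) tracks_cmp[OF tracks_actA[OF s'(2) t'(3)] tracks_fcmp[OF t'(2) s'(2) t'(4)]]])
  ultimately show ?thesis
    using t'(4) hom_IntWD[OF s'(2)] by (simp add: ptracks_def pcmp_def s'(1) t'(1) Let_def)
qed

lemma ptracks_ten:
  assumes s: "ptracks s X A c Y B d r" and t: "ptracks t X' A' c' Y' B' d' q"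
  shows "ptracks (pten IntW Mch s t) (box_sum X X') (mch_mu X X' A A') (core_mu c c') (box_sum Y Y') (mch_mu Y Y' B B') (core_mu d d')
    (\<lambda>u. Tup (r (tfst u)) (q (tsnd u)))"
proof -
  obtain \<phi> f where s': "s = (\<phi>, A, f)" "\<phi> \<in> hom IntW X Y" "tracks Y f (mch_act \<phi> A) (core_act c) B d r" "mach X A"
    using s by (cases s) (auto simp: ptracks_def)
  obtain \<psi> g where t': "t = (\<psi>, A', g)" "\<psi> \<in> hom IntW X' Y'" "tracks Y' g (mch_act \<psi> A') (core_act c') B' d' q" "mach X' A'"
    using t by (cases t) (auto simp: ptracks_def)
  note p = hom_IntWD[OF s'(2)] and q = hom_IntWD[OF t'(2)]
  have "wd_sum \<phi> \<psi> \<in> hom IntW (box_sum X X') (box_sum Y Y')"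
    using p q by (simp add: hom_wiring is_wd_sum)
  moreover have "tracks (box_sum Y Y') (muA Mch Y Y' f g \<cdot>\<^bsub>sl (box_sum Y Y')\<^esub> muN Mch \<phi> \<psi> A A')
      (mch_act (wd_sum \<phi> \<psi>) (mch_mu X X' A A')) (core_act (core_mu c c')) (mch_mu Y Y' B B') (core_mu d d') (\<lambda>u. Tup (r (tfst u)) (q (tsnd u)))"
    by (rule tracks_cmp[OF tracks_muA[OF p(5) q(5) s'(3) t'(3)] tracks_muN[OF s'(2) t'(2) s'(4) t'(4)]])
  ultimately show ?thesis
    using mach_mu[OF p(4) q(4) s'(4) t'(4)] p q by (simp add: ptracks_def pten_def s'(1) t'(1) Let_def)
qed

lemma ptracks_p1: "\<phi> \<in> hom IntW X Y \<Longrightarrow> mach X A \<Longrightarrow>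
    ptracks (\<phi>, A, idn (sl (wtrg \<phi>)) (mch_act \<phi> A)) X A c Y (mch_act \<phi> A) (core_act c) (\<lambda>u. u)"
  unfolding ptracks_def using hom_IntWD(3)[of \<phi> X Y] tracks_idn[OF mach_act] by simp

lemma ptracks_cells:
  "psh_box X \<Longrightarrow> mach X A \<Longrightarrow> ptracks (idn IntW X, A, fidn Mch X A) X A c X A c (\<lambda>u. u)"
  "psh_box X \<Longrightarrow> psh_box Y \<Longrightarrow> psh_box Z \<Longrightarrow> mach X A \<Longrightarrow> mach Y B \<Longrightarrow> mach Z C \<Longrightarrow>
    ptracks (assoc IntW X Y Z, mch_mu (box_sum X Y) Z (mch_mu X Y A B) C, mu_assoc Mch X Y Z A B C)
      (box_sum (box_sum X Y) Z) (mch_mu (box_sum X Y) Z (mch_mu X Y A B) C) (core_mu (core_mu c d) e)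
      (box_sum X (box_sum Y Z)) (mch_mu X (box_sum Y Z) A (mch_mu Y Z B C)) (core_mu c (core_mu d e))
      (\<lambda>u. Tup (tfst (tfst u)) (Tup (tsnd (tfst u)) (tsnd u)))"
  "psh_box X \<Longrightarrow> mach X A \<Longrightarrow> ptracks (lunit IntW X, mch_mu box_empty X mch_eta A, mu_lunit Mch X A)
      (box_sum box_empty X) (mch_mu box_empty X mch_eta A) (core_mu core_id c) X A c tsnd"
  "psh_box X \<Longrightarrow> mach X A \<Longrightarrow> ptracks (runit IntW X, mch_mu X box_empty A mch_eta, mu_runit Mch X A)
      (box_sum X box_empty) (mch_mu X box_empty A mch_eta) (core_mu c core_id) X A c tfst"
  "psh_box X \<Longrightarrow> psh_box Y \<Longrightarrow> mach X A \<Longrightarrow> mach Y B \<Longrightarrow>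
    ptracks (braid IntW X Y, mch_mu X Y A B, mu_braid Mch X Y A B)
      (box_sum X Y) (mch_mu X Y A B) (core_mu c d) (box_sum Y X) (mch_mu Y X B A) (core_mu d c) (\<lambda>u. Tup (tsnd u) (tfst u))"
  unfolding ptracks_def fst_conv snd_conv
  by (intro conjI refl IntW_structure tracks_fidn tracks_mu_assoc tracks_mu_lunit tracks_mu_runit tracks_mu_braid mach_mu mach_eta
      is_box_sum is_box_empty; assumption)+

text \<open>Splits a pasting equation into one between wiring diagrams, which is a law of
  \<open>IntW\<close>, and one between functions on cores.\<close>

lemma ptracks_eqI:
  assumes t: "ptracks t X A c Y B d r" and t': "ptracks t' X A c Y B d q" and d: "detects B d" and \<phi>: "fst t = fst t'"
    and eq: "\<And>l u. r (c l u) = q (c l u)"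
  shows "t = t'"
proof -
  have "snd (snd t) = snd (snd t')"
    by (rule tracks_eqI[OF _ _ d, of Y _ "mch_act (fst t) A" "core_act c" r _ q])
      (use t t' \<phi> eq in \<open>auto simp: ptracks_def core_act_def\<close>)
  then show ?thesis using t t' \<phi> by (simp add: ptracks_def prod_eq_iff)
qed

lemma fst_pasting: "fst (pcmp IntW Mch s t) = wd_comp (fst s) (fst t)" "fst (pten IntW Mch s t) = wd_sum (fst s) (fst t)"
  by (simp_all add: pcmp_def pten_def case_prod_unfold Let_def)

lemma IntW_comp: "\<phi> \<in> hom IntW X Y \<Longrightarrow> \<psi> \<in> hom IntW Y Z \<Longrightarrow> wd_comp \<psi> \<phi> \<in> hom IntW X Z"
  by (simp add: hom_wiring is_wd_comp)

lemma IntW_sum: "\<phi> \<in> hom IntW X Y \<Longrightarrow> \<psi> \<in> hom IntW X' Y' \<Longrightarrow> wd_sum \<phi> \<psi> \<in> hom IntW (box_sum X X') (box_sum Y Y')"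
  by (simp add: hom_wiring is_wd_sum)

lemmas mch_objects = mach_act mach_mu mach_eta is_box_sum is_box_empty IntW_comp IntW_sum IntW_structure

lemmas detects_intros = detects_id detects_act detects_mu

text \<open>The shape of an arrow selects the rule, and unification propagates the views from the
  target to the source. \<open>tracks_hom\<close> is the last of the tracking rules since it fits
  every arrow.\<close>

lemmas tracks_intros = tracks_cmp tracks_idn tracks_actA tracks_muA tracks_fcmp tracks_fidn tracks_muN tracks_mu_assoc tracks_mu_lunit tracks_mu_runit
  tracks_mu_braid tracks_hom mch_objects detects_intros

lemmas ptracks_intros = ptracks_cmp ptracks_ten ptracks_p1 ptracks_cells mch_objects detects_intros

section \<open>Functoriality and coherence of the algebra of machines\<close>

lemma mch_act_functor:
  assumes \<phi>: "\<phi> \<in> hom IntW X Y"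
  shows "is_functor (sl X) (sl Y) (mch_act \<phi>) (actA Mch \<phi>)"
  unfolding is_functor_def
proof (intro conjI ballI allI impI)
  fix A assume "A \<in> Obj (sl X)"
  then have A: "mach X A" by (simp only: Obj_sl)
  show "mch_act \<phi> A \<in> Obj (sl Y)" using mach_act[OF \<phi> A] by (simp only: Obj_sl)
  show "actA Mch \<phi> (idn (sl X) A) = idn (sl Y) (mch_act \<phi> A)"
    by (insert \<phi> A, rule tracks_eqI[where d = "core_act core_id"], (assumption | erule hom_IntWD(4,5) hom_slD(1,2) | rule tracks_intros)+, rule refl)
next
  fix A B f assume "f \<in> hom (sl X) A B"
  then show "actA Mch \<phi> f \<in> hom (sl Y) (mch_act \<phi> A) (mch_act \<phi> B)" by (rule actA_hom[OF \<phi>])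
next
  fix A B E f g assume fg: "f \<in> hom (sl X) A B" "g \<in> hom (sl X) B E"
  show "actA Mch \<phi> (g \<cdot>\<^bsub>sl X\<^esub> f) = actA Mch \<phi> g \<cdot>\<^bsub>sl Y\<^esub> actA Mch \<phi> f"
    by (insert \<phi> fg, rule tracks_eqI[where d = "core_act core_id"], (assumption | erule hom_IntWD(4,5) hom_slD(1,2) | rule tracks_intros)+, rule refl)
qed

text \<open>The equation \<open>A' = A\<close> absorbs the laws of wiring diagrams: sources such as
  \<open>mch_act ((\<chi> \<cdot> \<psi>) \<cdot> \<phi>) m\<close> and \<open>mch_act (\<chi> \<cdot> (\<psi> \<cdot> \<phi>)) m\<close> agree only up to these laws.\<close>

lemma tracks_eqI2:
  assumes "tracks X f A c B d r" "tracks X g A' c B d q" "detects B d" "A' = A" "\<And>l u. r (c l u) = q (c l u)"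
  shows "f = g"
  using assms by (blast intro: tracks_eqI)

text \<open>Oriented for rewriting: composites nest to the right, composites of sums become sums of
  composites, and identities are absorbed.\<close>

lemma IntW_laws:
  "\<phi> \<in> hom IntW X Y \<Longrightarrow> \<psi> \<in> hom IntW Y Z \<Longrightarrow> \<chi> \<in> hom IntW Z U \<Longrightarrow>
    wd_comp (wd_comp \<chi> \<psi>) \<phi> = wd_comp \<chi> (wd_comp \<psi> \<phi>)"
  "\<phi> \<in> hom IntW X Y \<Longrightarrow> wd_comp (idn IntW Y) \<phi> = \<phi>"
  "\<phi> \<in> hom IntW X Y \<Longrightarrow> wd_comp \<phi> (idn IntW X) = \<phi>"
  "\<phi> \<in> hom IntW X Y \<Longrightarrow> \<psi> \<in> hom IntW Y Z \<Longrightarrow> \<phi>' \<in> hom IntW X' Y' \<Longrightarrow> \<psi>' \<in> hom IntW Y' Z' \<Longrightarrow>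
    wd_comp (wd_sum \<psi> \<psi>') (wd_sum \<phi> \<phi>') = wd_sum (wd_comp \<psi> \<phi>) (wd_comp \<psi>' \<phi>')"
  "psh_box X \<Longrightarrow> psh_box Y \<Longrightarrow> wd_sum (idn IntW X) (idn IntW Y) = idn IntW (box_sum X Y)"
proof -
  interpret V: symmetric_monoidal "IntW :: ('a psh box, 'a psh wd) smcat" by (rule IntW_symmetric_monoidal)
  show "\<phi> \<in> hom IntW X Y \<Longrightarrow> \<psi> \<in> hom IntW Y Z \<Longrightarrow> \<chi> \<in> hom IntW Z U \<Longrightarrow>
    wd_comp (wd_comp \<chi> \<psi>) \<phi> = wd_comp \<chi> (wd_comp \<psi> \<phi>)" by (rule V.cmp_assoc[unfolded wiring_simps])
  show "\<phi> \<in> hom IntW X Y \<Longrightarrow> wd_comp (idn IntW Y) \<phi> = \<phi>" by (rule V.idn_left[unfolded wiring_simps])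
  show "\<phi> \<in> hom IntW X Y \<Longrightarrow> wd_comp \<phi> (idn IntW X) = \<phi>" by (rule V.idn_right[unfolded wiring_simps])
  show "\<phi> \<in> hom IntW X Y \<Longrightarrow> \<psi> \<in> hom IntW Y Z \<Longrightarrow> \<phi>' \<in> hom IntW X' Y' \<Longrightarrow> \<psi>' \<in> hom IntW Y' Z' \<Longrightarrow>
    wd_comp (wd_sum \<psi> \<psi>') (wd_sum \<phi> \<phi>') = wd_sum (wd_comp \<psi> \<phi>) (wd_comp \<psi>' \<phi>')"
    by (rule V.tenA_cmp[unfolded wiring_simps, symmetric])
  show "psh_box X \<Longrightarrow> psh_box Y \<Longrightarrow> wd_sum (idn IntW X) (idn IntW Y) = idn IntW (box_sum X Y)"
    by (rule V.tenA_idn[unfolded wiring_simps mem_Collect_eq])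
qed

text \<open>In each equation the view \<open>d\<close> mirrors how the common target is built:
  \<open>core_act\<close> for an action, \<open>core_mu\<close> for a product,
  \<open>core_id\<close> for an arbitrary machine. Such views detect by construction, and the rest
  is an identity of tuples.\<close>

lemma Mch_lax_algebra: "lax_algebra IntW Mch"
proof -
  interpret V: symmetric_monoidal "IntW :: ('a psh box, 'a psh wd) smcat" by (rule IntW_symmetric_monoidal)
  note unf = wiring_simps mem_Collect_eq
  show ?thesis
    apply (intro_locales)
    apply (unfold lax_algebra_axioms_def)
    apply (intro conjI allI impI; (unfold Mch_simps wiring_simps Obj_sl mem_Collect_eq)?)
    subgoal by (rule sl_category)
    subgoal by (rule mch_act_functor)
    subgoal by (rule fcmp_iso)
    subgoal by (rule tracks_eqI[where d = "core_act (core_act core_id)"], (assumption | erule hom_IntWD(4,5) hom_slD(1,2) | rule tracks_intros)+, rule refl)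
    subgoal by (rule fidn_iso)
    subgoal by (rule tracks_eqI[where d = "core_id"], (assumption | erule hom_IntWD(4,5) hom_slD(1,2) | rule tracks_intros)+, rule refl)
    subgoal by (rule tracks_eqI2[where d = "core_act (core_act (core_act core_id))"], (assumption | erule hom_IntWD(4,5) hom_slD(1,2) | rule tracks_intros)+) (simp_all add: IntW_laws)
    subgoal by (rule tracks_eqI2[where d = "core_act core_id"], (assumption | erule hom_IntWD(4,5) hom_slD(1,2) | rule tracks_intros)+) (simp_all add: IntW_laws)
    subgoal by (rule tracks_eqI2[where d = "core_act core_id"], (assumption | erule hom_IntWD(4,5) hom_slD(1,2) | rule tracks_intros)+) (simp_all add: IntW_laws)
    subgoal by (rule mach_mu)
    subgoal by (rule muA_hom)
    subgoal by (rule tracks_eqI[where d = "core_mu core_id core_id"], (assumption | erule hom_IntWD(4,5) hom_slD(1,2) | rule tracks_intros)+) (simp add: core_defs)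
    subgoal by (rule tracks_eqI[where d = "core_mu core_id core_id"], (assumption | erule hom_IntWD(4,5) hom_slD(1,2) | rule tracks_intros)+) (simp add: core_defs)
    subgoal by (rule muN_iso)
    subgoal by (rule tracks_eqI[where d = "core_mu (core_act core_id) (core_act core_id)"], (assumption | erule hom_IntWD(4,5) hom_slD(1,2) | rule tracks_intros)+) (simp add: core_defs)
    subgoal by (rule tracks_eqI2[where d = "core_mu (core_act (core_act core_id)) (core_act (core_act core_id))"], (assumption | erule hom_IntWD(4,5) hom_slD(1,2) | rule tracks_intros)+) (simp_all add: IntW_laws core_defs)
    subgoal by (rule tracks_eqI2[where d = "core_mu core_id core_id"], (assumption | erule hom_IntWD(4,5) hom_slD(1,2) | rule tracks_intros)+) (simp_all add: IntW_laws core_defs)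
    subgoal by (rule mach_eta)
    subgoal by (rule mu_assoc_iso)
    subgoal by (rule tracks_eqI[where d = "core_mu core_id (core_mu core_id core_id)"], (assumption | erule hom_IntWD(4,5) hom_slD(1,2) | rule tracks_intros)+) (simp add: core_defs)
    \<comment> \<open>In this and the other pasting equations, the diagrams on the two sides agree
      by the law of the same shape in the monoidal category of wiring diagrams.\<close>
    subgoal by (rule ptracks_eqI[where d = "core_mu (core_act core_id) (core_mu (core_act core_id) (core_act core_id))"], (assumption | erule hom_IntWD(4,5) hom_slD(1,2) | rule ptracks_intros)+, unfold fst_pasting fst_conv)
        (erule (2) V.assoc_nat[unfolded unf], simp add: core_defs)
    subgoal by (rule mu_lunit_iso)
    subgoal by (rule tracks_eqI[where d = "core_id"], (assumption | erule hom_IntWD(4,5) hom_slD(1,2) | rule tracks_intros)+) (simp add: core_defs)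
    subgoal by (rule ptracks_eqI[where d = "core_act core_id"], (assumption | erule hom_IntWD(4,5) hom_slD(1,2) | rule ptracks_intros)+, unfold fst_pasting fst_conv)
        (erule V.lunit_nat[unfolded unf], simp add: core_defs)
    subgoal by (rule mu_runit_iso)
    subgoal by (rule tracks_eqI[where d = "core_id"], (assumption | erule hom_IntWD(4,5) hom_slD(1,2) | rule tracks_intros)+) (simp add: core_defs)
    subgoal by (rule ptracks_eqI[where d = "core_act core_id"], (assumption | erule hom_IntWD(4,5) hom_slD(1,2) | rule ptracks_intros)+, unfold fst_pasting fst_conv)
        (erule V.runit_nat[unfolded unf], simp add: core_defs)
    subgoal by (rule mu_braid_iso)
    subgoal by (rule tracks_eqI[where d = "core_mu core_id core_id"], (assumption | erule hom_IntWD(4,5) hom_slD(1,2) | rule tracks_intros)+) (simp add: core_defs)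
    subgoal by (rule ptracks_eqI[where d = "core_mu (core_act core_id) (core_act core_id)"], (assumption | erule hom_IntWD(4,5) hom_slD(1,2) | rule ptracks_intros)+, unfold fst_pasting fst_conv)
        (erule (1) V.braid_nat[unfolded unf], simp add: core_defs)
    subgoal by (rule ptracks_eqI[where d = "core_mu core_id (core_mu core_id (core_mu core_id core_id))"], (assumption | erule hom_IntWD(4,5) hom_slD(1,2) | rule ptracks_intros)+, unfold fst_pasting fst_conv)
        (erule (3) V.pentagon[unfolded unf], simp add: core_defs)
    subgoal by (rule ptracks_eqI[where d = "core_mu core_id core_id"], (assumption | erule hom_IntWD(4,5) hom_slD(1,2) | rule ptracks_intros)+, unfold fst_pasting fst_conv)
        (erule (1) V.triangle[unfolded unf], simp add: core_defs)
    subgoal by (rule ptracks_eqI[where d = "core_mu core_id (core_mu core_id core_id)"], (assumption | erule hom_IntWD(4,5) hom_slD(1,2) | rule ptracks_intros)+, unfold fst_pasting fst_conv)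
        (erule (2) V.hexagon[unfolded unf], simp add: core_defs)
    subgoal by (rule ptracks_eqI[where d = "core_mu core_id core_id"], (assumption | erule hom_IntWD(4,5) hom_slD(1,2) | rule ptracks_intros)+, unfold fst_pasting fst_conv)
        (erule (1) V.braid_sym[unfolded unf], simp add: core_defs)
    done
qed

section \<open>Inertial machines\<close>

lemma machine_mach: "psh_box X \<Longrightarrow> machine (hat (inp X)) (hat (outp X)) m \<longleftrightarrow> mach X m"
  by (auto simp: machine_def mach_def iface_def)

lemma out_map_simps:
  assumes "psh_box X" "mach X m"
  shows "sheaf_map (out_map (hat (inp X)) (hat (outp X)) m)"
    "pdom (out_map (hat (inp X)) (hat (outp X)) m) = pdom m" "pcod (out_map (hat (inp X)) (hat (outp X)) m) = hat (outp X)"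
    "s \<in> sec (pdom m) l \<Longrightarrow> app (out_map (hat (inp X)) (hat (outp X)) m) l s = tsnd (app m l s)"
proof -
  show "sheaf_map (out_map (hat (inp X)) (hat (outp X)) m)"
    unfolding out_map_def
    by (rule sheaf_map_comp[OF _ sheaf_map_proj2]) (use assms in \<open>auto simp: mach_def iface_def\<close>)
  show "app (out_map (hat (inp X)) (hat (outp X)) m) l s = tsnd (app m l s)" if s: "s \<in> sec (pdom m) l"
  proof -
    obtain a b where "app m l s = Tup a b" "a \<in> sec (hat (inp X)) l" "b \<in> sec (hat (outp X)) l"
      using mach_app[OF assms(2) s] by blast
    then show ?thesis using s mach_sec_nonneg[OF assms(2) s] by (simp add: out_map_def)
  qed
qed (simp_all add: out_map_def)

text \<open>An unbundled factorisation: values in \<open>Ext e\<close>, the triangle with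
  \<open>left_restr\<close>, naturality. Here \<open>q\<close> is a bare function, so witnesses can
  be given without normalising their values off the carriers.\<close>

definition lookahead :: "real \<Rightarrow> 'a psh box \<Rightarrow> 'a pmap \<Rightarrow> (real \<Rightarrow> 'a univ \<Rightarrow> 'a univ) \<Rightarrow> bool" where
  "lookahead e X m q \<longleftrightarrow> (\<forall>l. \<forall>s \<in> sec (pdom m) l.
     q l s \<in> sec (hat (outp X)) (l + e) \<and> res (hat (outp X)) (l, 0, l + e) (q l s) = tsnd (app m l s) \<and>
     (\<forall>l' p. 0 \<le> l' \<longrightarrow> 0 \<le> p \<longrightarrow> l' + p \<le> l \<longrightarrow>
        q l' (res (pdom m) (l', p, l) s) = res (hat (outp X)) (l' + e, p, l + e) (q l s)))"

text \<open>The passage from \<open>q\<close> back to a factorisation relies on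
  \<open>sheaf_Ext\<close>, since \<open>q\<close> has to become a morphism of sheaves into the
  extension.\<close>

lemma eps_inertial_machine_iff:
  assumes X: "psh_box X" and m: "mach X m" and e: "0 \<le> e"
  shows "eps_inertial_machine e X m \<longleftrightarrow> (\<exists>q. lookahead e X m q)"
proof
  let ?B = "hat (outp X)" and ?o = "out_map (hat (inp X)) (hat (outp X)) m"
  note o = out_map_simps[OF X m]
  assume "eps_inertial_machine e X m"
  then obtain h where h: "sheaf_map h" "pdom h = pdom m" "pcod h = Ext e ?B"
    and eq: "left_restr e ?B \<cdot>\<^bsub>IntSh\<^esub> h = ?o"
    by (auto simp: eps_inertial_machine_def eps_inertial_map_def o hom_IntSh)
  have "lookahead e X m (app h)"
    unfolding lookahead_def
  proof (intro allI ballI conjI impI)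
    fix l s assume s: "s \<in> sec (pdom m) l"
    have l: "0 \<le> l" by (rule mach_sec_nonneg[OF m s])
    have h': "app h l s \<in> sec (Ext e ?B) l" using sheaf_mapD(5)[OF h(1), of s l] s h by simp
    then show 1: "app h l s \<in> sec ?B (l + e)" using l e by (simp add: sec_Ext)
    have "app (left_restr e ?B \<cdot>\<^bsub>IntSh\<^esub> h) l s = res ?B (l, 0, l + e) (app h l s)"
      using s h h' by (simp add: left_restr_def restr_def)
    then show "res ?B (l, 0, l + e) (app h l s) = tsnd (app m l s)" using o(4)[OF s] by (simp add: eq)
    fix l' p :: real assume "0 \<le> l'" "0 \<le> p" "l' + p \<le> l"
    then show "app h l' (res (pdom m) (l', p, l) s) = res ?B (l' + e, p, l + e) (app h l s)"
      using sheaf_mapD(7)[OF h(1), of l' p l s] s h 1 by (simp add: res_Ext)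
  qed
  then show "\<exists>q. lookahead e X m q" by (intro exI)
next
  let ?B = "hat (outp X)" and ?o = "out_map (hat (inp X)) (hat (outp X)) m"
  note o = out_map_simps[OF X m]
  assume "\<exists>q. lookahead e X m q"
  then obtain q where q: "lookahead e X m q" by blast
  let ?h = "mk_map (pdom m) (Ext e ?B) q"
  have B: "sheaf ?B" using X by simp
  have h: "sheaf_map ?h"
    by (rule sheaf_map_mk[OF mach_sheaf[OF m] sheaf_Ext[OF B e]])
      (use q mach_sec_nonneg[OF m] e in \<open>simp_all add: lookahead_def sec_Ext res_Ext\<close>)
  have r: "sheaf_map (left_restr e ?B)"
    unfolding left_restr_def restr_def
    by (rule sheaf_map_mk[OF sheaf_Ext[OF B e] B])
      (use e in \<open>auto simp: sec_Ext res_Ext presheafD[OF sheafD(1)[OF B]] split: if_splits\<close>)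
  have "left_restr e ?B \<cdot>\<^bsub>IntSh\<^esub> ?h = ?o"
  proof (rule pmap_eqI)
    show "sheaf_map (left_restr e ?B \<cdot>\<^bsub>IntSh\<^esub> ?h)" by (rule sheaf_map_comp[OF h r]) (simp add: left_restr_def)
    fix l s assume "s \<in> sec (pdom (left_restr e ?B \<cdot>\<^bsub>IntSh\<^esub> ?h)) l"
    then have s: "s \<in> sec (pdom m) l" by simp
    have "q l s \<in> sec (Ext e ?B) l" using q s mach_sec_nonneg[OF m s] e by (simp add: lookahead_def sec_Ext)
    then show "app (left_restr e ?B \<cdot>\<^bsub>IntSh\<^esub> ?h) l s = app ?o l s"
      using q s by (simp add: o(4)[OF s] left_restr_def restr_def lookahead_def)
  qed (use o in \<open>simp_all add: left_restr_def\<close>)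
  then show "eps_inertial_machine e X m"
    using h m X by (auto simp: eps_inertial_machine_def eps_inertial_map_def machine_mach o hom_IntSh)
qed

text \<open>Feedback restricts which states exist but does not enter the extension, which is
  computed from the inner state alone.\<close>

lemma lookahead_act:
  assumes \<phi>: "\<phi> \<in> hom IntW X Y" and e: "0 \<le> e" and q: "lookahead e X m q"
  shows "lookahead e Y (mch_act \<phi> m) (\<lambda>l u. dout \<phi> (l + e) (q l (tsnd u)))"
  unfolding lookahead_def
proof (intro allI ballI)
  note p = hom_IntWD[OF \<phi>]
  fix l u assume u: "u \<in> sec (pdom (mch_act \<phi> m)) l"
  obtain y x s where u': "u = Tup (Tup y x) s" "0 \<le> l" "y \<in> sec (hat (inp Y)) l" "x \<in> sec (hat (outp X)) l"
    "s \<in> sec (pdom m) l" "app m l s = Tup (din \<phi> l y x) x" using sec_act_cases[OF u \<phi>] by blast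
  have qs: "q l s \<in> sec (hat (outp X)) (l + e)" "res (hat (outp X)) (l, 0, l + e) (q l s) = x"
    and nat: "\<And>l' p. 0 \<le> l' \<Longrightarrow> 0 \<le> p \<Longrightarrow> l' + p \<le> l \<Longrightarrow>
        q l' (res (pdom m) (l', p, l) s) = res (hat (outp X)) (l' + e, p, l + e) (q l s)"
    using q u' by (simp_all add: lookahead_def)
  show "dout \<phi> (l + e) (q l (tsnd u)) \<in> sec (hat (outp Y)) (l + e) \<and>
      res (hat (outp Y)) (l, 0, l + e) (dout \<phi> (l + e) (q l (tsnd u))) = tsnd (app (mch_act \<phi> m) l u) \<and>
     (\<forall>l' p. 0 \<le> l' \<longrightarrow> 0 \<le> p \<longrightarrow> l' + p \<le> l \<longrightarrow>
        dout \<phi> (l' + e) (q l' (tsnd (res (pdom (mch_act \<phi> m)) (l', p, l) u))) =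
        res (hat (outp Y)) (l' + e, p, l + e) (dout \<phi> (l + e) (q l (tsnd u))))"
  proof (intro conjI allI impI)
    show "dout \<phi> (l + e) (q l (tsnd u)) \<in> sec (hat (outp Y)) (l + e)"
      using sec_dout[OF p(1), of "q l s" "l + e"] qs p u' by simp
    \<comment> \<open>Exposing outputs commutes with restriction, so the extended output restricts
      to what \<open>\<phi>\<close> exposes of the recorded \<open>x\<close>.\<close>
    show "res (hat (outp Y)) (l, 0, l + e) (dout \<phi> (l + e) (q l (tsnd u))) = tsnd (app (mch_act \<phi> m) l u)"
      using dout_res[OF p(1), of "q l s" "l + e" l 0] qs p u' u e by (simp add: app_act)
    fix l' r :: real assume l: "0 \<le> l'" "0 \<le> r" "l' + r \<le> l"
    show "dout \<phi> (l' + e) (q l' (tsnd (res (pdom (mch_act \<phi> m)) (l', r, l) u))) =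
        res (hat (outp Y)) (l' + e, r, l + e) (dout \<phi> (l + e) (q l (tsnd u)))"
      using dout_res[OF p(1), of "q l s" "l + e" "l' + e" r] nat[OF l] qs p u l e by (simp add: u'(1) res_act)
  qed
qed

text \<open>Both factors look ahead by the same \<open>e\<close>, so their extended outputs have
  equal length and can be joined.\<close>

lemma lookahead_mu:
  assumes X: "psh_box X" and Y: "psh_box Y" and m: "mach X m" and n: "mach Y n" and e: "0 \<le> e"
    and q: "lookahead e X m q" and r: "lookahead e Y n r"
  shows "lookahead e (box_sum X Y) (mch_mu X Y m n)
    (\<lambda>l u. fam_join (outp X) (outp Y) (q l (tfst u)) (r l (tsnd u)))"
  unfolding lookahead_def
proof (intro allI ballI)
  fix l u assume "u \<in> sec (pdom (mch_mu X Y m n)) l"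
  then obtain s t where u: "u = Tup s t" "0 \<le> l" "s \<in> sec (pdom m) l" "t \<in> sec (pdom n) l" by (auto elim: sec_prodE)
  obtain a b where ab: "app m l s = Tup a b" using mach_app[OF m u(3)] by blast
  obtain c d where cd: "app n l t = Tup c d" using mach_app[OF n u(4)] by blast
  note X' = psh_box_tfs(2)[OF X] and Y' = psh_box_tfs(2)[OF Y]
  have qs: "q l s \<in> sec (hat (outp X)) (l + e)" "r l t \<in> sec (hat (outp Y)) (l + e)"
    using q r u by (simp_all add: lookahead_def)
  show "fam_join (outp X) (outp Y) (q l (tfst u)) (r l (tsnd u)) \<in> sec (hat (outp (box_sum X Y))) (l + e) \<and>
      res (hat (outp (box_sum X Y))) (l, 0, l + e) (fam_join (outp X) (outp Y) (q l (tfst u)) (r l (tsnd u))) =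
        tsnd (app (mch_mu X Y m n) l u) \<and>
     (\<forall>l' p. 0 \<le> l' \<longrightarrow> 0 \<le> p \<longrightarrow> l' + p \<le> l \<longrightarrow>
        fam_join (outp X) (outp Y) (q l' (tfst (res (pdom (mch_mu X Y m n)) (l', p, l) u)))
          (r l' (tsnd (res (pdom (mch_mu X Y m n)) (l', p, l) u))) =
        res (hat (outp (box_sum X Y))) (l' + e, p, l + e) (fam_join (outp X) (outp Y) (q l (tfst u)) (r l (tsnd u))))"
    using q r u qs e ab cd app_mu[OF m n u(3,4) ab cd]
    by (auto simp: fam_join_sec res_join[OF X' Y' qs] lookahead_def)
qed

text \<open>The only section of the empty product is the same element at every length, so the state
  is its own extended output.\<close>

lemma lookahead_eta: "0 \<le> e \<Longrightarrow> lookahead e box_empty mch_eta (\<lambda>l u. u)"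
  unfolding lookahead_def by (auto simp: sec_hat_empty res_hat restrict_def)

lemma lookahead_mono:
  assumes X: "psh_box X" and q: "lookahead e X m q" and m: "mach X m" and d: "0 \<le> d" "d \<le> e"
  shows "lookahead d X m (\<lambda>l s. res (hat (outp X)) (l + d, 0, l + e) (q l s))"
  unfolding lookahead_def
proof (intro allI ballI)
  fix l s assume s: "s \<in> sec (pdom m) l"
  have pre: "presheaf (hat (outp X))" using X by simp
  have l: "0 \<le> l" by (rule mach_sec_nonneg[OF m s])
  show "res (hat (outp X)) (l + d, 0, l + e) (q l s) \<in> sec (hat (outp X)) (l + d) \<and>
      res (hat (outp X)) (l, 0, l + d) (res (hat (outp X)) (l + d, 0, l + e) (q l s)) = tsnd (app m l s) \<and>
     (\<forall>l' p. 0 \<le> l' \<longrightarrow> 0 \<le> p \<longrightarrow> l' + p \<le> l \<longrightarrow>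
        res (hat (outp X)) (l' + d, 0, l' + e) (q l' (res (pdom m) (l', p, l) s)) =
        res (hat (outp X)) (l' + d, p, l + d) (res (hat (outp X)) (l + d, 0, l + e) (q l s)))"
    using q s l d by (auto simp: lookahead_def presheafD[OF pre])
qed

lemma eps_inertial_mono:
  assumes "psh_box X" "mach X m" "0 \<le> d" "d \<le> e" "eps_inertial_machine e X m"
  shows "eps_inertial_machine d X m"
proof -
  have e: "0 \<le> e" using assms by simp
  then obtain q where "lookahead e X m q" using assms by (auto simp: eps_inertial_machine_iff[OF assms(1,2) e])
  then show ?thesis
    using lookahead_mono[OF assms(1) _ assms(2-4)] by (auto simp: eps_inertial_machine_iff[OF assms(1,2,3)])
qed

lemma inertial_machine_iff:
  "psh_box X \<Longrightarrow> mach X m \<Longrightarrow> inertial_machine X m \<longleftrightarrow> (\<exists>e > 0. eps_inertial_machine e X m)"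
  by (auto simp: inertial_machine_def eps_inertial_machine_def inertial_map_def)

section \<open>The subalgebras of inertial machines and their union\<close>

lemma eps_inertial_subalgebra:
  assumes e: "0 \<le> e"
  shows "subalgebra IntW Mch (eps_inertial_machine e)"
  unfolding subalgebra_def
proof (intro conjI ballI impI Mch_lax_algebra; unfold Mch_simps wiring_simps Obj_sl mem_Collect_eq)
  fix \<phi> :: "'a psh wd" and m assume "psh_wd \<phi>" and m: "mach (wsrc \<phi>) m" and i: "eps_inertial_machine e (wsrc \<phi>) m"
  then have \<phi>: "\<phi> \<in> hom IntW (wsrc \<phi>) (wtrg \<phi>)" by (simp add: hom_wiring)
  note p = hom_IntWD[OF \<phi>]
  show "eps_inertial_machine e (wtrg \<phi>) (mch_act \<phi> m)"
    using i lookahead_act[OF \<phi> e] eps_inertial_machine_iff[OF p(4) m e]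
      eps_inertial_machine_iff[OF p(5) mach_act[OF \<phi> m] e] by blast
next
  fix X Y :: "'a psh box" and m n assume *: "psh_box X" "psh_box Y" "mach X m" "mach Y n"
    and "eps_inertial_machine e X m" "eps_inertial_machine e Y n"
  then show "eps_inertial_machine e (box_sum X Y) (mch_mu X Y m n)"
    using lookahead_mu[OF * e] eps_inertial_machine_iff[OF *(1,3) e] eps_inertial_machine_iff[OF *(2,4) e]
      eps_inertial_machine_iff[OF is_box_sum[OF *(1,2)] mach_mu[OF *] e] by blast
next
  show "eps_inertial_machine e box_empty (mch_eta :: 'a pmap)"
    using lookahead_eta[OF e] eps_inertial_machine_iff[OF is_box_empty mach_eta e] by blast
qed

lemma inertial_subalgebra: "subalgebra IntW Mch inertial_machine"
  unfolding subalgebra_def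
proof (intro conjI ballI impI Mch_lax_algebra; unfold Mch_simps wiring_simps Obj_sl mem_Collect_eq)
  fix \<phi> :: "'a psh wd" and m assume w: "psh_wd \<phi>" and m: "mach (wsrc \<phi>) m" and i: "inertial_machine (wsrc \<phi>) m"
  then have \<phi>: "\<phi> \<in> hom IntW (wsrc \<phi>) (wtrg \<phi>)" by (simp add: hom_wiring)
  note p = hom_IntWD[OF \<phi>]
  obtain e where e: "0 < e" "eps_inertial_machine e (wsrc \<phi>) m" using i inertial_machine_iff[OF p(4) m] by blast
  have "eps_inertial_machine e (wtrg \<phi>) (mch_act \<phi> m)"
    using subalgebraD(1)[OF eps_inertial_subalgebra \<phi>, unfolded Mch_simps Obj_sl, OF _ m] e by simp
  then show "inertial_machine (wtrg \<phi>) (mch_act \<phi> m)"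
    using inertial_machine_iff[OF p(5) mach_act[OF \<phi> m]] e(1) by blast
next
  fix X Y :: "'a psh box" and m n assume *: "psh_box X" "psh_box Y" "mach X m" "mach Y n"
    and i: "inertial_machine X m" "inertial_machine Y n"
  obtain d e where de: "0 < d" "eps_inertial_machine d X m" "0 < e" "eps_inertial_machine e Y n"
    using i inertial_machine_iff[OF *(1,3)] inertial_machine_iff[OF *(2,4)] by blast
  \<comment> \<open>The factors may be inertial with different constants; both are inertial for the
    smaller one.\<close>
  define c where "c = min d e"
  have c: "0 < c" "c \<le> d" "c \<le> e" using de by (auto simp: c_def)
  have "eps_inertial_machine c X m" "eps_inertial_machine c Y n"
    using eps_inertial_mono[OF *(1,3) _ c(2) de(2)] eps_inertial_mono[OF *(2,4) _ c(3) de(4)] c by simp_all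
  then have "eps_inertial_machine c (box_sum X Y) (mch_mu X Y m n)"
    using subalgebraD(2)[OF eps_inertial_subalgebra, unfolded Mch_simps wiring_simps Obj_sl mem_Collect_eq, OF _ *] c
    by simp
  then show "inertial_machine (box_sum X Y) (mch_mu X Y m n)"
    using inertial_machine_iff[OF is_box_sum[OF *(1,2)] mach_mu[OF *]] c(1) by blast
next
  show "inertial_machine box_empty (mch_eta :: 'a pmap)"
    \<comment> \<open>The unit machine is inertial for every constant; 1 is an arbitrary positive
      choice.\<close>
    using subalgebraD(3)[OF eps_inertial_subalgebra[of 1], unfolded Mch_simps wiring_simps]
      inertial_machine_iff[OF is_box_empty mach_eta] zero_less_one zero_le_one by blast
qed

text \<open>An index grows as its constant shrinks, so \<open>P_mono\<close> is monotonicity in the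
  constant and a bound of two indices is their minimum.\<close>

lemma inertial_directed_union:
  "directed_union IntW Mch {e. 0 < e} (\<lambda>e d. d \<le> e) eps_inertial_machine (inertial_machine :: 'a psh box \<Rightarrow> _)"
proof unfold_locales
  fix d e :: real and X :: "'a psh box" and A assume "e \<in> {e. 0 < e}" "d \<in> {e. 0 < e}" "d \<le> e" "X \<in> Obj IntW"
    "A \<in> Obj (fib Mch X)" "eps_inertial_machine e X A"
  then show "eps_inertial_machine d X A" using eps_inertial_mono[of X A d e] by (simp add: mach_def)
next
  fix d e :: real assume "e \<in> {e. 0 < e}" "d \<in> {e. 0 < e}"
  then show "\<exists>k \<in> {e. 0 < e}. k \<le> e \<and> k \<le> d" by (intro bexI[of _ "min d e"]) auto
next
  fix X :: "'a psh box" and A assume "X \<in> Obj IntW" "A \<in> Obj (fib Mch X)"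
  then show "inertial_machine X A \<longleftrightarrow> (\<exists>e \<in> {e. 0 < e}. eps_inertial_machine e X A)"
    using inertial_machine_iff[of X A] by (auto simp: mach_def)
qed (auto simp: eps_inertial_subalgebra inertial_subalgebra intro: exI[of _ 1])

theorem proposition4p3p1:
  shows "subalgebra IntW (Mch :: ('a psh box, 'a psh wd, 'a pmap, _) alg) inertial_machine \<and>
    (\<forall>\<epsilon> > 0. subalgebra IntW (Mch :: ('a psh box, 'a psh wd, 'a pmap, _) alg)
       (eps_inertial_machine \<epsilon>)) \<and>
    alg_colimit TYPE('p \<times> 'n) IntW {\<epsilon>. 0 < \<epsilon>} (\<lambda>\<epsilon> \<delta>. \<delta> \<le> \<epsilon>)
      Mch_eps (\<lambda>\<epsilon> \<delta>. sub_incl IntW Mch)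
      (Mch_in :: ('a psh box, 'a psh wd, 'a pmap, _) alg) (\<lambda>\<epsilon>. sub_incl IntW Mch)"
proof (intro conjI allI impI)
  interpret directed_union "IntW :: ('a psh box, 'a psh wd) smcat" Mch "{e. 0 < e}" "\<lambda>e d. d \<le> e"
    eps_inertial_machine inertial_machine
    by (rule inertial_directed_union)
  show "alg_colimit TYPE('p \<times> 'n) IntW {\<epsilon>. 0 < \<epsilon>} (\<lambda>\<epsilon> \<delta>. \<delta> \<le> \<epsilon>)
      Mch_eps (\<lambda>\<epsilon> \<delta>. sub_incl IntW Mch)
      (Mch_in :: ('a psh box, 'a psh wd, 'a pmap, _) alg) (\<lambda>\<epsilon>. sub_incl IntW Mch)"
    using directed_union_colimit unfolding Mch_eps_def[abs_def] Mch_in_def .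
qed (simp_all add: eps_inertial_subalgebra inertial_subalgebra)

end
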